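(* Let $n\ge2$, $u_->0$ and $u_+=0$. For any $\rho_+>0$ there exist positive constants $\epsilon_0$, $\nu_0$ and $C$, independent of $\mu\in(0,1]$ (and of $u_-,\rho_-$), such that the following hold, where $\epsilon=\rho_-u_-$. (I) If $|u_-|+|\rho_--\rho_+|\le\epsilon_0$, there exists a unique smooth solution $(\rho^E,u^E)$ of the stationary Euler problem (E) described in the context with boundary condition $\rho^E(r_0)u^E(r_0)=\rho_-u_-$, and it satisfies $$|\rho^E(r)-\rho_+|\le C r^{-2(n-1)}|u_-|^2,\qquad C^{-1}r^{-(n-1)}|u_-|\le |u^E(r)|\le C r^{-(n-1)}|u_-|,\qquad r\ge r_0.$$ (II) If $|\rho_--\rho_+|+|u_-|\le\epsilon_0$, there exists a unique smooth solution $(\rho^B,u^B)$ of the boundary layer problem (BL) described in the context (with $(\rho^E,u^E)$ as in (I)), and it satisfies, for $y\ge0$, $$|\rho^B(y)-\rho^E(r_0)|\le Ce^{-\frac{\nu_0}{\epsilon}y}(|u_-|^2+|\rho_--\rho_+|),\qquad |u^B(y)-u^E(r_0)|\le Ce^{-\frac{\nu_0}{\epsilon}y}(|u_-|^2+|\rho_--\rho_+|).$$ (III) If $|\rho_--\rho_+|+|u_-|\le\epsilon_0$, then for $\mu\in(0,1]$ the solution $(\rho,u)$ of the stationary Navier-Stokes problem (NS) described in the context converges uniformly, as $\mu\to0$, to a linear superposition of the boundary layer solution $(\rho^B,u^B)$ and the Euler solution $(\rho^E,u^E)$; more precisely, for every $\alpha\in(0,1)$, $$\sup_{r\ge r_0}\Big|\rho(r)-\rho^E(r)-\rho^B\Big(\frac{r-r_0}{\mu}\Big)+\rho^E(r_0)\Big|\le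 C\mu^\alpha,\qquad \sup_{r\ge r_0}\Big|u(r)-u^E(r)-u^B\Big(\frac{r-r_0}{\mu}\Big)+u^E(r_0)\Big|\le C\mu^\alpha,$$ where here $C$ also depends on $\alpha$.
   Context: Fix $r_0>0$, an integer $n\ge2$, and a smooth pressure function $p=p(\rho)$ on $\rho>0$ with $p'(\rho)>0$ for all $\rho>0$. Densities (including the boundary datum $\rho_->0$) are positive. $\mu>0$ is a viscosity constant. Constants may depend on $n,r_0,p,\rho_+$. Problem (NS) (radially symmetric stationary barotropic Navier-Stokes, inflow case $u_->0$, with $u_+=0$): find $(\rho,u)(r)$, $\rho>0$, with $$(r^{n-1}\rho u)_r=0,\qquad \rho u u_r+p(\rho)_r=\mu\Big(\frac{(r^{n-1}u)_r}{r^{n-1}}\Big)_r,\quad r>r_0,$$ $$\lim_{r\to\infty}(\rho,u)(r)=(\rho_+,0),\qquad (\rho,u)(r_0)=(\rho_-,u_-).$$ Known fact (earlier work): for each $\rho_+>0$ there are positive constants, which can be taken uniform in $\mu\in(0,1]$, such that for $|u_-|+|\rho_--\rho_+|$ sufficiently small (NS) has a unique smooth solution $(\rho,u)$ satisfying $|\rho(r)-\rho_+|\le Cr^{-(n-1)}(|u_-|^2+|\rho_--\rho_+|)$ and $C^{-1}r^{-(n-1)}|u_-|\le|u(r)|\le Cr^{-(n-1)}|u_-|$ for $r\ge r_0$. "The solution $(\rho,u)$ of (NS)" means this solution. Problem (E) (stationary Euler): find $(\rho^E,u^E)(r)$, $\rho^E>0$, with $$(r^{n-1}\rho^Eu^E)_r=0,\qquad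 \rho^Eu^Eu^E_r+p(\rho^E)_r=0,\quad r>r_0,\qquad \lim_{r\to\infty}(\rho^E,u^E)(r)=(\rho_+,0).$$ Problem (BL) (boundary layer): find $(\rho^B,u^B)(y)$, $\rho^B>0$, with $$(\rho^Bu^B)_y=0,\qquad \rho^Bu^Bu^B_y+p(\rho^B)_y=u^B_{yy},\quad y>0,$$ $$\lim_{y\to\infty}(\rho^B,u^B)(y)=(\rho^E(r_0),u^E(r_0)),\qquad (\rho^B,u^B)(0)=(\rho_-,u_-).$$ *)

theory Defs
  imports "HOL-Analysis.Analysis"
begin

text \<open>
  \<open>C\<^sup>\<infinity>\<close> regularity on a set of reals. \<open>D k\<close> is the k-th derivative; derivatives are taken
  relative to \<open>S\<close>, so on a closed half-line \<open>{a..}\<close> they are one-sided at \<open>a\<close> and the definition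
  expresses smoothness up to the boundary.
\<close>
definition smooth_on :: "real set \<Rightarrow> (real \<Rightarrow> real) \<Rightarrow> bool" where
  "smooth_on S f \<longleftrightarrow>
    (\<exists>D :: nat \<Rightarrow> real \<Rightarrow> real.
      (\<forall>x\<in>S. D 0 x = f x) \<and>
      (\<forall>k. \<forall>x\<in>S. (D k has_real_derivative D (Suc k) x) (at x within S)))"

text \<open>
  The differential equations below are imposed at interior points only, where smoothness makes
  every \<^const>\<open>deriv\<close> a genuine derivative. Solutions are functions on the whole real line whose
  values left of the domain are irrelevant.
\<close>

definition ns_solution ::
  "(real \<Rightarrow> real) \<Rightarrow> nat \<Rightarrow> real \<Rightarrow> real \<Rightarrow> real \<Rightarrow> real \<Rightarrow> real \<Rightarrow>
   (real \<Rightarrow> real) \<Rightarrow> (real \<Rightarrow> real) \<Rightarrow> bool" where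
  "ns_solution p n r0 \<mu> \<rho>_plus \<rho>_minus u_minus \<rho> u \<longleftrightarrow>
    smooth_on {r0..} \<rho> \<and> smooth_on {r0..} u \<and>
    (\<forall>r\<ge>r0. \<rho> r > 0) \<and>
    (\<forall>r>r0. deriv (\<lambda>s. s ^ (n - 1) * \<rho> s * u s) r = 0) \<and>
    (\<forall>r>r0. \<rho> r * u r * deriv u r + deriv (\<lambda>s. p (\<rho> s)) r
             = \<mu> * deriv (\<lambda>s. deriv (\<lambda>t. t ^ (n - 1) * u t) s / s ^ (n - 1)) r) \<and>
    (\<rho> \<longlongrightarrow> \<rho>_plus) at_top \<and> (u \<longlongrightarrow> 0) at_top \<and>
    \<rho> r0 = \<rho>_minus \<and> u r0 = u_minus"

definition euler_solution ::
  "(real \<Rightarrow> real) \<Rightarrow> nat \<Rightarrow> real \<Rightarrow> real \<Rightarrow>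
   (real \<Rightarrow> real) \<Rightarrow> (real \<Rightarrow> real) \<Rightarrow> bool" where
  "euler_solution p n r0 \<rho>_plus \<rho>E uE \<longleftrightarrow>
    smooth_on {r0..} \<rho>E \<and> smooth_on {r0..} uE \<and>
    (\<forall>r\<ge>r0. \<rho>E r > 0) \<and>
    (\<forall>r>r0. deriv (\<lambda>s. s ^ (n - 1) * \<rho>E s * uE s) r = 0) \<and>
    (\<forall>r>r0. \<rho>E r * uE r * deriv uE r + deriv (\<lambda>s. p (\<rho>E s)) r = 0) \<and>
    (\<rho>E \<longlongrightarrow> \<rho>_plus) at_top \<and> (uE \<longlongrightarrow> 0) at_top"

text \<open>
  The far-field state \<open>(\<rho>_inf, u_inf)\<close> is to be instantiated with the Euler solution at \<open>r0\<close>.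
\<close>
definition bl_solution ::
  "(real \<Rightarrow> real) \<Rightarrow> real \<Rightarrow> real \<Rightarrow> real \<Rightarrow> real \<Rightarrow>
   (real \<Rightarrow> real) \<Rightarrow> (real \<Rightarrow> real) \<Rightarrow> bool" where
  "bl_solution p \<rho>_inf u_inf \<rho>_minus u_minus \<rho>B uB \<longleftrightarrow>
    smooth_on {0..} \<rho>B \<and> smooth_on {0..} uB \<and>
    (\<forall>y\<ge>0. \<rho>B y > 0) \<and>
    (\<forall>y>0. deriv (\<lambda>z. \<rho>B z * uB z) y = 0) \<and>
    (\<forall>y>0. \<rho>B y * uB y * deriv uB y + deriv (\<lambda>z. p (\<rho>B z)) y = deriv (deriv uB) y) \<and>
    (\<rho>B \<longlongrightarrow> \<rho>_inf) at_top \<and> (uB \<longlongrightarrow> u_inf) at_top \<and>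
    \<rho>B 0 = \<rho>_minus \<and> uB 0 = u_minus"

end

theory Submission
  imports Defs
begin

text \<open>
  In terms of the specific volume \<open>v = 1 / \<rho>\<close>, conservation of mass reads \<open>u = \<epsilon> \<theta> v\<close> with
  \<open>\<theta> r = (r0 / r)\<^sup>m\<close> and \<open>m = n - 1\<close>, and all three problems become first-order equations governed by
  \<open>q v = p (1 / v)\<close>, which is strictly decreasing near the far-field state: integrating the momentum
  equation from \<open>r\<close> to infinity gives
  \<open>\<mu> \<epsilon> \<theta> v' = q v - q a + \<epsilon>\<^sup>2 \<theta>\<^sup>2 v - N\<close>, where \<open>N\<close> is an integral of \<open>v\<close>; the Euler equation is the
  case \<open>\<mu> = 0\<close>, solved explicitly by Bernoulli's law, and the boundary layer solves the scalar equation
  \<open>\<epsilon> v' = \<epsilon>\<^sup>2 (v - v\<^sub>\<infinity>) + q v - q v\<^sub>\<infinity>\<close>, along which \<open>v - v\<^sub>\<infinity>\<close> decays exponentially.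
  The difference \<open>w\<close> between the Navier-Stokes solution and the superposition vanishes at \<open>r0\<close> and at
  infinity. At a point where \<open>\<bar>w\<bar>\<close> is maximal the term \<open>w'\<close> drops out, and since \<open>N\<close> contributes only
  \<open>O(\<epsilon>\<^sup>2 sup \<bar>w\<bar>)\<close>, the strict monotonicity of \<open>q\<close> yields \<open>\<bar>w\<bar> = O(\<mu>)\<close>, which is better than \<open>O(\<mu>\<^sup>\<alpha>)\<close>.
\<close>

subsection \<open>Smooth functions\<close>

text \<open>The planar layer freezes the radial coefficients at \<open>r0\<close>, where \<theta> is
  1 and the Euler state is \<open>vE r0\<close>, so the superposition does not solve the radial
  equation. Every mismatch caused by the freezing carries a factor r - r0 times the layer amplitude
  |b|; since the layer has width of order \<epsilon> \<mu>, this product is O(\<epsilon> \<mu>)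
  uniformly in r. The nonlocal term is controlled because m \<theta>^2 / s is exactly the derivative
  of -\<theta>^2 / 2: an error of size W in v changes \<open>N\<close> by at most \<epsilon>^2 W /
  2, apart from the share of the layer, and smallness of \<epsilon>^2 against \<open>c\<close>
  absorbs it. Only the sign of p' is given, so the bounds \<open>c\<close>, \<open>L\<close>,
  \<open>M\<close> on \<open>q\<close> hold merely for |v - a| \<le> \<eta>. Solutions are arbitrary
  at the outset, so each kind is first confined to that interval: viscous flows and layers by a
  barrier, inviscid flows, whose equation is algebraic in v, by the intermediate value theorem from
  infinity. Euler uniqueness rests on Bernoulli's law because that law is local in v, unlike the
  integrated equation with \<open>N\<close>.\<close>

text \<open>A choice function picking derivatives inside \<open>A\<close> can be iterated forever,
  and its iterates are the successive derivatives. Smoothness thus becomes a closure property of a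
  family of functions.\<close>

lemma smooth_on_closed_set:
  assumes A: "\<And>f. f \<in> A \<Longrightarrow> \<exists>g\<in>A. \<forall>x\<in>S. (f has_real_derivative g x) (at x within S)"
    and f: "f \<in> A"
  shows "smooth_on S f"
proof -
  obtain d where d: "\<And>f. f \<in> A \<Longrightarrow> d f \<in> A \<and> (\<forall>x\<in>S. (f has_real_derivative d f x) (at x within S))"
    using A by metis
  have "(d ^^ k) f \<in> A" for k
    using f d by (induction k) auto
  then show ?thesis
    unfolding smooth_on_def using d
    by (intro exI[of _ "\<lambda>k. (d ^^ k) f"]) auto
qed

lemma smooth_on_derivative:
  assumes "smooth_on S f"
  obtains f' where "smooth_on S f'" "\<And>x. x \<in> S \<Longrightarrow> (f has_real_derivative f' x) (at x within S)"
proof -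
  obtain D where D: "\<forall>x\<in>S. D 0 x = f x"
      "\<forall>k. \<forall>x\<in>S. (D k has_real_derivative D (Suc k) x) (at x within S)"
    using assms unfolding smooth_on_def by blast
  have "(f has_real_derivative D 1 x) (at x within S)" if "x \<in> S" for x
  proof (rule has_field_derivative_transform_within[of "D 0" _ _ _ 1])
    show "(D 0 has_real_derivative D 1 x) (at x within S)"
      using D(2)[rule_format, of x 0] that by simp
  qed (use D(1) that in auto)
  moreover have "smooth_on S (D 1)"
    unfolding smooth_on_def using D(2) by (intro exI[of _ "\<lambda>k. D (Suc k)"]) auto
  ultimately show ?thesis using that by blast
qed

lemma smooth_on_continuous: "smooth_on S f \<Longrightarrow> continuous_on S f"
  by (metis DERIV_continuous_on smooth_on_derivative)

lemma smooth_on_cong: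
  assumes "smooth_on S f" "\<And>x. x \<in> S \<Longrightarrow> g x = f x"
  shows "smooth_on S g"
  using assms unfolding smooth_on_def by simp

lemma smooth_on_subset:
  assumes "smooth_on S f" "T \<subseteq> S"
  shows "smooth_on T f"
proof (rule smooth_on_closed_set)
  fix f assume "f \<in> {f. smooth_on S f}"
  then show "\<exists>g\<in>{f. smooth_on S f}. \<forall>x\<in>T. (f has_real_derivative g x) (at x within T)"
    using assms(2) smooth_on_derivative[of S f] DERIV_subset
    by (smt (verit) mem_Collect_eq subsetD)
qed (use assms in simp)

lemma smooth_on_const: "smooth_on S (\<lambda>x. k)"
proof (rule smooth_on_closed_set)
  fix f :: "real \<Rightarrow> real" assume "f \<in> {\<lambda>x. k, \<lambda>x. 0}"
  then have "\<forall>x\<in>S. (f has_real_derivative 0) (at x within S)"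
    by auto
  then show "\<exists>g\<in>{\<lambda>x. k, \<lambda>x. 0}. \<forall>x\<in>S. (f has_real_derivative g x) (at x within S)"
    by (intro bexI[where x = "\<lambda>x. 0"]) auto
qed simp

lemma smooth_on_ident: "smooth_on S (\<lambda>x. x)"
proof (rule smooth_on_closed_set[of "insert (\<lambda>x. x) {f. smooth_on S f}"])
  fix f assume f: "f \<in> insert (\<lambda>x. x) {f. smooth_on S f}"
  show "\<exists>g\<in>insert (\<lambda>x. x) {f. smooth_on S f}.
      \<forall>x\<in>S. (f has_real_derivative g x) (at x within S)"
  proof (cases "f = (\<lambda>x. x)")
    case True
    have "\<forall>x\<in>S. ((\<lambda>x. x) has_real_derivative (1::real)) (at x within S)"
      by simp
    then show ?thesis
      using smooth_on_const[of S 1] unfolding True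
      by (intro bexI[where x = "\<lambda>x. 1"]) auto
  next
    case False
    then show ?thesis
      using f smooth_on_derivative[of S f] by (metis insert_iff mem_Collect_eq)
  qed
qed simp

text \<open>The Leibniz and chain rules lead out of a family of generators but not out of the sums
  and products of its members. It is therefore enough to differentiate generators, with derivatives
  allowed anywhere in the generated algebra.\<close>

inductive_set algebra_of :: "(real \<Rightarrow> real) set \<Rightarrow> (real \<Rightarrow> real) set" for G where
  gen: "f \<in> G \<Longrightarrow> f \<in> algebra_of G"
| add: "f \<in> algebra_of G \<Longrightarrow> g \<in> algebra_of G \<Longrightarrow> (\<lambda>x. f x + g x) \<in> algebra_of G"
| mult: "f \<in> algebra_of G \<Longrightarrow> g \<in> algebra_of G \<Longrightarrow> (\<lambda>x. f x * g x) \<in> algebra_of G"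

lemma smooth_on_algebra_of:
  assumes G: "\<And>f. f \<in> G \<Longrightarrow> \<exists>g\<in>algebra_of G. \<forall>x\<in>S. (f has_real_derivative g x) (at x within S)"
    and f: "f \<in> algebra_of G"
  shows "smooth_on S f"
proof (rule smooth_on_closed_set[OF _ f])
  fix f assume "f \<in> algebra_of G"
  then show "\<exists>g\<in>algebra_of G. \<forall>x\<in>S. (f has_real_derivative g x) (at x within S)"
  proof induction
    case (gen f)
    then show ?case by (rule G)
  next
    case (add f g)
    then obtain f' g' where *: "f' \<in> algebra_of G" "g' \<in> algebra_of G"
      "\<forall>x\<in>S. (f has_real_derivative f' x) (at x within S)"
      "\<forall>x\<in>S. (g has_real_derivative g' x) (at x within S)" by blast
    show ?case
      using * by (intro bexI[of _ "\<lambda>x. f' x + g' x"] algebra_of.add)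
        (auto intro!: derivative_eq_intros)
  next
    case (mult f g)
    then obtain f' g' where *: "f' \<in> algebra_of G" "g' \<in> algebra_of G"
      "\<forall>x\<in>S. (f has_real_derivative f' x) (at x within S)"
      "\<forall>x\<in>S. (g has_real_derivative g' x) (at x within S)" by blast
    show ?case
      using * mult.hyps by (intro bexI[of _ "\<lambda>x. f' x * g x + f x * g' x"] algebra_of.add algebra_of.mult)
        (auto intro!: derivative_eq_intros)
  qed
qed

lemma smooth_on_add_mult:
  assumes "smooth_on S f" "smooth_on S g"
  shows smooth_on_add: "smooth_on S (\<lambda>x. f x + g x)"
    and smooth_on_mult: "smooth_on S (\<lambda>x. f x * g x)"
proof -
  let ?G = "{f. smooth_on S f}"
  have *: "\<exists>g\<in>algebra_of ?G. \<forall>x\<in>S. (f has_real_derivative g x) (at x within S)" if "f \<in> ?G" for f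
    using that smooth_on_derivative[of S f] by (metis algebra_of.gen mem_Collect_eq)
  have fg: "f \<in> algebra_of ?G" "g \<in> algebra_of ?G"
    using assms by (auto intro: algebra_of.gen)
  show "smooth_on S (\<lambda>x. f x + g x)"
    by (rule smooth_on_algebra_of[OF * algebra_of.add[OF fg]])
  show "smooth_on S (\<lambda>x. f x * g x)"
    by (rule smooth_on_algebra_of[OF * algebra_of.mult[OF fg]])
qed

lemma smooth_on_diff:
  assumes "smooth_on S f" "smooth_on S g"
  shows "smooth_on S (\<lambda>x. f x - g x)"
  using smooth_on_add[OF assms(1) smooth_on_mult[OF smooth_on_const[of S "-1"] assms(2)]] by simp

lemma smooth_on_power: "smooth_on S f \<Longrightarrow> smooth_on S (\<lambda>x. f x ^ k)"
  by (induction k) (auto intro: smooth_on_const smooth_on_mult)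

text \<open>The derivative of 1/f is -f' (1/f)^2, a polynomial in the reciprocal itself and smooth
  functions.\<close>

lemma smooth_on_inverse:
  assumes "smooth_on S f" "\<And>x. x \<in> S \<Longrightarrow> f x \<noteq> 0"
  shows "smooth_on S (\<lambda>x. inverse (f x))"
proof -
  let ?i = "\<lambda>x. inverse (f x)"
  let ?G = "insert ?i {f. smooth_on S f}"
  obtain f' where f': "smooth_on S f'" "\<And>x. x \<in> S \<Longrightarrow> (f has_real_derivative f' x) (at x within S)"
    using smooth_on_derivative[OF assms(1)] by blast
  have "\<exists>g\<in>algebra_of ?G. \<forall>x\<in>S. (h has_real_derivative g x) (at x within S)" if h: "h \<in> ?G" for h
  proof (cases "h = ?i")
    case True
    have "(\<lambda>x. (- 1 * f' x) * (?i x * ?i x)) \<in> algebra_of ?G"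
      using smooth_on_mult[OF smooth_on_const[of S "-1"] f'(1)]
      by (intro algebra_of.mult algebra_of.gen) auto
    moreover have "\<forall>x\<in>S. (?i has_real_derivative (- 1 * f' x) * (?i x * ?i x)) (at x within S)"
      using f' assms(2) by (auto intro!: derivative_eq_intros)
    ultimately show ?thesis
      unfolding True by (intro bexI[where x = "\<lambda>x. (- 1 * f' x) * (?i x * ?i x)"])
  next
    case False
    then show ?thesis
      using h smooth_on_derivative[of S h] by (metis algebra_of.gen insert_iff mem_Collect_eq)
  qed
  then show ?thesis
    by (rule smooth_on_algebra_of) (auto intro: algebra_of.gen)
qed

lemma smooth_on_divide:
  assumes "smooth_on S f" "smooth_on S g" "\<And>x. x \<in> S \<Longrightarrow> g x \<noteq> 0"
  shows "smooth_on S (\<lambda>x. f x / g x)"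
  unfolding divide_inverse by (intro smooth_on_mult smooth_on_inverse assms)

lemma smooth_on_compose:
  assumes g: "smooth_on T g" and f: "smooth_on S f" and T: "f ` S \<subseteq> T"
  shows "smooth_on S (\<lambda>x. g (f x))"
proof -
  let ?H = "{\<lambda>x. h (f x) |h. smooth_on T h}"
  let ?G = "?H \<union> {f. smooth_on S f}"
  obtain f' where f': "smooth_on S f'" "\<And>x. x \<in> S \<Longrightarrow> (f has_real_derivative f' x) (at x within S)"
    using smooth_on_derivative[OF f] by blast
  have "\<exists>g\<in>algebra_of ?G. \<forall>x\<in>S. (k has_real_derivative g x) (at x within S)" if k: "k \<in> ?G" for k
  proof (cases "k \<in> ?H")
    case True
    then obtain h where h: "k = (\<lambda>x. h (f x))" "smooth_on T h" by blast
    obtain h' where h': "smooth_on T h'" "\<And>x. x \<in> T \<Longrightarrow> (h has_real_derivative h' x) (at x within T)"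
      using smooth_on_derivative[OF h(2)] by blast
    have "(k has_real_derivative h' (f x) * f' x) (at x within S)" if "x \<in> S" for x
      unfolding h(1) using DERIV_image_chain[of h "h' (f x)" f x S "f' x"]
        DERIV_subset[OF h'(2) T] f'(2)[OF that] T that by (auto simp: o_def)
    moreover have "(\<lambda>x. h' (f x) * f' x) \<in> algebra_of ?G"
      by (intro algebra_of.mult algebra_of.gen) (use h' f' in auto)
    ultimately show ?thesis
      by (intro bexI[where x = "\<lambda>x. h' (f x) * f' x"]) auto
  next
    case False
    then show ?thesis
      using k smooth_on_derivative[of S k] by (metis (no_types, lifting) algebra_of.gen Un_iff mem_Collect_eq)
  qed
  then show ?thesis
    by (rule smooth_on_algebra_of) (use g in \<open>auto intro!: algebra_of.gen\<close>)
qed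

text \<open>Along a solution, \<open>h (f x)\<close> has derivative
  \<open>h' (f x) * g (f x)\<close>, which is again a smooth function of \<open>f x\<close>. The
  compositions with \<open>f\<close> thus form a closed family, and a single derivative of
  \<open>f\<close> bootstraps to all orders.\<close>

lemma smooth_on_autonomous_ode:
  assumes g: "smooth_on T g" and T: "f ` S \<subseteq> T"
    and f: "\<And>x. x \<in> S \<Longrightarrow> (f has_real_derivative g (f x)) (at x within S)"
  shows "smooth_on S f"
proof (rule smooth_on_closed_set[of "{\<lambda>x. h (f x) |h. smooth_on T h}"])
  fix k assume "k \<in> {\<lambda>x. h (f x) |h. smooth_on T h}"
  then obtain h where h: "k = (\<lambda>x. h (f x))" "smooth_on T h" by blast
  obtain h' where h': "smooth_on T h'" "\<And>x. x \<in> T \<Longrightarrow> (h has_real_derivative h' x) (at x within T)"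
    using smooth_on_derivative[OF h(2)] by blast
  have "(k has_real_derivative h' (f x) * g (f x)) (at x within S)" if "x \<in> S" for x
    unfolding h(1) using DERIV_image_chain[of h "h' (f x)" f x S "g (f x)"]
      DERIV_subset[OF h'(2) T] f[OF that] T that by (auto simp: o_def)
  with smooth_on_mult[OF h'(1) g]
  show "\<exists>g\<in>{\<lambda>x. h (f x) |h. smooth_on T h}. \<forall>x\<in>S. (k has_real_derivative g x) (at x within S)"
    by (intro bexI[of _ "\<lambda>x. h' (f x) * g (f x)"]) auto
next
  show "f \<in> {\<lambda>x. h (f x) |h. smooth_on T h}"
    using smooth_on_ident[of T] by auto
qed

subsection \<open>Differential inequalities on a half-line\<close>

lemma mean_value:
  fixes f :: "real \<Rightarrow> real"
  assumes "a < b" "continuous_on {a..b} f"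
    and "\<And>x. a < x \<Longrightarrow> x < b \<Longrightarrow> (f has_real_derivative f' x) (at x)"
  obtains z where "a < z" "z < b" "f b - f a = (b - a) * f' z"
proof -
  have "\<And>x. a < x \<Longrightarrow> x < b \<Longrightarrow> f differentiable (at x)"
    using assms(3) real_differentiable_def by blast
  then obtain l z where "a < z" "z < b" "DERIV f z :> l" "f b - f a = (b - a) * l"
    using MVT[OF assms(1,2)] by blast
  with assms(3) that show ?thesis
    using DERIV_unique by blast
qed

lemma nonincreasing_halfline:
  fixes f :: "real \<Rightarrow> real"
  assumes "continuous_on {a..} f"
    and "\<And>x. x > a \<Longrightarrow> (f has_real_derivative f' x) (at x)"
    and "\<And>x. x > a \<Longrightarrow> f' x \<le> 0"
    and "a \<le> x" "x \<le> y"
  shows "f y \<le> f x"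
proof (cases "x = y")
  case False
  then have "x < y" using assms(5) by simp
  moreover have "continuous_on {x..y} f"
    using assms(1) by (rule continuous_on_subset) (use assms(4) in auto)
  ultimately obtain z where "x < z" "f y - f x = (y - x) * f' z"
    by (rule mean_value[of x y f f']) (use assms(2,4) in auto)
  with assms(3)[of z] assms(4) \<open>x < y\<close> show ?thesis
    by (smt (verit) mult_nonneg_nonpos)
qed simp

text \<open>The sign of \<open>w'\<close> is required only in the strip \<open>0 < w < h\<close>,
  since the estimates on \<open>q\<close> are local. After the last point \<open>c\<close> with
  \<open>w c \<le> 0\<close> the function enters this strip by continuity, and the mean value
  theorem forbids it to have risen.\<close>

lemma barrier:
  fixes w :: "real \<Rightarrow> real"
  assumes cont: "continuous_on {a..} w" and init: "w a \<le> 0" and "h > 0"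
    and der: "\<And>x. x > a \<Longrightarrow> (w has_real_derivative w' x) (at x)"
    and sign: "\<And>x. x > a \<Longrightarrow> 0 < w x \<Longrightarrow> w x < h \<Longrightarrow> w' x \<le> 0"
    and "x \<ge> a"
  shows "w x \<le> 0"
proof (rule ccontr)
  assume "\<not> w x \<le> 0"
  define S where "S = {a..x} \<inter> w -` {..0}"
  have contx: "continuous_on {a..x} w"
    using cont by (rule continuous_on_subset) auto
  then have "closed S"
    unfolding S_def by (intro continuous_closed_preimage) auto
  moreover have "bounded S"
    unfolding S_def by (rule bounded_subset[of "{a..x}"]) auto
  moreover have "a \<in> S"
    using init \<open>x \<ge> a\<close> by (auto simp: S_def)
  ultimately obtain c where c: "c \<in> S" "\<And>s. s \<in> S \<Longrightarrow> s \<le> c"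
    using compact_attains_sup[of S] by (auto simp: compact_eq_bounded_closed)
  have cx: "a \<le> c" "c < x" "w c \<le> 0"
    using c(1) \<open>\<not> w x \<le> 0\<close> by (auto simp: S_def less_le)
  have pos: "0 < w s" if "c < s" "s \<le> x" for s
    using c(2)[of s] cx that by (force simp: S_def)
  obtain d where d: "d > 0" "\<And>s. s \<in> {a..x} \<Longrightarrow> dist s c < d \<Longrightarrow> dist (w s) (w c) < h"
    using contx[unfolded continuous_on_iff, rule_format, of c h] \<open>h > 0\<close> cx by auto
  define e where "e = min (c + d / 2) x"
  have e: "c < e" "e \<le> x"
    using d(1) cx by (auto simp: e_def)
  have small: "w s < h" if "c \<le> s" "s \<le> e" for s
    using d(2)[of s] that cx d(1) by (auto simp: e_def dist_real_def)
  have "continuous_on {c..e} w"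
    using contx by (rule continuous_on_subset) (use cx e in auto)
  then obtain z where z: "c < z" "z < e" "w e - w c = (e - c) * w' z"
    by (rule mean_value[OF e(1), of w w']) (use der cx in auto)
  have "w' z \<le> 0"
    using sign[of z] pos[of z] small[of z] z e cx by auto
  then have "w e \<le> w c"
    using z(3) e by (smt (verit) mult_nonneg_nonpos)
  with pos[of e] e cx show False by simp
qed

text \<open>Over a unit interval far out the increment is at least \<open>d\<close>, while both end
  values lie within \<open>d / 3\<close> of the limit. This is how constants of integration are
  identified at infinity.\<close>

lemma derivative_bounded_below_not_convergent:
  fixes f :: "real \<Rightarrow> real"
  assumes lim: "(f \<longlongrightarrow> l) at_top" and "d > 0"
    and der: "\<forall>\<^sub>F x in at_top. (f has_real_derivative f' x) (at x) \<and> f' x \<ge> d"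
  shows False
proof -
  have "\<forall>\<^sub>F x in at_top. \<bar>f x - l\<bar> < d / 3"
    using tendstoD[OF lim, of "d / 3"] \<open>d > 0\<close> by (simp add: dist_real_def)
  with der have "\<forall>\<^sub>F x in at_top. (f has_real_derivative f' x) (at x) \<and> f' x \<ge> d \<and> \<bar>f x - l\<bar> < d / 3"
    by eventually_elim auto
  then obtain R where R: "\<And>x. x \<ge> R \<Longrightarrow> (f has_real_derivative f' x) (at x) \<and> f' x \<ge> d \<and> \<bar>f x - l\<bar> < d / 3"
    unfolding eventually_at_top_linorder by blast
  have "continuous_on {R..R+1} f"
    by (intro continuous_at_imp_continuous_on) (metis DERIV_isCont R atLeastAtMost_iff)
  then obtain z where "R < z" "f (R + 1) - f R = (R + 1 - R) * f' z"
    by (rule mean_value[of R "R + 1" f f', rotated]) (use R in auto)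
  moreover have "d \<le> f' z" "\<bar>f R - l\<bar> < d / 3" "\<bar>f (R + 1) - l\<bar> < d / 3"
    using R[of z] R[of R] R[of "R + 1"] \<open>R < z\<close> by auto
  ultimately show False
    using \<open>d > 0\<close> by simp
qed

lemma nondecreasing_tendsto_upper_bound:
  fixes f :: "real \<Rightarrow> real"
  assumes lim: "(f \<longlongrightarrow> l) at_top"
    and der: "\<And>x. x > a \<Longrightarrow> (f has_real_derivative f' x) (at x)"
    and nonneg: "\<And>x. x > a \<Longrightarrow> f' x \<ge> 0"
    and "x > a"
  shows "f x \<le> l"
proof (rule tendsto_lowerbound[OF lim])
  have "f x \<le> f y" if "y \<ge> x" for y
    by (rule DERIV_nonneg_imp_nondecreasing[OF that]) (meson der nonneg \<open>x > a\<close> less_le_trans)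
  then show "\<forall>\<^sub>F y in at_top. f x \<le> f y"
    unfolding eventually_at_top_linorder by blast
qed simp

lemma abs_attains_max_halfline:
  fixes w :: "real \<Rightarrow> real"
  assumes cont: "continuous_on {a..} w" and "w a = 0" and lim: "(w \<longlongrightarrow> 0) at_top"
    and "b \<ge> a" "w b \<noteq> 0"
  obtains x where "x > a" "w x \<noteq> 0" "\<And>s. s \<ge> a \<Longrightarrow> \<bar>w s\<bar> \<le> \<bar>w x\<bar>"
proof -
  have "\<forall>\<^sub>F s in at_top. \<bar>w s\<bar> < \<bar>w b\<bar>"
    using lim \<open>w b \<noteq> 0\<close> by (auto simp: tendsto_iff dist_real_def)
  then obtain R where R: "\<And>s. s \<ge> R \<Longrightarrow> \<bar>w s\<bar> < \<bar>w b\<bar>"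
    unfolding eventually_at_top_linorder by blast
  have "continuous_on {a..max b R} (\<lambda>s. \<bar>w s\<bar>)"
    using cont by (intro continuous_on_rabs) (auto elim: continuous_on_subset)
  then obtain x where x: "x \<in> {a..max b R}" "\<And>s. s \<in> {a..max b R} \<Longrightarrow> \<bar>w s\<bar> \<le> \<bar>w x\<bar>"
    using continuous_attains_sup[of "{a..max b R}" "\<lambda>s. \<bar>w s\<bar>"] \<open>b \<ge> a\<close>
    by force
  have b: "\<bar>w b\<bar> \<le> \<bar>w x\<bar>"
    using x(2)[of b] \<open>b \<ge> a\<close> by auto
  have "\<bar>w s\<bar> \<le> \<bar>w x\<bar>" if "s \<ge> a" for s
  proof (cases "s \<le> max b R")
    case False
    then have "\<bar>w s\<bar> < \<bar>w b\<bar>"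
      by (intro R) simp
    with b show ?thesis by simp
  qed (use x(2) that in auto)
  moreover have "w x \<noteq> 0" "x > a"
    using b \<open>w b \<noteq> 0\<close> \<open>w a = 0\<close> x(1) by (auto simp: less_le)
  ultimately show ?thesis using that by blast
qed

lemma derivative_zero_at_abs_max:
  fixes w :: "real \<Rightarrow> real"
  assumes der: "(w has_real_derivative d) (at x)" and "x > a"
    and max: "\<And>s. s \<ge> a \<Longrightarrow> \<bar>w s\<bar> \<le> \<bar>w x\<bar>" and "w x \<noteq> 0"
  shows "d = 0"
proof -
  \<comment> \<open>Squaring preserves the order of absolute values and keeps the function
    differentiable. The radius \<open>x - a\<close> below keeps the competitors inside the
    half-line.\<close>
  have "((\<lambda>s. w s ^ 2) has_real_derivative 2 * w x * d) (at x)"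
    using der by (auto intro!: derivative_eq_intros)
  moreover have "\<forall>y. \<bar>x - y\<bar> < x - a \<longrightarrow> w y ^ 2 \<le> w x ^ 2"
    using max by (simp add: abs_le_square_iff[symmetric])
  ultimately have "2 * w x * d = 0"
    using \<open>x > a\<close> by (intro DERIV_local_max[of "\<lambda>s. w s ^ 2" _ x "x - a"]) auto
  with \<open>w x \<noteq> 0\<close> show ?thesis by simp
qed

text \<open>The square of w exp (k y) is nonincreasing. Stating the damping through the product
  \<open>w y * w' y\<close> avoids distinguishing the sign of \<open>w\<close>.\<close>

lemma exp_decay_halfline:
  fixes w :: "real \<Rightarrow> real"
  assumes cont: "continuous_on {0..} w"
    and der: "\<And>y. y > 0 \<Longrightarrow> (w has_real_derivative w' y) (at y)"
    and damp: "\<And>y. y > 0 \<Longrightarrow> w y * w' y \<le> - k * (w y)\<^sup>2"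
    and "y \<ge> 0"
  shows "\<bar>w y\<bar> \<le> \<bar>w 0\<bar> * exp (- k * y)"
proof -
  define f where "f y = (w y * exp (k * y))\<^sup>2" for y
  define f' where "f' y = 2 * (exp (k * y))\<^sup>2 * (w y * w' y + k * (w y)\<^sup>2)" for y
  have "f y \<le> f 0"
  proof (rule nonincreasing_halfline[where a = 0 and f = f and f' = f'])
    show "continuous_on {0..} f"
      unfolding f_def by (intro continuous_intros cont)
    fix y :: real assume "y > 0"
    show "(f has_real_derivative f' y) (at y)"
      unfolding f_def f'_def using der[OF \<open>y > 0\<close>]
      by (auto intro!: derivative_eq_intros simp: power2_eq_square algebra_simps)
    show "f' y \<le> 0"
      unfolding f'_def using damp[OF \<open>y > 0\<close>] by (intro mult_nonneg_nonpos) auto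
  qed (use \<open>y \<ge> 0\<close> in auto)
  then have "\<bar>w y * exp (k * y)\<bar> \<le> \<bar>w 0\<bar>"
    unfolding f_def by (simp only: abs_le_square_iff) simp
  then have "\<bar>w y\<bar> * exp (k * y) \<le> \<bar>w 0\<bar>"
    by (simp add: abs_mult)
  then have "\<bar>w y\<bar> * exp (k * y) * exp (- k * y) \<le> \<bar>w 0\<bar> * exp (- k * y)"
    by (intro mult_right_mono) auto
  then show ?thesis
    by (simp add: mult.assoc flip: exp_add)
qed

lemma exp_decay_tendsto:
  fixes l c :: real
  assumes "l > 0"
  shows "((\<lambda>r. exp (- l * (r - c))) \<longlongrightarrow> 0) at_top"
proof -
  have "filterlim (\<lambda>r. r - c) at_top at_top"
    by (rule filterlim_at_top_mono[OF filterlim_tendsto_add_at_top[OF tendsto_const[of "-c"] filterlim_ident]])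
      auto
  then have "filterlim (\<lambda>r. l * (r - c)) at_top at_top"
    using assms by (rule filterlim_tendsto_pos_mult_at_top[OF tendsto_const, rotated])
  then have "filterlim (\<lambda>r. - (l * (r - c))) at_bot at_top"
    by (rule filterlim_compose[OF filterlim_uminus_at_bot_at_top])
  then show ?thesis
    by (intro filterlim_compose[OF exp_at_bot]) simp
qed

section \<open>Antiderivatives, inverse functions and a scalar damped equation\<close>

lemma continuous_has_antiderivative:
  fixes f :: "real \<Rightarrow> real" and a b :: ereal
  assumes "a < b" "\<And>x. a < x \<Longrightarrow> x < b \<Longrightarrow> isCont f x"
  obtains F where "\<And>x. a < ereal x \<Longrightarrow> x < b \<Longrightarrow> (F has_real_derivative f x) (at x)"
proof -
  obtain F where "\<forall>x::real. a < x \<longrightarrow> x < b \<longrightarrow> (F has_vector_derivative f x) (at x)"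
    using einterval_antiderivative[OF assms] by blast
  then show ?thesis
    using that unfolding has_real_derivative_iff_has_vector_derivative by blast
qed

lemma inverse_has_derivative:
  fixes f g :: "real \<Rightarrow> real"
  assumes "open S" "x \<in> S" "\<And>x. x \<in> S \<Longrightarrow> g (f x) = x"
    and der: "\<And>x. x \<in> S \<Longrightarrow> (f has_real_derivative f' x) (at x)" and "f' x \<noteq> 0"
  shows "(g has_real_derivative inverse (f' x)) (at (f x))"
  unfolding has_field_derivative_def
proof (rule has_derivative_inverse_strong[OF assms(1,2)])
  show "continuous_on S f"
    using der by (intro continuous_at_imp_continuous_on) (auto intro: DERIV_isCont)
  show "(f has_derivative (*) (f' x)) (at x)"
    using der[OF assms(2)] by (simp add: has_field_derivative_def)
  show "(*) (f' x) \<circ> (*) (inverse (f' x)) = id"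
    using \<open>f' x \<noteq> 0\<close> by (auto simp: fun_eq_iff)
qed (use assms(3) in auto)

text \<open>Writing \<open>w = d e\<^sup>-\<^sup>\<tau>\<close>, the equation becomes \<open>\<tau>' = - f w / w\<close>, whose right-hand side
  lies between positive constants, so that the time map \<open>\<tau> \<mapsto> y\<close> can be inverted globally.\<close>
lemma damped_ode_solution:
  fixes f :: "real \<Rightarrow> real"
  assumes cont: "\<And>x. \<bar>x\<bar> \<le> \<bar>d\<bar> \<Longrightarrow> isCont f x" and "f 0 = 0" and "c > 0"
    and damp: "\<And>x. \<bar>x\<bar> \<le> \<bar>d\<bar> \<Longrightarrow> c * x\<^sup>2 \<le> - (x * f x)"
    and bound: "\<And>x. \<bar>x\<bar> \<le> \<bar>d\<bar> \<Longrightarrow> - (x * f x) \<le> L * x\<^sup>2"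
  obtains w where "w 0 = d" "\<And>y. y \<ge> 0 \<Longrightarrow> (w has_real_derivative f (w y)) (at y)"
    "\<And>y. y \<ge> 0 \<Longrightarrow> \<bar>w y\<bar> \<le> \<bar>d\<bar>"
proof (cases "d = 0")
  case True
  then show ?thesis
    using that[of "\<lambda>_. 0"] \<open>f 0 = 0\<close> by simp
next
  case False
  \<comment> \<open>Freezing the curve for negative t keeps |x t| \<le> |d| everywhere, which is the
    region where \<open>f\<close> is controlled. The time map \<open>Y\<close> is thereby defined on
    the whole line and becomes a bijection of it.\<close>
  define x where "x t = d * exp (- max t 0)" for t :: real
  have x: "\<bar>x t\<bar> \<le> \<bar>d\<bar>" "x t \<noteq> 0" for t
    using False by (auto simp: x_def abs_mult mult_le_cancel_left1)
  define \<phi> where "\<phi> t = - (f (x t)) / x t" for t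
  have \<phi>_eq: "\<phi> t * (x t)\<^sup>2 = - (x t * f (x t))" for t
    using x(2)[of t] by (simp add: \<phi>_def power2_eq_square)
  have \<phi>: "c \<le> \<phi> t" "\<phi> t \<le> L" for t
    using damp[OF x(1)[of t]] bound[OF x(1)[of t]] x(2)[of t]
    by (auto simp: \<phi>_eq[symmetric])
  have \<phi>_pos: "\<phi> t > 0" for t
    using \<phi>(1)[of t] \<open>c > 0\<close> by simp
  have "L > 0"
    using \<phi>(2)[of 0] \<phi>_pos[of 0] by simp
  have contx: "isCont x t" for t
    unfolding x_def by (intro continuous_intros)
  have "isCont (\<lambda>t. f (x t)) t" for t
    using isCont_o2[OF contx cont[OF x(1)]] .
  then have "isCont (\<lambda>t. 1 / \<phi> t) t" for t
    using x(2)[of t] \<phi>_pos[of t] contx[of t] unfolding \<phi>_def by (intro continuous_intros) auto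
  then obtain F where F: "\<And>t. (F has_real_derivative 1 / \<phi> t) (at t)"
    using continuous_has_antiderivative[of "-\<infinity>" "\<infinity>" "\<lambda>t. 1 / \<phi> t"] by auto
  define Y where "Y t = F t - F 0" for t
  have Y': "(Y has_real_derivative 1 / \<phi> t) (at t)" for t
    unfolding Y_def using F[of t] by (auto intro!: derivative_eq_intros)
  have contY: "continuous_on A Y" for A
    using Y' by (intro continuous_at_imp_continuous_on) (auto intro: DERIV_isCont)
  have grow: "Y t - Y s \<ge> (t - s) / L" if st: "s < t" for s t
  proof -
    obtain z where z: "Y t - Y s = (t - s) * (1 / \<phi> z)"
    proof (rule mean_value[of s t Y "\<lambda>t. 1 / \<phi> t"])
      show "s < t" by (rule st)
    qed (use contY Y' in auto)
    have "1 / L \<le> 1 / \<phi> z"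
      using \<phi>(2)[of z] \<phi>_pos[of z] by (simp add: frac_le)
    then have "(t - s) * (1 / L) \<le> (t - s) * (1 / \<phi> z)"
      using that by (intro mult_left_mono) auto
    then show ?thesis unfolding z by simp
  qed
  have mono: "Y s < Y t" if "s < t" for s t
  proof -
    have "(t - s) / L > 0"
      using that \<open>L > 0\<close> by simp
    with grow[OF that] show ?thesis by linarith
  qed
  have "inj Y"
    by (rule linorder_inj_onI') (use mono in force)
  have "Y 0 = 0" by (simp add: Y_def)
  have surj: "\<exists>t. Y t = y" for y
  proof -
    \<comment> \<open>With slope at least 1 / L, the map \<open>Y\<close> passes |y| within
      \<open>?k\<close> units in either direction, so the intermediate value theorem
      applies.\<close>
    let ?k = "L * (\<bar>y\<bar> + 1)"
    have "?k > 0" using \<open>L > 0\<close> by simp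
    have "?k / L = \<bar>y\<bar> + 1" using \<open>L > 0\<close> by simp
    then have "Y (- ?k) \<le> y" "y \<le> Y ?k"
      using grow[of 0 ?k] grow[of "- ?k" 0] \<open>?k > 0\<close> \<open>Y 0 = 0\<close> by auto
    then show ?thesis
      using IVT'[of Y "- ?k" y ?k, OF _ _ _ contY] \<open>?k > 0\<close> by force
  qed
  define g where "g = inv Y"
  have g: "g (Y t) = t" "Y (g y) = y" for t y
    unfolding g_def using \<open>inj Y\<close> surj[of y] by (auto intro!: f_inv_into_f)
  have g': "(g has_real_derivative \<phi> (g y)) (at y)" for y
    using inverse_has_derivative[of UNIV "g y" g Y "\<lambda>t. 1 / \<phi> t"] g Y' \<phi>_pos[of "g y"] by simp
  have g_nonneg: "g y \<ge> 0" if "y \<ge> 0" for y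
    using mono[of "g y" 0] g(2)[of y] \<open>Y 0 = 0\<close> that by (cases "g y < 0") auto
  define w where "w y = d * exp (- g y)" for y
  have wx: "w y = x (g y)" if "y \<ge> 0" for y
    using g_nonneg[OF that] by (simp add: w_def x_def)
  show ?thesis
  proof (rule that)
    show "w 0 = d"
      using g(1)[of 0] \<open>Y 0 = 0\<close> by (simp add: w_def)
    fix y :: real assume "y \<ge> 0"
    show "\<bar>w y\<bar> \<le> \<bar>d\<bar>"
      using x(1) wx[OF \<open>y \<ge> 0\<close>] by simp
    have "(w has_real_derivative d * (exp (- g y) * - \<phi> (g y))) (at y)"
      unfolding w_def using g'[of y] by (auto intro!: derivative_eq_intros)
    moreover have "d * (exp (- g y) * - \<phi> (g y)) = - \<phi> (g y) * w y"
      by (simp add: w_def)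
    moreover have "\<dots> = f (w y)"
      unfolding wx[OF \<open>y \<ge> 0\<close>] using x(2) by (simp add: \<phi>_def)
    ultimately show "(w has_real_derivative f (w y)) (at y)" by (simp only:)
  qed
qed

subsection \<open>Flows and layers in terms of the specific volume\<close>

text \<open>
  Here \<open>\<epsilon> = \<rho>\<^sub>- u\<^sub>-\<close>, the state \<open>a = 1 / \<rho>\<^sub>+\<close> is the far field, and \<open>N\<close> stands for
  \<open>\<integral>\<^sub>r\<^sup>\<infinity> m \<epsilon>\<^sup>2 \<theta>\<^sup>2 v / s ds\<close>, the part of the integrated momentum equation that is nonlocal in \<open>v\<close>.
\<close>

locale gas_law =
  fixes q q' q'' :: "real \<Rightarrow> real" and a \<eta> c L M r0 :: real and m :: nat
  assumes r0_pos: "r0 > 0" and m_pos: "m \<ge> 1"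
    and \<eta>_pos: "\<eta> > 0" and \<eta>_le: "\<eta> \<le> a / 2" and c_pos: "c > 0"
    and q_deriv: "\<And>x. x > 0 \<Longrightarrow> (q has_real_derivative q' x) (at x)"
    and q'_deriv: "\<And>x. x > 0 \<Longrightarrow> (q' has_real_derivative q'' x) (at x)"
    and q'_upper: "\<And>x. \<bar>x - a\<bar> \<le> \<eta> \<Longrightarrow> q' x \<le> - c"
    and q'_lower: "\<And>x. \<bar>x - a\<bar> \<le> \<eta> \<Longrightarrow> - L \<le> q' x"
    and q''_bound: "\<And>x. \<bar>x - a\<bar> \<le> \<eta> \<Longrightarrow> \<bar>q'' x\<bar> \<le> M"
begin

definition \<theta> :: "real \<Rightarrow> real" where
  "\<theta> r = (r0 / r) ^ m"

text \<open>\<open>N\<close> is fixed by its derivative and its limit zero rather than as an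
  improper integral, so that bounds on it follow by comparing derivatives. For \<mu> = 0 the last
  clause is an algebraic relation and \<open>v'\<close> merely names the derivative.\<close>

definition flow :: "real \<Rightarrow> real \<Rightarrow> (real \<Rightarrow> real) \<Rightarrow> (real \<Rightarrow> real) \<Rightarrow> (real \<Rightarrow> real) \<Rightarrow> bool" where
  "flow \<mu> \<epsilon> v v' N \<longleftrightarrow>
    continuous_on {r0..} v \<and> (\<forall>r\<ge>r0. v r > 0) \<and> (v \<longlongrightarrow> a) at_top \<and> (N \<longlongrightarrow> 0) at_top \<and>
    (\<forall>r>r0. (v has_real_derivative v' r) (at r)) \<and>
    (\<forall>r>r0. (N has_real_derivative - (real m * \<epsilon>\<^sup>2 * (\<theta> r)\<^sup>2 * v r / r)) (at r)) \<and>
    (\<forall>r>r0. \<mu> * \<epsilon> * \<theta> r * v' r = q (v r) - q a + \<epsilon>\<^sup>2 * (\<theta> r)\<^sup>2 * v r - N r)"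

definition layer :: "real \<Rightarrow> real \<Rightarrow> (real \<Rightarrow> real) \<Rightarrow> (real \<Rightarrow> real) \<Rightarrow> bool" where
  "layer \<epsilon> vi v v' \<longleftrightarrow>
    continuous_on {0..} v \<and>
    (\<forall>y>0. (v has_real_derivative v' y) (at y)) \<and>
    (\<forall>y>0. \<epsilon> * v' y = \<epsilon>\<^sup>2 * (v y - vi) + q (v y) - q vi)"

text \<open>The last bound makes the forcing \<epsilon>^2 \<theta>^2 v, for v \<le> 2 a, at most c
  \<eta> / 4, which is half of the restoring force c \<eta> / 2 available at distance \<eta> / 2
  from \<open>a\<close>. Combined with \<eta> \<le> a / 2 it also yields \<epsilon>^2 \<le> c /
  16.\<close>

definition small :: "real \<Rightarrow> bool" where
  "small \<epsilon> \<longleftrightarrow> 0 < \<epsilon> \<and> \<epsilon> \<le> 1 \<and> 8 * a * \<epsilon>\<^sup>2 \<le> c * \<eta>"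

lemma a_pos: "a > 0"
  using \<eta>_pos \<eta>_le by simp

lemma near_pos: "\<bar>x - a\<bar> \<le> \<eta> \<Longrightarrow> 0 < x" "\<bar>x - a\<bar> \<le> \<eta> \<Longrightarrow> x \<le> 2 * a"
  using \<eta>_pos \<eta>_le by (auto simp: abs_le_iff)

lemma small_le: "small \<epsilon> \<Longrightarrow> \<epsilon>\<^sup>2 \<le> c / 16" "small \<epsilon> \<Longrightarrow> 0 < \<epsilon>" "small \<epsilon> \<Longrightarrow> \<epsilon>\<^sup>2 \<le> 1"
proof -
  assume *: "small \<epsilon>"
  then have "8 * a * \<epsilon>\<^sup>2 \<le> c * (a / 2)"
    using mult_left_mono[OF \<eta>_le, of c] c_pos unfolding small_def by linarith
  then have "a * (16 * \<epsilon>\<^sup>2) \<le> a * c"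
    by (simp add: field_simps)
  then show "\<epsilon>\<^sup>2 \<le> c / 16"
    using a_pos by simp
  show "0 < \<epsilon>" "\<epsilon>\<^sup>2 \<le> 1"
    using * by (auto simp: small_def power_le_one)
qed

lemma \<theta>_pos: "r \<ge> r0 \<Longrightarrow> \<theta> r > 0"
  unfolding \<theta>_def using r0_pos by simp

lemma \<theta>_le_1: "r \<ge> r0 \<Longrightarrow> \<theta> r \<le> 1"
  unfolding \<theta>_def using r0_pos by (intro power_le_one) auto

lemma \<theta>_sq_le_1: "r \<ge> r0 \<Longrightarrow> (\<theta> r)\<^sup>2 \<le> 1"
  using \<theta>_pos[of r] \<theta>_le_1[of r] by (intro power_le_one) auto

lemma \<theta>_r0: "\<theta> r0 = 1"
  unfolding \<theta>_def using r0_pos by simp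

lemma \<theta>_tendsto: "(\<theta> \<longlongrightarrow> 0) at_top"
proof -
  have "((\<lambda>r. r0 / r) \<longlongrightarrow> 0) at_top"
    by (rule real_tendsto_divide_at_top[OF tendsto_const filterlim_ident])
  then show ?thesis
    unfolding \<theta>_def using m_pos by (intro tendsto_null_power) auto
qed

lemma \<theta>_deriv:
  assumes "r \<ge> r0"
  shows "(\<theta> has_real_derivative - (real m * \<theta> r / r)) (at r)"
proof -
  have "r > 0" using assms r0_pos by simp
  obtain k where k: "m = Suc k"
    using m_pos by (cases m) auto
  have "((\<lambda>r. (r0 / r) ^ Suc k) has_real_derivative - (real (Suc k) * (r0 / r) ^ Suc k / r)) (at r)"
  proof -
    have "((\<lambda>r. r0 / r) has_real_derivative - (r0 / r / r)) (at r)"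
      using \<open>r > 0\<close> by (auto intro!: derivative_eq_intros simp: field_simps)
    from DERIV_power_Suc[OF this, of k] show ?thesis
      by (simp add: algebra_simps)
  qed
  then show ?thesis
    unfolding \<theta>_def[abs_def] by (simp only: k)
qed

lemma \<theta>_sq_deriv:
  assumes "r \<ge> r0"
  shows "((\<lambda>r. (\<theta> r)\<^sup>2) has_real_derivative - (2 * real m * (\<theta> r)\<^sup>2 / r)) (at r)"
  using \<theta>_deriv[OF assms] by (auto intro!: derivative_eq_intros simp: power2_eq_square)

text \<open>Bernoulli's inequality for the m-th power of r0 / r. It measures how far the radial
  geometry departs from the planar one near the boundary.\<close>

lemma one_minus_\<theta>_le:
  assumes "r \<ge> r0"
  shows "1 - \<theta> r \<le> real m / r0 * (r - r0)"
proof -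
  have "r > 0" using assms r0_pos by simp
  have "1 + real m * (r0 / r - 1) \<le> (1 + (r0 / r - 1)) ^ m"
    using \<open>r > 0\<close> r0_pos by (intro Bernoulli_inequality) auto
  then have "1 - \<theta> r \<le> real m * (1 - r0 / r)"
    by (simp add: \<theta>_def algebra_simps)
  also have "1 - r0 / r \<le> (r - r0) / r0"
  proof -
    have "1 - r0 / r = (r - r0) / r"
      using \<open>r > 0\<close> by (simp add: field_simps)
    also have "\<dots> \<le> (r - r0) / r0"
      using assms r0_pos by (intro divide_left_mono) auto
    finally show ?thesis .
  qed
  finally show ?thesis
    by (simp add: mult_left_mono)
qed

lemma near_between:
  assumes "\<bar>x - a\<bar> \<le> \<eta>" "\<bar>y - a\<bar> \<le> \<eta>" "x \<le> z" "z \<le> y"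
  shows "\<bar>z - a\<bar> \<le> \<eta>"
  using assms by (auto simp: abs_le_iff)

lemma q_slope:
  assumes x: "\<bar>x - a\<bar> \<le> \<eta>" and y: "\<bar>y - a\<bar> \<le> \<eta>" and "x \<noteq> y"
  obtains k where "q y - q x = - k * (y - x)" "c \<le> k" "k \<le> L"
proof -
  have *: "\<exists>z. \<bar>z - a\<bar> \<le> \<eta> \<and> q y - q x = (y - x) * q' z"
    if "x < y" and x: "\<bar>x - a\<bar> \<le> \<eta>" and y: "\<bar>y - a\<bar> \<le> \<eta>" for x y
  proof -
    have "(q has_real_derivative q' z) (at z)" if "x \<le> z" "z \<le> y" for z
      using near_between[OF x y that] by (intro q_deriv near_pos)
    then obtain z where "x < z" "z < y" "q y - q x = (y - x) * q' z"
      using MVT2[OF \<open>x < y\<close>] by metis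
    with near_between[OF x y] show ?thesis
      by (intro exI[of _ z]) auto
  qed
  have "\<exists>z. \<bar>z - a\<bar> \<le> \<eta> \<and> q y - q x = (y - x) * q' z"
  proof (cases "x < y")
    case False
    then obtain z where "\<bar>z - a\<bar> \<le> \<eta>" "q x - q y = (x - y) * q' z"
      using *[of y x] assms by auto
    then show ?thesis
      by (intro exI[of _ z]) (auto simp: algebra_simps)
  qed (use * x y in blast)
  then obtain z where "\<bar>z - a\<bar> \<le> \<eta>" "q y - q x = (y - x) * q' z"
    by blast
  with q'_upper[of z] q'_lower[of z] show ?thesis
    by (intro that[of "- q' z"]) auto
qed

lemma q_dissipative:
  assumes "\<bar>x - a\<bar> \<le> \<eta>" "\<bar>y - a\<bar> \<le> \<eta>"
  shows "(y - x) * (q y - q x) \<le> - c * (y - x)\<^sup>2"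
proof (cases "x = y")
  case False
  then obtain k where k: "q y - q x = - k * (y - x)" "c \<le> k"
    using q_slope[OF assms] by metis
  have "c * (y - x)\<^sup>2 \<le> k * (y - x)\<^sup>2"
    using k(2) by (intro mult_right_mono) auto
  then show ?thesis
    unfolding k(1) by (simp add: power2_eq_square algebra_simps)
qed simp

lemma q_diff_lower:
  assumes "\<bar>x - a\<bar> \<le> \<eta>" "\<bar>y - a\<bar> \<le> \<eta>"
  shows "c * \<bar>y - x\<bar> \<le> \<bar>q y - q x\<bar>"
proof (cases "x = y")
  case False
  then obtain k where k: "q y - q x = - k * (y - x)" "c \<le> k"
    using q_slope[OF assms] by metis
  then show ?thesis
    using c_pos by (simp add: abs_mult mult_right_mono)
qed simp

lemma q_lipschitz:
  assumes "\<bar>x - a\<bar> \<le> \<eta>" "\<bar>y - a\<bar> \<le> \<eta>"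
  shows "\<bar>q y - q x\<bar> \<le> L * \<bar>y - x\<bar>"
proof (cases "x = y")
  case False
  then obtain k where k: "q y - q x = - k * (y - x)" "c \<le> k" "k \<le> L"
    using q_slope[OF assms] by metis
  then show ?thesis
    using c_pos by (simp add: abs_mult mult_right_mono)
qed simp

lemma q_strict_antimono:
  assumes "\<bar>x - a\<bar> \<le> \<eta>" "\<bar>y - a\<bar> \<le> \<eta>" "x \<le> y"
  shows "q y - q x \<le> - c * (y - x)"
proof (cases "x = y")
  case False
  then obtain k where k: "q y - q x = - k * (y - x)" "c \<le> k"
    using q_slope[OF assms(1,2)] by metis
  have "c * (y - x) \<le> k * (y - x)"
    using k(2) assms(3) by (intro mult_right_mono) auto
  then show ?thesis
    unfolding k(1) by simp
qed simp

end

text \<open>The increment of \<open>f\<close> over a step \<open>b\<close> has derivative at most M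
  |b| as a function of the base point. Moving the base from the boundary state to the local Euler
  state therefore costs a product of two factors, the small displacement of the base and the layer
  amplitude.\<close>

lemma second_difference_bound:
  fixes f f' f'' :: "real \<Rightarrow> real"
  assumes f': "\<And>x. x \<in> {l..u} \<Longrightarrow> (f has_real_derivative f' x) (at x)"
    and f'': "\<And>x. x \<in> {l..u} \<Longrightarrow> (f' has_real_derivative f'' x) (at x)"
    and M: "\<And>x. x \<in> {l..u} \<Longrightarrow> \<bar>f'' x\<bar> \<le> M"
    and x: "x \<in> {l..u}" "x + b \<in> {l..u}" and y: "y \<in> {l..u}" "y + b \<in> {l..u}"
  shows "\<bar>f (x + b) - f x - f (y + b) + f y\<bar> \<le> M * \<bar>x - y\<bar> * \<bar>b\<bar>"
proof -
  have f'_lip: "\<bar>f' s - f' t\<bar> \<le> M * \<bar>s - t\<bar>" if "s \<in> {l..u}" "t \<in> {l..u}" for s t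
  proof -
    have "norm (f' s - f' t) \<le> M * norm (s - t)"
      by (rule field_differentiable_bound[of "{l..u}" f' f''])
        (use f'' M that in \<open>auto intro: has_field_derivative_at_within\<close>)
    then show ?thesis by simp
  qed
  \<comment> \<open>Both signs of \<open>b\<close> are covered at once: the admissible base points
    still form an interval.\<close>
  define S where "S = {s. s \<in> {l..u} \<and> s + b \<in> {l..u}}"
  have "convex S"
  proof -
    have "S = {max l (l - b)..min u (u - b)}"
      by (auto simp: S_def)
    then show ?thesis by simp
  qed
  moreover have "((\<lambda>s. f (s + b) - f s) has_real_derivative f' (s + b) - f' s) (at s within S)" if "s \<in> S" for s
    using that f'[of "s + b"] f'[of s] by (auto simp: S_def DERIV_shift intro!: derivative_eq_intros
      intro: has_field_derivative_at_within)
  moreover have "norm (f' (s + b) - f' s) \<le> M * \<bar>b\<bar>" if "s \<in> S" for s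
    using that f'_lip[of "s + b" s] by (simp add: S_def)
  ultimately have "norm ((f (x + b) - f x) - (f (y + b) - f y)) \<le> M * \<bar>b\<bar> * norm (x - y)"
    by (rule field_differentiable_bound[of S "\<lambda>s. f (s + b) - f s"]) (use x y in \<open>auto simp: S_def\<close>)
  then show ?thesis
    by (simp add: algebra_simps)
qed

context gas_law
begin

section \<open>Bounds for the nonlocal term and confinement of viscous flows\<close>

text \<open>The right-hand side \<open>H\<close> tends to zero and satisfies H' \<le> N', so N - H
  increases to zero. The part of \<open>z\<close> bounded by \<open>W\<close> is integrated exactly,
  because m \<theta>^2 / r is the derivative of -\<theta>^2 / 2; for the exponential part \<theta>^2
  / r \<le> 1 / r0 is used and the integration gains the factor 1 / l, which is of order \<epsilon>
  \<mu> for a layer.\<close>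

lemma nonlocal_term_le:
  assumes N: "\<And>r. r > r0 \<Longrightarrow> (N has_real_derivative - (real m * \<epsilon>\<^sup>2 * (\<theta> r)\<^sup>2 * z r / r)) (at r)"
    and lim: "(N \<longlongrightarrow> 0) at_top"
    and z: "\<And>r. r > r0 \<Longrightarrow> z r \<le> W + d * exp (- l * (r - r0))"
    and "d \<ge> 0" "l > 0" and "r > r0"
  shows "N r \<le> \<epsilon>\<^sup>2 * W / 2 * (\<theta> r)\<^sup>2 + real m / r0 * \<epsilon>\<^sup>2 * d / l * exp (- l * (r - r0))"
proof -
  define e where "e r = exp (- l * (r - r0))" for r
  define H where "H r = \<epsilon>\<^sup>2 * W / 2 * (\<theta> r)\<^sup>2 + real m / r0 * \<epsilon>\<^sup>2 * d / l * e r" for r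
  define H' where "H' r = - (real m * \<epsilon>\<^sup>2 * W * (\<theta> r)\<^sup>2 / r) - real m / r0 * \<epsilon>\<^sup>2 * d * e r" for r
  have e': "(e has_real_derivative - l * e r) (at r)" for r
    unfolding e_def by (auto intro!: derivative_eq_intros)
  have "(H has_real_derivative H' r) (at r)" if "r > r0" for r
  proof -
    have "(H has_real_derivative \<epsilon>\<^sup>2 * W / 2 * (- (2 * real m * (\<theta> r)\<^sup>2 / r))
        + real m / r0 * \<epsilon>\<^sup>2 * d / l * (- l * e r)) (at r)"
      unfolding H_def using that by (intro DERIV_add DERIV_cmult \<theta>_sq_deriv e') auto
    then show ?thesis
      by (rule DERIV_cong) (use \<open>l > 0\<close> in \<open>simp add: H'_def algebra_simps\<close>)
  qed
  moreover have "(H \<longlongrightarrow> 0) at_top"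
  proof -
    have "(e \<longlongrightarrow> 0) at_top"
      unfolding e_def[abs_def] by (rule exp_decay_tendsto[OF \<open>l > 0\<close>])
    then have "((\<lambda>r. \<epsilon>\<^sup>2 * W / 2 * (\<theta> r)\<^sup>2 + real m / r0 * \<epsilon>\<^sup>2 * d / l * e r)
        \<longlongrightarrow> \<epsilon>\<^sup>2 * W / 2 * 0\<^sup>2 + real m / r0 * \<epsilon>\<^sup>2 * d / l * 0) at_top"
      by (intro tendsto_intros \<theta>_tendsto)
    then show ?thesis
      by (simp add: H_def[abs_def])
  qed
  ultimately have "N r - H r \<le> 0 - 0"
  proof (intro nondecreasing_tendsto_upper_bound[OF tendsto_diff[OF lim] _ _ \<open>r > r0\<close>,
        where f' = "\<lambda>r. - (real m * \<epsilon>\<^sup>2 * (\<theta> r)\<^sup>2 * z r / r) - H' r"])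
    fix r assume r: "r > r0"
    then have "r > 0" using r0_pos by simp
    have "e r \<ge> 0" by (simp add: e_def)
    have "z r - W \<le> d * e r"
      using z[OF r] by (simp add: e_def)
    then have "real m * \<epsilon>\<^sup>2 * ((\<theta> r)\<^sup>2 / r) * (z r - W) \<le> real m * \<epsilon>\<^sup>2 * ((\<theta> r)\<^sup>2 / r) * (d * e r)"
      using \<open>r > 0\<close> by (intro mult_left_mono) auto
    also have "\<dots> \<le> real m * \<epsilon>\<^sup>2 * (1 / r0) * (d * e r)"
      using \<theta>_sq_le_1[of r] r r0_pos \<open>d \<ge> 0\<close> \<open>e r \<ge> 0\<close>
      by (intro mult_right_mono mult_left_mono frac_le) auto
    finally show "- (real m * \<epsilon>\<^sup>2 * (\<theta> r)\<^sup>2 * z r / r) - H' r \<ge> 0"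
      by (simp add: H'_def algebra_simps diff_divide_distrib)
  qed (auto intro!: DERIV_diff N)
  then show ?thesis
    by (simp add: H_def e_def)
qed

lemma nonlocal_term_abs_le:
  assumes N: "\<And>r. r > r0 \<Longrightarrow> (N has_real_derivative - (real m * \<epsilon>\<^sup>2 * (\<theta> r)\<^sup>2 * z r / r)) (at r)"
    and lim: "(N \<longlongrightarrow> 0) at_top"
    and z: "\<And>r. r > r0 \<Longrightarrow> \<bar>z r\<bar> \<le> W + d * exp (- l * (r - r0))"
    and "d \<ge> 0" "l > 0" and "r > r0"
  shows "\<bar>N r\<bar> \<le> \<epsilon>\<^sup>2 * W / 2 * (\<theta> r)\<^sup>2 + real m / r0 * \<epsilon>\<^sup>2 * d / l * exp (- l * (r - r0))"
proof -
  have "N r \<le> \<epsilon>\<^sup>2 * W / 2 * (\<theta> r)\<^sup>2 + real m / r0 * \<epsilon>\<^sup>2 * d / l * exp (- l * (r - r0))"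
    by (rule nonlocal_term_le[OF N lim _ assms(4-6)]) (use z in \<open>auto simp: abs_le_iff\<close>)
  moreover have "- N r \<le> \<epsilon>\<^sup>2 * W / 2 * (\<theta> r)\<^sup>2 + real m / r0 * \<epsilon>\<^sup>2 * d / l * exp (- l * (r - r0))"
  proof (rule nonlocal_term_le[OF _ _ _ assms(4-6), where z = "\<lambda>r. - z r" and N = "\<lambda>r. - N r"])
    show "((\<lambda>r. - N r) has_real_derivative - (real m * \<epsilon>\<^sup>2 * (\<theta> r)\<^sup>2 * - z r / r)) (at r)" if "r > r0" for r
      using DERIV_minus[OF N[OF that]] by simp
    show "((\<lambda>r. - N r) \<longlongrightarrow> 0) at_top"
      using tendsto_minus[OF lim] by simp
  qed (use z in \<open>auto simp: abs_le_iff\<close>)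
  ultimately show ?thesis
    by (simp add: abs_le_iff)
qed

lemma flow_N_nonneg:
  assumes "flow \<mu> \<epsilon> v v' N" "r > r0"
  shows "N r \<ge> 0"
proof -
  have "- N r \<le> \<epsilon>\<^sup>2 * 0 / 2 * (\<theta> r)\<^sup>2 + real m / r0 * \<epsilon>\<^sup>2 * 0 / 1 * exp (- 1 * (r - r0))"
  proof (rule nonlocal_term_le[where z = "\<lambda>r. - v r" and N = "\<lambda>r. - N r"])
    have *: "(N has_real_derivative - (real m * \<epsilon>\<^sup>2 * (\<theta> r)\<^sup>2 * v r / r)) (at r)" if "r > r0" for r
      using assms that by (simp add: flow_def)
    show "((\<lambda>r. - N r) has_real_derivative - (real m * \<epsilon>\<^sup>2 * (\<theta> r)\<^sup>2 * - v r / r)) (at r)"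
      if "r > r0" for r
      using DERIV_minus[OF *[OF that]] by simp
    have "(N \<longlongrightarrow> 0) at_top"
      using assms by (simp add: flow_def)
    then show "((\<lambda>r. - N r) \<longlongrightarrow> 0) at_top"
      using tendsto_minus[of N 0] by simp
  qed (use assms in \<open>auto simp: flow_def less_imp_le\<close>)
  then show ?thesis by simp
qed

lemma flow_N_upper:
  assumes "flow \<mu> \<epsilon> v v' N" "r > r0" and v: "\<And>r. r > r0 \<Longrightarrow> v r \<le> 2 * a"
  shows "N r \<le> a * \<epsilon>\<^sup>2 * (\<theta> r)\<^sup>2"
proof -
  have "N r \<le> \<epsilon>\<^sup>2 * (2 * a) / 2 * (\<theta> r)\<^sup>2 + real m / r0 * \<epsilon>\<^sup>2 * 0 / 1 * exp (- 1 * (r - r0))"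
    by (rule nonlocal_term_le[where z = v]) (use assms in \<open>auto simp: flow_def\<close>)
  then show ?thesis by (simp add: mult.commute mult.left_commute)
qed

lemma flow_forcing_le:
  assumes "r \<ge> r0" "x \<le> 2 * a" "x \<ge> 0" "small \<epsilon>"
  shows "\<epsilon>\<^sup>2 * (\<theta> r)\<^sup>2 * x \<le> c * \<eta> / 4"
proof -
  have "\<epsilon>\<^sup>2 * ((\<theta> r)\<^sup>2 * x) \<le> \<epsilon>\<^sup>2 * (1 * (2 * a))"
    using assms \<theta>_sq_le_1[of r] by (intro mult_left_mono mult_mono) auto
  also have "\<dots> \<le> c * \<eta> / 4"
    using assms(4) by (simp add: small_def mult_ac)
  finally show ?thesis
    by (simp add: mult.assoc)
qed

text \<open>Between distances \<eta> / 2 and \<eta> from \<open>a\<close>, the term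
  \<open>q (v r) - q a\<close> pushes v back with strength at least c \<eta> / 2. The opposing term,
  \<epsilon>^2 \<theta>^2 v above and \<open>N\<close> below, is at most c \<eta> / 4; the remaining
  one has the favourable sign.\<close>

lemma flow_trapped:
  assumes flow: "flow \<mu> \<epsilon> v v' N" and "\<mu> > 0" and \<epsilon>: "small \<epsilon>"
    and init: "\<bar>v r0 - a\<bar> \<le> \<eta> / 2" and r: "r \<ge> r0"
  shows "\<bar>v r - a\<bar> \<le> \<eta> / 2"
proof -
  have cont: "continuous_on {r0..} v" and vpos: "\<And>r. r \<ge> r0 \<Longrightarrow> v r > 0"
    and v': "\<And>r. r > r0 \<Longrightarrow> (v has_real_derivative v' r) (at r)"
    and eq: "\<And>r. r > r0 \<Longrightarrow> \<mu> * \<epsilon> * \<theta> r * v' r = q (v r) - q a + \<epsilon>\<^sup>2 * (\<theta> r)\<^sup>2 * v r - N r"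
    using flow by (auto simp: flow_def)
  have coeff: "\<mu> * \<epsilon> * \<theta> r > 0" if "r > r0" for r
    using \<open>\<mu> > 0\<close> small_le(2)[OF \<epsilon>] \<theta>_pos[of r] that by simp
  have init': "v r0 - (a + \<eta> / 2) \<le> 0" "a - \<eta> / 2 - v r0 \<le> 0"
    using init by linarith+
  have c\<eta>: "c * \<eta> > 0"
    using c_pos \<eta>_pos by simp
  have upper: "v r - (a + \<eta> / 2) \<le> 0" if "r \<ge> r0" for r
  proof (rule barrier[where h = "\<eta> / 2" and w' = v' and w = "\<lambda>r. v r - (a + \<eta> / 2)" and a = r0])
    fix r assume r: "r > r0" and "0 < v r - (a + \<eta> / 2)" "v r - (a + \<eta> / 2) < \<eta> / 2"
    then have v: "a + \<eta> / 2 < v r" "v r < a + \<eta>" by auto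
    then have "q (v r) - q a \<le> - c * (v r - a)"
      using \<eta>_pos by (intro q_strict_antimono) auto
    also have "\<dots> \<le> - c * (\<eta> / 2)"
      using v c_pos by simp
    finally have "q (v r) - q a \<le> - (c * \<eta> / 2)" by simp
    moreover have "\<epsilon>\<^sup>2 * (\<theta> r)\<^sup>2 * v r \<le> c * \<eta> / 4"
      using r v \<eta>_le a_pos \<eta>_pos by (intro flow_forcing_le \<epsilon>) auto
    ultimately have "\<mu> * \<epsilon> * \<theta> r * v' r \<le> 0"
      unfolding eq[OF r] using flow_N_nonneg[OF flow r] c\<eta> by linarith
    then show "v' r \<le> 0"
      using coeff[OF r] by (metis linorder_not_le mult_pos_pos)
  qed (use init' \<eta>_pos that in \<open>auto intro!: derivative_eq_intros v' continuous_intros cont\<close>)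
  \<comment> \<open>The upper barrier has to come first: the lower one needs \<open>N\<close>
    bounded above, which rests on v \<le> 2 a.\<close>
  have v2a: "v r \<le> 2 * a" if "r > r0" for r
    using upper[of r] that \<eta>_le a_pos by simp
  have lower: "a - \<eta> / 2 - v r \<le> 0"
  proof (rule barrier[where h = "\<eta> / 2" and w' = "\<lambda>r. - v' r" and w = "\<lambda>r. a - \<eta> / 2 - v r" and a = r0])
    fix r assume r: "r > r0" and "0 < a - \<eta> / 2 - v r" "a - \<eta> / 2 - v r < \<eta> / 2"
    then have v: "a - \<eta> < v r" "v r < a - \<eta> / 2" by auto
    then have "q a - q (v r) \<le> - c * (a - v r)"
      using \<eta>_pos by (intro q_strict_antimono) auto
    also have "\<dots> \<le> - c * (\<eta> / 2)"
      using v c_pos by simp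
    finally have "q (v r) - q a \<ge> c * \<eta> / 2" by simp
    moreover have "\<epsilon>\<^sup>2 * (\<theta> r)\<^sup>2 * a \<le> c * \<eta> / 4"
      using r a_pos by (intro flow_forcing_le \<epsilon>) auto
    then have "N r \<le> c * \<eta> / 4"
      using flow_N_upper[OF flow r v2a] by (simp add: mult.commute mult.left_commute)
    moreover have "\<epsilon>\<^sup>2 * (\<theta> r)\<^sup>2 * v r \<ge> 0"
      using vpos[of r] r by simp
    ultimately have "\<mu> * \<epsilon> * \<theta> r * v' r \<ge> 0"
      unfolding eq[OF r] using c\<eta> by linarith
    then show "- v' r \<le> 0"
      using coeff[OF r] by (simp add: zero_le_mult_iff not_le)
  qed (use init' \<eta>_pos r in \<open>auto intro!: derivative_eq_intros v' continuous_intros cont\<close>)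
  show ?thesis
    using upper[OF r] lower by linarith
qed

end

lemma le_at_left_endpoint:
  fixes f g :: "real \<Rightarrow> real"
  assumes "continuous_on {a..} f" "continuous_on {a..} g" "\<And>x. x > a \<Longrightarrow> f x \<le> g x" "x \<ge> a"
  shows "f x \<le> g x"
proof -
  have "continuous_on (closure {a<..}) (\<lambda>x. g x - f x)"
    using assms(1,2) by (simp add: continuous_on_diff)
  moreover have "x \<in> closure {a<..}"
    using assms(4) by simp
  moreover have "g s - f s \<ge> 0" if "s \<in> {a<..}" for s
    using assms(3) that by simp
  ultimately have "g x - f x \<ge> 0"
    by (rule continuous_ge_on_closure)
  then show ?thesis by simp
qed

lemma attains_level_before_limit:
  fixes v :: "real \<Rightarrow> real"
  assumes cont: "continuous_on {s..} v" and lim: "(v \<longlongrightarrow> l) at_top"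
    and x: "v s \<le> x \<and> x < l \<or> l < x \<and> x \<le> v s"
  obtains t where "t \<ge> s" "v t = x"
proof -
  have "\<forall>\<^sub>F t in at_top. dist (v t) l < \<bar>l - x\<bar>"
    using x by (intro tendstoD[OF lim]) auto
  then obtain R where R: "\<And>t. t \<ge> R \<Longrightarrow> \<bar>v t - l\<bar> < \<bar>l - x\<bar>"
    unfolding eventually_at_top_linorder dist_real_def by blast
  have contT: "continuous_on {s..max s R} v"
    using cont by (rule continuous_on_subset) auto
  have "\<bar>v (max s R) - l\<bar> < \<bar>l - x\<bar>"
    by (intro R) simp
  then have "\<exists>t\<ge>s. t \<le> max s R \<and> v t = x"
    using x
  proof (elim disjE)
    assume "\<bar>v (max s R) - l\<bar> < \<bar>l - x\<bar>" "v s \<le> x \<and> x < l"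
    then show ?thesis
      by (intro IVT' contT) auto
  next
    assume "\<bar>v (max s R) - l\<bar> < \<bar>l - x\<bar>" "l < x \<and> x \<le> v s"
    then show ?thesis
      by (intro IVT2' contT) auto
  qed
  then show ?thesis using that by blast
qed

context gas_law
begin

section \<open>Inviscid flows: confinement, decay and slope\<close>

text \<open>With \<mu> = 0 there is no evolution to run a barrier on and no datum for v at
  \<open>r0\<close>; the only anchor is the limit \<open>a\<close> at infinity. If v left the
  interval, it would take the value a + \<eta> or a - \<eta> exactly, where
  \<open>q (v r) - q a\<close> has modulus at least c \<eta> and cannot be balanced by terms of size
  c \<eta> / 4.\<close>

lemma inviscid_flow_near:
  assumes flow: "flow 0 \<epsilon> v v' N" and \<epsilon>: "small \<epsilon>" and r: "r > r0"
  shows "\<bar>v r - a\<bar> < \<eta>"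
proof -
  have vpos: "\<And>r. r \<ge> r0 \<Longrightarrow> v r > 0" and lim: "(v \<longlongrightarrow> a) at_top"
    and eq: "\<And>r. r > r0 \<Longrightarrow> q (v r) - q a + \<epsilon>\<^sup>2 * (\<theta> r)\<^sup>2 * v r - N r = 0"
    using flow by (auto simp: flow_def)
  have cont: "continuous_on {s..} v" if "s > r0" for s
    using that flow by (auto simp: flow_def elim: continuous_on_subset)
  have c\<eta>: "c * \<eta> > 0"
    using c_pos \<eta>_pos by simp
  have upper: "v s < a + \<eta>" if s: "s > r0" for s
  proof (rule ccontr)
    assume "\<not> v s < a + \<eta>"
    then obtain t where t: "t \<ge> s" "v t = a + \<eta>"
      using attains_level_before_limit[OF cont[OF s] lim, of "a + \<eta>"] \<eta>_pos by auto
    have "q (v t) - q a \<le> - c * (v t - a)"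
      using \<eta>_pos t(2) by (intro q_strict_antimono) auto
    moreover have "\<epsilon>\<^sup>2 * (\<theta> t)\<^sup>2 * v t \<le> c * \<eta> / 4"
      using t s \<eta>_le a_pos \<eta>_pos by (intro flow_forcing_le \<epsilon>) auto
    ultimately show False
      using eq[of t] flow_N_nonneg[OF flow, of t] t s c\<eta> by simp
  qed
  have v2a: "v s \<le> 2 * a" if "s > r0" for s
    using upper[OF that] \<eta>_le a_pos by simp
  have "a - \<eta> < v r"
  proof (rule ccontr)
    assume "\<not> a - \<eta> < v r"
    then obtain t where t: "t \<ge> r" "v t = a - \<eta>"
      using attains_level_before_limit[OF cont[OF r] lim, of "a - \<eta>"] \<eta>_pos by auto
    have "q a - q (v t) \<le> - c * (a - v t)"
      using \<eta>_pos t(2) by (intro q_strict_antimono) auto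
    moreover have "\<epsilon>\<^sup>2 * (\<theta> t)\<^sup>2 * a \<le> c * \<eta> / 4"
      using t r a_pos by (intro flow_forcing_le \<epsilon>) auto
    then have "N t \<le> c * \<eta> / 4"
      using flow_N_upper[OF flow _ v2a, of t] t r by (simp add: mult.commute mult.left_commute)
    moreover have "\<epsilon>\<^sup>2 * (\<theta> t)\<^sup>2 * v t \<ge> 0"
      using vpos[of t] t r by simp
    ultimately show False
      using eq[of t] t r c\<eta> by simp
  qed
  with upper[OF r] show ?thesis by (simp add: abs_less_iff)
qed

text \<open>Both \<epsilon>^2 \<theta>^2 v and \<open>N\<close> lie between 0 and 2 a \<epsilon>^2
  \<theta>^2, hence so does the modulus of their difference, which equals that of
  \<open>q (v r) - q a\<close>; dividing by the slope \<open>c\<close> gives the bound. The factor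
  \<theta>^2 is the decay rate of the Euler density.\<close>

lemma inviscid_flow_close:
  assumes flow: "flow 0 \<epsilon> v v' N" and \<epsilon>: "small \<epsilon>" and "r \<ge> r0"
  shows "\<bar>v r - a\<bar> \<le> 2 * a / c * \<epsilon>\<^sup>2 * (\<theta> r)\<^sup>2"
proof (rule le_at_left_endpoint[OF _ _ _ \<open>r \<ge> r0\<close>, where f = "\<lambda>r. \<bar>v r - a\<bar>"])
  show "continuous_on {r0..} (\<lambda>r. \<bar>v r - a\<bar>)"
    using flow by (intro continuous_intros) (auto simp: flow_def)
  show "continuous_on {r0..} (\<lambda>r. 2 * a / c * \<epsilon>\<^sup>2 * (\<theta> r)\<^sup>2)"
    using \<theta>_deriv by (intro continuous_intros continuous_at_imp_continuous_on) (auto intro: DERIV_isCont)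
  fix r assume r: "r > r0"
  have near: "\<bar>v r - a\<bar> \<le> \<eta>"
    using inviscid_flow_near[OF flow \<epsilon> r] by simp
  have v: "0 < v s" "v s \<le> 2 * a" if "s > r0" for s
    using near_pos[of "v s"] inviscid_flow_near[OF flow \<epsilon> that] by auto
  have "N r \<le> a * \<epsilon>\<^sup>2 * (\<theta> r)\<^sup>2"
    using flow_N_upper[OF flow r v(2)] .
  also have "\<dots> \<le> 2 * a * \<epsilon>\<^sup>2 * (\<theta> r)\<^sup>2"
    using a_pos by (intro mult_right_mono) auto
  finally have N: "0 \<le> N r" "N r \<le> 2 * a * \<epsilon>\<^sup>2 * (\<theta> r)\<^sup>2"
    using flow_N_nonneg[OF flow r] by auto
  have "\<epsilon>\<^sup>2 * (\<theta> r)\<^sup>2 * v r \<le> \<epsilon>\<^sup>2 * (\<theta> r)\<^sup>2 * (2 * a)"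
    using v(2)[OF r] by (intro mult_left_mono) auto
  moreover have "0 \<le> \<epsilon>\<^sup>2 * (\<theta> r)\<^sup>2 * v r"
    using v(1)[OF r] by simp
  moreover have "q (v r) - q a = N r - \<epsilon>\<^sup>2 * (\<theta> r)\<^sup>2 * v r"
    using flow r by (auto simp: flow_def)
  ultimately have "\<bar>q (v r) - q a\<bar> \<le> 2 * a * \<epsilon>\<^sup>2 * (\<theta> r)\<^sup>2"
    using N by (simp add: abs_le_iff mult_ac)
  with q_diff_lower[of a "v r"] near \<eta>_pos have "c * \<bar>v r - a\<bar> \<le> 2 * a * \<epsilon>\<^sup>2 * (\<theta> r)\<^sup>2"
    by simp
  then show "\<bar>v r - a\<bar> \<le> 2 * a / c * \<epsilon>\<^sup>2 * (\<theta> r)\<^sup>2"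
    using c_pos by (simp add: field_simps)
qed

lemma small_two_a_div_c:
  assumes "small \<epsilon>"
  shows "2 * a / c * \<epsilon>\<^sup>2 \<le> \<eta> / 4"
  using assms c_pos by (simp add: small_def field_simps)

lemma inviscid_flow_quarter:
  assumes "flow 0 \<epsilon> v v' N" "small \<epsilon>" "r \<ge> r0"
  shows "\<bar>v r - a\<bar> \<le> \<eta> / 4"
proof -
  have "2 * a / c * \<epsilon>\<^sup>2 * (\<theta> r)\<^sup>2 \<le> 2 * a / c * \<epsilon>\<^sup>2 * 1"
    using \<theta>_sq_le_1[OF assms(3)] a_pos c_pos by (intro mult_left_mono) auto
  with inviscid_flow_close[OF assms] small_two_a_div_c[OF assms(2)] show ?thesis
    by linarith
qed

text \<open>The quotient of m (2 a) / r0 by c / 2: the numerator bounds m v / r, and c / 2 is a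
  lower bound for the modulus of q' + \<epsilon>^2 \<theta>^2 on the confinement interval.\<close>

definition K_slope :: real where
  "K_slope = 4 * real m * a / (r0 * c)"

lemma K_slope_nonneg: "K_slope \<ge> 0"
  using a_pos r0_pos c_pos by (simp add: K_slope_def)

text \<open>Obtained by differentiating the algebraic relation. The derivative of \<open>N\<close>
  cancels half of the term coming from (\<theta>^2)', leaving the inviscid momentum
  equation.\<close>

lemma inviscid_flow_deriv_eq:
  assumes flow: "flow 0 \<epsilon> v v' N" and r: "r > r0"
  shows "v' r * (q' (v r) + \<epsilon>\<^sup>2 * (\<theta> r)\<^sup>2) = real m * \<epsilon>\<^sup>2 * (\<theta> r)\<^sup>2 * v r / r"
proof -
  have v': "(v has_real_derivative v' r) (at r)" and vpos: "v r > 0"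
    and N': "(N has_real_derivative - (real m * \<epsilon>\<^sup>2 * (\<theta> r)\<^sup>2 * v r / r)) (at r)"
    and eq: "\<And>r. r > r0 \<Longrightarrow> q (v r) - q a + \<epsilon>\<^sup>2 * (\<theta> r)\<^sup>2 * v r - N r = 0"
    using flow r by (auto simp: flow_def)
  have "((\<lambda>r. q (v r)) has_real_derivative q' (v r) * v' r) (at r)"
    using DERIV_chain2[OF q_deriv[OF vpos] v'] .
  moreover have "((\<lambda>r. \<epsilon>\<^sup>2 * (\<theta> r)\<^sup>2 * v r) has_real_derivative
      \<epsilon>\<^sup>2 * (- (2 * real m * (\<theta> r)\<^sup>2 / r)) * v r + v' r * (\<epsilon>\<^sup>2 * (\<theta> r)\<^sup>2)) (at r)"
    using r by (intro DERIV_mult DERIV_cmult \<theta>_sq_deriv v') auto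
  ultimately have "((\<lambda>r. q (v r) - q a + \<epsilon>\<^sup>2 * (\<theta> r)\<^sup>2 * v r - N r) has_real_derivative
      q' (v r) * v' r - 0 + (\<epsilon>\<^sup>2 * (- (2 * real m * (\<theta> r)\<^sup>2 / r)) * v r + v' r * (\<epsilon>\<^sup>2 * (\<theta> r)\<^sup>2))
      - - (real m * \<epsilon>\<^sup>2 * (\<theta> r)\<^sup>2 * v r / r)) (at r)"
    by (intro DERIV_diff DERIV_add N') auto
  moreover have "((\<lambda>r. q (v r) - q a + \<epsilon>\<^sup>2 * (\<theta> r)\<^sup>2 * v r - N r) has_real_derivative 0) (at r)"
    by (rule has_field_derivative_transform_within_open[of "\<lambda>_. 0" _ _ "{r0<..}"])
      (use eq r in auto)
  ultimately have "q' (v r) * v' r - 0 + (\<epsilon>\<^sup>2 * (- (2 * real m * (\<theta> r)\<^sup>2 / r)) * v r + v' r * (\<epsilon>\<^sup>2 * (\<theta> r)\<^sup>2))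
      - - (real m * \<epsilon>\<^sup>2 * (\<theta> r)\<^sup>2 * v r / r) = 0"
    by (rule DERIV_unique)
  then show ?thesis
    by (simp add: algebra_simps)
qed

lemma inviscid_flow_deriv_bound:
  assumes flow: "flow 0 \<epsilon> v v' N" and \<epsilon>: "small \<epsilon>" and r: "r > r0"
  shows "\<bar>v' r\<bar> \<le> K_slope * \<epsilon>\<^sup>2"
proof -
  have near: "\<bar>v r - a\<bar> \<le> \<eta>"
    using inviscid_flow_near[OF flow \<epsilon> r] by simp
  have "\<epsilon>\<^sup>2 * (\<theta> r)\<^sup>2 \<le> \<epsilon>\<^sup>2 * 1"
    using \<theta>_sq_le_1[of r] r by (intro mult_left_mono) auto
  then have "c / 2 \<le> - (q' (v r) + \<epsilon>\<^sup>2 * (\<theta> r)\<^sup>2)"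
    using q'_upper[OF near] small_le(1)[OF \<epsilon>] c_pos by linarith
  then have "\<bar>v' r\<bar> * (c / 2) \<le> \<bar>v' r\<bar> * \<bar>q' (v r) + \<epsilon>\<^sup>2 * (\<theta> r)\<^sup>2\<bar>"
    using c_pos by (intro mult_left_mono) auto
  also have "\<dots> = \<bar>real m * \<epsilon>\<^sup>2 * (\<theta> r)\<^sup>2 * v r / r\<bar>"
    by (simp only: inviscid_flow_deriv_eq[OF flow r] flip: abs_mult)
  also have "\<dots> = real m * \<epsilon>\<^sup>2 * (\<theta> r)\<^sup>2 * v r / r"
    using near_pos(1)[OF near] r r0_pos by simp
  also have "\<dots> \<le> real m * \<epsilon>\<^sup>2 * 1 * (2 * a) / r0"
    using near_pos[OF near] r r0_pos \<theta>_sq_le_1[of r]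
    by (intro frac_le mult_mono) auto
  finally show ?thesis
    using r0_pos c_pos by (simp add: K_slope_def field_simps)
qed

lemma inviscid_flow_lipschitz:
  assumes flow: "flow 0 \<epsilon> v v' N" and \<epsilon>: "small \<epsilon>" and "r \<ge> r0"
  shows "\<bar>v r - v r0\<bar> \<le> K_slope * \<epsilon>\<^sup>2 * (r - r0)"
proof (cases "r = r0")
  case False
  then have "r0 < r" using \<open>r \<ge> r0\<close> by simp
  moreover have "continuous_on {r0..r} v"
    using flow by (auto simp: flow_def elim: continuous_on_subset)
  ultimately obtain z where "r0 < z" "v r - v r0 = (r - r0) * v' z"
    by (rule mean_value[where f' = v']) (use flow in \<open>auto simp: flow_def\<close>)
  moreover have "\<bar>v' z\<bar> * (r - r0) \<le> K_slope * \<epsilon>\<^sup>2 * (r - r0)"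
    using inviscid_flow_deriv_bound[OF flow \<epsilon> \<open>r0 < z\<close>] \<open>r \<ge> r0\<close> by (intro mult_right_mono) auto
  ultimately show ?thesis
    using \<open>r \<ge> r0\<close> by (simp add: abs_mult mult.commute)
qed simp

section \<open>Planar layers: decay, uniqueness, existence\<close>

text \<open>The damping inequality is available only while v stays near \<open>a\<close>, so a
  barrier for (v - vi)^2 at height (\<eta> / 2)^2 precedes the decay estimate. The rate is c / 2
  because the destabilising term \<epsilon>^2 (v - vi) uses up at most c / 16 of the slope
  \<open>c\<close>.\<close>

lemma layer_decay:
  assumes layer: "layer \<epsilon> vi v v'" and \<epsilon>: "small \<epsilon>"
    and vi: "\<bar>vi - a\<bar> \<le> \<eta> / 4" and init: "\<bar>v 0 - a\<bar> \<le> \<eta> / 4" and "y \<ge> 0"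
  shows "\<bar>v y - vi\<bar> \<le> \<bar>v 0 - vi\<bar> * exp (- (c / 2 / \<epsilon>) * y)" and "\<bar>v y - a\<bar> \<le> \<eta>"
proof -
  have cont: "continuous_on {0..} v"
    and v': "\<And>y. y > 0 \<Longrightarrow> (v has_real_derivative v' y) (at y)"
    and eq: "\<And>y. y > 0 \<Longrightarrow> \<epsilon> * v' y = \<epsilon>\<^sup>2 * (v y - vi) + q (v y) - q vi"
    using layer by (auto simp: layer_def)
  have "\<epsilon> > 0" using small_le(2)[OF \<epsilon>] .
  have damp: "(v y - vi) * v' y \<le> - (c / 2 / \<epsilon>) * (v y - vi)\<^sup>2" if "y > 0" "\<bar>v y - a\<bar> \<le> \<eta>" for y
  proof -
    have "(v y - vi) * (q (v y) - q vi) \<le> - c * (v y - vi)\<^sup>2"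
      using vi \<eta>_pos that by (intro q_dissipative) auto
    moreover have "\<epsilon>\<^sup>2 * (v y - vi)\<^sup>2 \<le> c / 16 * (v y - vi)\<^sup>2"
      using small_le(1)[OF \<epsilon>] by (intro mult_right_mono) auto
    moreover have "\<epsilon> * ((v y - vi) * v' y) = \<epsilon>\<^sup>2 * (v y - vi)\<^sup>2 + (v y - vi) * (q (v y) - q vi)"
      using arg_cong[OF eq[OF that(1)], of "\<lambda>x. (v y - vi) * x"]
      by (simp add: power2_eq_square algebra_simps)
    moreover have "c * (v y - vi)\<^sup>2 \<ge> 0"
      using c_pos by simp
    ultimately have "\<epsilon> * ((v y - vi) * v' y) \<le> - (c / 2) * (v y - vi)\<^sup>2"
      by simp
    then show ?thesis
      using \<open>\<epsilon> > 0\<close> by (simp add: field_simps)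
  qed
  have init': "\<bar>v 0 - vi\<bar> \<le> \<eta> / 2"
    using init vi by linarith
  \<comment> \<open>In the strip above the barrier (v - vi)^2 is at most \<eta>^2 / 2, which is
    below (3 \<eta> / 4)^2; the remaining \<eta> / 4 is the distance allowed between
    \<open>vi\<close> and \<open>a\<close>.\<close>
  have in_region: "\<bar>v y - a\<bar> \<le> \<eta>" if "(v y - vi)\<^sup>2 \<le> (\<eta> / 2)\<^sup>2 + \<eta>\<^sup>2 / 4" for y
  proof -
    have "(\<eta> / 2)\<^sup>2 = \<eta>\<^sup>2 / 4" "(3 / 4 * \<eta>)\<^sup>2 = 9 / 16 * \<eta>\<^sup>2"
      by (simp_all add: power2_eq_square)
    then have "(v y - vi)\<^sup>2 \<le> (3 / 4 * \<eta>)\<^sup>2"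
      using that zero_le_power2[of \<eta>] by linarith
    then have "\<bar>v y - vi\<bar> \<le> 3 / 4 * \<eta>"
      using \<eta>_pos abs_le_square_iff[of "v y - vi" "3 / 4 * \<eta>"] by simp
    with vi show ?thesis by linarith
  qed
  have trap: "(v y - vi)\<^sup>2 - (\<eta> / 2)\<^sup>2 \<le> 0" if "y \<ge> 0" for y
  proof (rule barrier[where h = "\<eta>\<^sup>2 / 4" and w' = "\<lambda>y. 2 * ((v y - vi) * v' y)"
        and w = "\<lambda>y. (v y - vi)\<^sup>2 - (\<eta> / 2)\<^sup>2" and a = 0])
    show "(v 0 - vi)\<^sup>2 - (\<eta> / 2)\<^sup>2 \<le> 0"
      using abs_le_square_iff[of "v 0 - vi" "\<eta> / 2"] init' \<eta>_pos by simp
    fix y :: real assume "y > 0"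
    then show "((\<lambda>y. (v y - vi)\<^sup>2 - (\<eta> / 2)\<^sup>2) has_real_derivative 2 * ((v y - vi) * v' y)) (at y)"
      using v' by (auto intro!: derivative_eq_intros)
    assume "(v y - vi)\<^sup>2 - (\<eta> / 2)\<^sup>2 < \<eta>\<^sup>2 / 4"
    then have "\<bar>v y - a\<bar> \<le> \<eta>"
      by (intro in_region) simp
    then have "(v y - vi) * v' y \<le> - (c / 2 / \<epsilon>) * (v y - vi)\<^sup>2"
      using damp \<open>y > 0\<close> by blast
    also have "\<dots> \<le> 0"
      using c_pos \<open>\<epsilon> > 0\<close> by simp
    finally show "2 * ((v y - vi) * v' y) \<le> 0" by linarith
  qed (use \<eta>_pos that in \<open>auto intro!: continuous_intros cont\<close>)
  have near: "\<bar>v y - a\<bar> \<le> \<eta>" if "y \<ge> 0" for y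
    using trap[OF that] by (intro in_region) (simp add: add_increasing2)
  then show "\<bar>v y - a\<bar> \<le> \<eta>"
    using \<open>y \<ge> 0\<close> by blast
  show "\<bar>v y - vi\<bar> \<le> \<bar>v 0 - vi\<bar> * exp (- (c / 2 / \<epsilon>) * y)"
  proof (rule exp_decay_halfline[where w' = v' and w = "\<lambda>y. v y - vi"])
    fix y :: real assume "y > 0"
    then show "((\<lambda>y. v y - vi) has_real_derivative v' y) (at y)"
      using v' by (auto intro!: derivative_eq_intros)
    show "(v y - vi) * v' y \<le> - (c / 2 / \<epsilon>) * (v y - vi)\<^sup>2"
      using \<open>y > 0\<close> by (intro damp near) auto
  qed (use \<open>y \<ge> 0\<close> in \<open>auto intro!: continuous_intros cont\<close>)
qed

text \<open>Both layers stay where \<open>q\<close> is dissipative, so the modulus of their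
  difference cannot grow from zero; the decay lemma at rate 0 expresses this.\<close>

lemma layer_unique:
  assumes layers: "layer \<epsilon> vi v v'" "layer \<epsilon> vi w w'" and \<epsilon>: "small \<epsilon>"
    and vi: "\<bar>vi - a\<bar> \<le> \<eta> / 4" and init: "\<bar>v 0 - a\<bar> \<le> \<eta> / 4" "w 0 = v 0" and "y \<ge> 0"
  shows "w y = v y"
proof -
  have "\<epsilon> > 0" using small_le(2)[OF \<epsilon>] .
  have "\<bar>w y - v y\<bar> \<le> \<bar>w 0 - v 0\<bar> * exp (- 0 * y)"
  proof (rule exp_decay_halfline[where w' = "\<lambda>y. w' y - v' y" and w = "\<lambda>y. w y - v y"])
    show "continuous_on {0..} (\<lambda>y. w y - v y)"
      using layers by (intro continuous_intros) (auto simp: layer_def)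
    fix y :: real assume "y > 0"
    then show "((\<lambda>y. w y - v y) has_real_derivative w' y - v' y) (at y)"
      using layers by (intro DERIV_diff) (auto simp: layer_def)
    have "\<epsilon> * w' y = \<epsilon>\<^sup>2 * (w y - vi) + q (w y) - q vi" "\<epsilon> * v' y = \<epsilon>\<^sup>2 * (v y - vi) + q (v y) - q vi"
      using layers \<open>y > 0\<close> by (auto simp: layer_def)
    then have "\<epsilon> * (w' y - v' y) = \<epsilon>\<^sup>2 * (w y - v y) + (q (w y) - q (v y))"
      by (simp add: algebra_simps)
    from arg_cong[OF this, of "\<lambda>x. (w y - v y) * x"]
    have "\<epsilon> * ((w y - v y) * (w' y - v' y)) = \<epsilon>\<^sup>2 * (w y - v y)\<^sup>2 + (w y - v y) * (q (w y) - q (v y))"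
      by (simp add: power2_eq_square algebra_simps)
    moreover have "(w y - v y) * (q (w y) - q (v y)) \<le> - c * (w y - v y)\<^sup>2"
      using layer_decay(2)[OF layers(1) \<epsilon> vi init(1), of y]
        layer_decay(2)[OF layers(2) \<epsilon> vi, of y] init \<open>y > 0\<close> by (intro q_dissipative) auto
    moreover have "\<epsilon>\<^sup>2 * (w y - v y)\<^sup>2 \<le> c / 16 * (w y - v y)\<^sup>2"
      using small_le(1)[OF \<epsilon>] by (intro mult_right_mono) auto
    moreover have "c * (w y - v y)\<^sup>2 \<ge> 0"
      using c_pos by simp
    ultimately have "\<epsilon> * ((w y - v y) * (w' y - v' y)) \<le> 0"
      by simp
    then show "(w y - v y) * (w' y - v' y) \<le> - 0 * (w y - v y)\<^sup>2"
      using \<open>\<epsilon> > 0\<close> by (simp add: mult_le_0_iff)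
  qed (use \<open>y \<ge> 0\<close> in auto)
  with init(2) show ?thesis by simp
qed

text \<open>In the variable x = v - vi the secant slope of \<open>q\<close> lies between -L and -c,
  which places -x f(x) between c x^2 / (2 \<epsilon>) and L x^2 / \<epsilon>, as the damped equation
  demands.\<close>

lemma layer_exists:
  assumes \<epsilon>: "small \<epsilon>" and vi: "\<bar>vi - a\<bar> \<le> \<eta> / 4" and v0: "\<bar>v0 - a\<bar> \<le> \<eta> / 4"
  obtains v where "v 0 = v0" "\<And>y. y \<ge> 0 \<Longrightarrow> \<bar>v y - a\<bar> \<le> \<eta>"
    "\<And>y. y \<ge> 0 \<Longrightarrow> (v has_real_derivative (\<epsilon>\<^sup>2 * (v y - vi) + q (v y) - q vi) / \<epsilon>) (at y)"
proof -
  have "\<epsilon> > 0" using small_le(2)[OF \<epsilon>] .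
  define f where "f x = (\<epsilon>\<^sup>2 * x + q (vi + x) - q vi) / \<epsilon>" for x
  have near: "\<bar>vi + x - a\<bar> \<le> \<eta>" if "\<bar>x\<bar> \<le> \<bar>v0 - vi\<bar>" for x
    using that vi v0 \<eta>_pos by linarith
  have near_vi: "\<bar>vi - a\<bar> \<le> \<eta>"
    using vi \<eta>_pos by linarith
  have slope: "\<exists>k. c \<le> k \<and> k \<le> L \<and> q (vi + x) - q vi = - k * x" if x: "\<bar>x\<bar> \<le> \<bar>v0 - vi\<bar>" for x
  proof (cases "x = 0")
    case True
    have "c \<le> L"
      using q'_upper[OF near_vi] q'_lower[OF near_vi] by linarith
    with True show ?thesis by auto
  next
    case False
    then obtain k where "q (vi + x) - q vi = - k * (vi + x - vi)" "c \<le> k" "k \<le> L"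
      using q_slope[OF near_vi near[OF x]] by (metis add_cancel_left_right)
    then show ?thesis by auto
  qed
  have xf: "\<exists>k. c \<le> k \<and> k \<le> L \<and> - (x * f x) = (k - \<epsilon>\<^sup>2) / \<epsilon> * x\<^sup>2" if x: "\<bar>x\<bar> \<le> \<bar>v0 - vi\<bar>" for x
  proof -
    obtain k where k: "c \<le> k" "k \<le> L" "q (vi + x) - q vi = - k * x"
      using slope[OF x] by blast
    have fx: "f x = (\<epsilon>\<^sup>2 * x + - k * x) / \<epsilon>"
      unfolding k(3)[symmetric] by (simp add: f_def)
    have "- (x * f x) = (k - \<epsilon>\<^sup>2) / \<epsilon> * x\<^sup>2"
      unfolding fx using \<open>\<epsilon> > 0\<close> by (simp add: power2_eq_square field_simps)
    with k show ?thesis by blast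
  qed
  obtain w where w: "w 0 = v0 - vi" "\<And>y. y \<ge> 0 \<Longrightarrow> (w has_real_derivative f (w y)) (at y)"
    "\<And>y. y \<ge> 0 \<Longrightarrow> \<bar>w y\<bar> \<le> \<bar>v0 - vi\<bar>"
  proof (rule damped_ode_solution[of "v0 - vi" f "c / 2 / \<epsilon>" "L / \<epsilon>"])
    fix x assume x: "\<bar>x\<bar> \<le> \<bar>v0 - vi\<bar>"
    have "isCont q (vi + x)"
      using q_deriv[OF near_pos(1)[OF near[OF x]]] by (rule DERIV_isCont)
    then have "isCont (\<lambda>x. q (vi + x)) x"
      by (rule isCont_o2[of x "\<lambda>x. vi + x" q, rotated]) simp
    then show "isCont f x"
      unfolding f_def using \<open>\<epsilon> > 0\<close> by (intro continuous_intros) auto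
    obtain k where k: "c \<le> k" "k \<le> L" "- (x * f x) = (k - \<epsilon>\<^sup>2) / \<epsilon> * x\<^sup>2"
      using xf[OF x] by blast
    have "c / 2 \<le> k - \<epsilon>\<^sup>2"
      using k(1) small_le(1)[OF \<epsilon>] c_pos by linarith
    then show "c / 2 / \<epsilon> * x\<^sup>2 \<le> - (x * f x)"
      unfolding k(3) using \<open>\<epsilon> > 0\<close> by (intro mult_right_mono divide_right_mono) auto
    have "k - \<epsilon>\<^sup>2 \<le> L"
      using k(2) zero_le_power2[of \<epsilon>] by linarith
    then show "- (x * f x) \<le> L / \<epsilon> * x\<^sup>2"
      unfolding k(3) using \<open>\<epsilon> > 0\<close> by (intro mult_right_mono divide_right_mono) auto
  qed (use c_pos \<open>\<epsilon> > 0\<close> in \<open>auto simp: f_def\<close>)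
  show ?thesis
  proof (rule that[of "\<lambda>y. vi + w y"])
    show "vi + w 0 = v0" using w(1) by simp
    fix y :: real assume "y \<ge> 0"
    show "\<bar>vi + w y - a\<bar> \<le> \<eta>"
      by (rule near[OF w(3)[OF \<open>y \<ge> 0\<close>]])
    show "((\<lambda>y. vi + w y) has_real_derivative
        (\<epsilon>\<^sup>2 * (vi + w y - vi) + q (vi + w y) - q vi) / \<epsilon>) (at y)"
      using w(2)[OF \<open>y \<ge> 0\<close>] by (auto simp: f_def intro!: derivative_eq_intros)
  qed
qed

subsection \<open>Maximum principle for the superposition error\<close>

text \<open>Collects the estimates \<open>T2\<close> to \<open>T6\<close> of the approximation
  lemma, divided by \<epsilon> \<mu>. Four of them contain the bound \<eta> \<epsilon> \<mu> / c for
  (r - r0) |b|; the summand \<open>K_slope\<close> comes from the viscosity acting on the Euler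
  profile, and 2 / c is what remains to be inverted after absorbing the terms proportional to the
  error.\<close>

definition K_error :: real where
  "K_error = 2 / c * ((M * K_slope + real m / r0 * (2 + L)) * \<eta> / c + K_slope)"

text \<open>The layer lives on the scale \<open>\<epsilon> \<mu>\<close>: near \<open>r0\<close> the factor \<open>r - r0\<close> is small, away from it \<open>b\<close> is.\<close>
lemma layer_profile:
  assumes layer: "layer \<epsilon> vi vB vB'" and \<epsilon>: "small \<epsilon>" and "\<mu> > 0"
    and vi: "\<bar>vi - a\<bar> \<le> \<eta> / 4" and init: "\<bar>vB 0 - a\<bar> \<le> \<eta> / 4" and "r \<ge> r0"
  defines "b \<equiv> vB ((r - r0) / \<mu>) - vi" and "l \<equiv> c / 2 / (\<epsilon> * \<mu>)"
  shows "\<bar>b\<bar> \<le> \<eta> / 2 * exp (- l * (r - r0))" and "\<bar>b\<bar> \<le> \<eta> / 2"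
    and "(r - r0) * \<bar>b\<bar> \<le> \<eta> * \<epsilon> * \<mu> / c"
proof -
  have "\<epsilon> > 0" using small_le(2)[OF \<epsilon>] .
  have "l > 0"
    using c_pos \<open>\<epsilon> > 0\<close> \<open>\<mu> > 0\<close> by (simp add: l_def)
  have y: "(r - r0) / \<mu> \<ge> 0"
    using \<open>r \<ge> r0\<close> \<open>\<mu> > 0\<close> by simp
  show b: "\<bar>b\<bar> \<le> \<eta> / 2 * exp (- l * (r - r0))"
  proof -
    have "\<bar>b\<bar> \<le> \<bar>vB 0 - vi\<bar> * exp (- (c / 2 / \<epsilon>) * ((r - r0) / \<mu>))"
      unfolding b_def by (rule layer_decay(1)[OF layer \<epsilon> vi init y])
    moreover have "- (c / 2 / \<epsilon>) * ((r - r0) / \<mu>) = - l * (r - r0)"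
      by (simp add: l_def)
    moreover have "\<bar>vB 0 - vi\<bar> \<le> \<eta> / 2"
      using vi init by linarith
    ultimately show ?thesis
      by (metis exp_ge_zero mult_right_mono order_trans)
  qed
  have "\<eta> / 2 * exp (- l * (r - r0)) \<le> \<eta> / 2 * 1"
    using \<eta>_pos \<open>l > 0\<close> \<open>r \<ge> r0\<close> by (intro mult_left_mono) auto
  with b show "\<bar>b\<bar> \<le> \<eta> / 2" by simp
  \<comment> \<open>Multiplying t \<le> exp t, with t = l (r - r0), by exp (-t) bounds (r - r0) exp
    (-t) by 1 / l = 2 \<epsilon> \<mu> / c.\<close>
  have "l * (r - r0) \<le> exp (l * (r - r0))"
    using exp_ge_add_one_self[of "l * (r - r0)"] by linarith
  then have "l * (r - r0) * exp (- l * (r - r0)) \<le> exp (l * (r - r0)) * exp (- l * (r - r0))"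
    by (intro mult_right_mono) auto
  then have "l * ((r - r0) * exp (- l * (r - r0))) \<le> 1"
    by (simp add: mult.assoc flip: exp_add)
  then have *: "(r - r0) * exp (- l * (r - r0)) \<le> 1 / l"
    using \<open>l > 0\<close> by (simp add: pos_le_divide_eq mult.commute)
  have "(r - r0) * \<bar>b\<bar> \<le> (r - r0) * (\<eta> / 2 * exp (- l * (r - r0)))"
    using b \<open>r \<ge> r0\<close> by (intro mult_left_mono) auto
  also have "\<dots> = \<eta> / 2 * ((r - r0) * exp (- l * (r - r0)))"
    by simp
  also have "\<dots> \<le> \<eta> / 2 * (1 / l)"
    using * \<eta>_pos by (intro mult_left_mono) auto
  also have "\<dots> = \<eta> * \<epsilon> * \<mu> / c"
    by (simp add: l_def)
  finally show "(r - r0) * \<bar>b\<bar> \<le> \<eta> * \<epsilon> * \<mu> / c" .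
qed

lemma L_M_nonneg: "L \<ge> 0" "M \<ge> 0"
  using q'_upper[of a] q'_lower[of a] q''_bound[of a] \<eta>_pos c_pos by auto

lemma K_error_nonneg: "K_error \<ge> 0"
  unfolding K_error_def
  using L_M_nonneg K_slope_nonneg c_pos \<eta>_pos r0_pos by simp

lemma flow_approximation:
  assumes flow: "flow \<mu> \<epsilon> v v' N" and eflow: "flow 0 \<epsilon> vE vE' NE"
    and layer: "layer \<epsilon> (vE r0) vB vB'" and \<epsilon>: "small \<epsilon>" and "\<mu> > 0"
    and init: "\<bar>v r0 - a\<bar> \<le> \<eta> / 4" "vB 0 = v r0"
    and "s \<ge> r0"
  defines "w \<equiv> \<lambda>r. v r - vE r - (vB ((r - r0) / \<mu>) - vE r0)"
  shows "\<bar>w s\<bar> \<le> K_error * \<epsilon> * \<mu>"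
proof (cases "w s = 0")
  case True
  then show ?thesis
    using K_error_nonneg small_le(2)[OF \<epsilon>] \<open>\<mu> > 0\<close> by simp
next
  case False
  have "\<epsilon> > 0" using small_le(2)[OF \<epsilon>] .
  define b where "b r = vB ((r - r0) / \<mu>) - vE r0" for r
  define l where "l = c / 2 / (\<epsilon> * \<mu>)"
  define X where "X = \<eta> * \<epsilon> * \<mu> / c"
  have "l > 0"
    using c_pos \<open>\<epsilon> > 0\<close> \<open>\<mu> > 0\<close> by (simp add: l_def)
  have "X \<ge> 0"
    using c_pos \<open>\<epsilon> > 0\<close> \<open>\<mu> > 0\<close> \<eta>_pos by (simp add: X_def)
  have w: "w r = v r - vE r - b r" for r
    by (simp add: w_def b_def)
  have vE_quarter: "\<bar>vE r - a\<bar> \<le> \<eta> / 4" if "r \<ge> r0" for r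
    using inviscid_flow_quarter[OF eflow \<epsilon> that] .
  have y: "(r - r0) / \<mu> \<ge> 0" if "r \<ge> r0" for r
    using that \<open>\<mu> > 0\<close> by simp
  have b: "\<bar>b r\<bar> \<le> \<eta> / 2 * exp (- l * (r - r0))" and b_le: "\<bar>b r\<bar> \<le> \<eta> / 2"
    and rb: "(r - r0) * \<bar>b r\<bar> \<le> X" if "r \<ge> r0" for r
    unfolding b_def l_def X_def
    using layer_profile[OF layer \<epsilon> \<open>\<mu> > 0\<close> vE_quarter[of r0] _ that] init by auto

  have cont_vB: "continuous_on {r0..} (\<lambda>r. vB ((r - r0) / \<mu>))"
  proof (rule continuous_on_compose2[of "{0..}" vB])
    show "continuous_on {0..} vB" using layer by (simp add: layer_def)
    show "continuous_on {r0..} (\<lambda>r. (r - r0) / \<mu>)"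
      using \<open>\<mu> > 0\<close> by (intro continuous_intros) auto
  qed (use y in auto)
  have contw: "continuous_on {r0..} w"
    unfolding w_def using flow eflow by (intro continuous_intros cont_vB) (auto simp: flow_def)
  have "w r0 = 0"
    using init by (simp add: w_def)
  have "(b \<longlongrightarrow> 0) at_top"
  proof (rule Lim_null_comparison[where g = "\<lambda>r. \<eta> / 2 * exp (- l * (r - r0))"])
    show "\<forall>\<^sub>F r in at_top. norm (b r) \<le> \<eta> / 2 * exp (- l * (r - r0))"
      using eventually_ge_at_top[of r0] by eventually_elim (use b in auto)
    have "((\<lambda>r. \<eta> / 2 * exp (- l * (r - r0))) \<longlongrightarrow> \<eta> / 2 * 0) at_top"
      by (intro tendsto_intros exp_decay_tendsto \<open>l > 0\<close>)
    then show "((\<lambda>r. \<eta> / 2 * exp (- l * (r - r0))) \<longlongrightarrow> 0) at_top" by simp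
  qed
  moreover have "(v \<longlongrightarrow> a) at_top" "(vE \<longlongrightarrow> a) at_top"
    using flow eflow by (auto simp: flow_def)
  ultimately have "((\<lambda>r. v r - vE r - b r) \<longlongrightarrow> a - a - 0) at_top"
    by (intro tendsto_intros)
  then have limw: "(w \<longlongrightarrow> 0) at_top"
    by (simp add: w[abs_def])
  obtain r where r: "r > r0" "w r \<noteq> 0" and max: "\<And>s. s \<ge> r0 \<Longrightarrow> \<bar>w s\<bar> \<le> \<bar>w r\<bar>"
    using abs_attains_max_halfline[OF contw \<open>w r0 = 0\<close> limw \<open>s \<ge> r0\<close> False] by blast
  define W where "W = \<bar>w r\<bar>"

  have vB': "((\<lambda>r. vB ((r - r0) / \<mu>)) has_real_derivative vB' ((r - r0) / \<mu>) * (1 / \<mu>)) (at r)"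
  proof (rule DERIV_chain2[where f = vB])
    show "(vB has_real_derivative vB' ((r - r0) / \<mu>)) (at ((r - r0) / \<mu>))"
      using layer r \<open>\<mu> > 0\<close> by (simp add: layer_def)
    show "((\<lambda>r. (r - r0) / \<mu>) has_real_derivative 1 / \<mu>) (at r)"
      using \<open>\<mu> > 0\<close> by (auto intro!: derivative_eq_intros)
  qed
  have "(w has_real_derivative v' r - vE' r - (vB' ((r - r0) / \<mu>) * (1 / \<mu>) - 0)) (at r)"
    unfolding w_def using flow eflow r by (intro DERIV_diff vB' DERIV_const) (auto simp: flow_def)
  then have "v' r - vE' r - (vB' ((r - r0) / \<mu>) * (1 / \<mu>) - 0) = 0"
    by (rule derivative_zero_at_abs_max[where w = w and x = r and a = r0]) (use r max in auto)
  then have "\<mu> * v' r = \<mu> * vE' r + vB' ((r - r0) / \<mu>)"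
    using \<open>\<mu> > 0\<close> by (simp add: field_simps)
  then have "\<mu> * \<epsilon> * \<theta> r * v' r = \<mu> * \<epsilon> * \<theta> r * vE' r + \<theta> r * (\<epsilon> * vB' ((r - r0) / \<mu>))"
    by (metis (no_types, opaque_lifting) distrib_left mult.assoc mult.commute)
  moreover have "\<mu> * \<epsilon> * \<theta> r * v' r = q (v r) - q a + \<epsilon>\<^sup>2 * (\<theta> r)\<^sup>2 * v r - N r"
    using flow r by (simp add: flow_def)
  moreover have "0 = q (vE r) - q a + \<epsilon>\<^sup>2 * (\<theta> r)\<^sup>2 * vE r - NE r"
    using eflow r by (simp add: flow_def)
  moreover have "\<epsilon> * vB' ((r - r0) / \<mu>) = \<epsilon>\<^sup>2 * b r + q (vE r0 + b r) - q (vE r0)"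
    using layer r \<open>\<mu> > 0\<close> by (simp add: layer_def b_def)
  ultimately have "q (v r) - q (vE r) + \<epsilon>\<^sup>2 * (\<theta> r)\<^sup>2 * (v r - vE r) - (N r - NE r)
      = \<mu> * \<epsilon> * \<theta> r * vE' r + \<theta> r * (\<epsilon>\<^sup>2 * b r + q (vE r0 + b r) - q (vE r0))"
    by (simp add: algebra_simps)
  moreover have "v r - vE r = w r + b r"
    by (simp add: w)
  \<comment> \<open>The arguments of \<open>q\<close> on the left differ by \<open>w r\<close>, so
    the left side controls the error. On the right stand, in order: convection of the error, the
    layer increment of \<open>q\<close> taken at the wrong Euler state, two effects of replacing
    \<theta> by 1 inside the layer, the nonlocal term, and the viscosity of the Euler flow.\<close>
  ultimately have key: "q (v r) - q (vE r + b r) =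
      - (\<epsilon>\<^sup>2 * (\<theta> r)\<^sup>2 * w r)
      - (q (vE r + b r) - q (vE r) - q (vE r0 + b r) + q (vE r0))
      + \<epsilon>\<^sup>2 * \<theta> r * (1 - \<theta> r) * b r
      - (1 - \<theta> r) * (q (vE r0 + b r) - q (vE r0))
      + (N r - NE r) + \<mu> * \<epsilon> * \<theta> r * vE' r"
    by (simp add: algebra_simps power2_eq_square)

  have r': "r \<ge> r0" using r by simp
  have near: "\<bar>v r - a\<bar> \<le> \<eta>" "\<bar>vE r + b r - a\<bar> \<le> \<eta>" "\<bar>vE r - a\<bar> \<le> \<eta>"
      "\<bar>vE r0 + b r - a\<bar> \<le> \<eta>" "\<bar>vE r0 - a\<bar> \<le> \<eta>"
    using flow_trapped[OF flow \<open>\<mu> > 0\<close> \<epsilon> _ r'] init(1) vE_quarter[OF r'] vE_quarter[of r0] b_le[OF r'] \<eta>_pos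
    by linarith+
  have \<theta>: "0 < \<theta> r" "\<theta> r \<le> 1" "(\<theta> r)\<^sup>2 \<le> 1"
    using \<theta>_pos[OF r'] \<theta>_le_1[OF r'] \<theta>_sq_le_1[OF r'] by auto
  have \<epsilon>1: "\<epsilon>\<^sup>2 \<le> 1" using small_le(3)[OF \<epsilon>] .
  have \<theta>b: "(1 - \<theta> r) * \<bar>b r\<bar> \<le> real m / r0 * X"
  proof -
    have "(1 - \<theta> r) * \<bar>b r\<bar> \<le> real m / r0 * (r - r0) * \<bar>b r\<bar>"
      using one_minus_\<theta>_le[OF r'] by (intro mult_right_mono) auto
    also have "\<dots> \<le> real m / r0 * X"
      using rb[OF r'] r0_pos by (simp only: mult.assoc) (intro mult_left_mono, auto)
    finally show ?thesis .
  qed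
  have mX: "real m / r0 * X \<ge> 0"
    using \<open>X \<ge> 0\<close> r0_pos by simp
  have T1: "\<bar>\<epsilon>\<^sup>2 * (\<theta> r)\<^sup>2 * w r\<bar> \<le> \<epsilon>\<^sup>2 * W"
  proof -
    have "\<epsilon>\<^sup>2 * (\<theta> r)\<^sup>2 * W \<le> \<epsilon>\<^sup>2 * 1 * W"
      using \<theta> by (intro mult_right_mono mult_left_mono) (auto simp: W_def)
    then show ?thesis by (simp add: abs_mult W_def)
  qed
  have T2: "\<bar>q (vE r + b r) - q (vE r) - q (vE r0 + b r) + q (vE r0)\<bar> \<le> M * K_slope * X"
  proof -
    have "\<bar>q (vE r + b r) - q (vE r) - q (vE r0 + b r) + q (vE r0)\<bar> \<le> M * \<bar>vE r - vE r0\<bar> * \<bar>b r\<bar>"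
    proof (rule second_difference_bound[of "a - \<eta>" "a + \<eta>" q q' q''])
      fix x assume "x \<in> {a - \<eta>..a + \<eta>}"
      then have *: "\<bar>x - a\<bar> \<le> \<eta>" by (auto simp: abs_le_iff)
      show "(q has_real_derivative q' x) (at x)" "(q' has_real_derivative q'' x) (at x)" "\<bar>q'' x\<bar> \<le> M"
        using q_deriv q'_deriv q''_bound near_pos(1)[OF *] * by auto
    qed (use near in \<open>auto simp: abs_le_iff\<close>)
    also have "\<dots> \<le> M * (K_slope * 1 * (r - r0)) * \<bar>b r\<bar>"
    proof -
      have "\<bar>vE r - vE r0\<bar> \<le> K_slope * \<epsilon>\<^sup>2 * (r - r0)"
        by (rule inviscid_flow_lipschitz[OF eflow \<epsilon> r'])
      also have "\<dots> \<le> K_slope * 1 * (r - r0)"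
        using \<epsilon>1 K_slope_nonneg r' by (intro mult_right_mono mult_left_mono) auto
      finally show ?thesis
        using L_M_nonneg by (intro mult_right_mono mult_left_mono) auto
    qed
    also have "\<dots> = M * K_slope * ((r - r0) * \<bar>b r\<bar>)"
      by simp
    also have "\<dots> \<le> M * K_slope * X"
      using rb[OF r'] L_M_nonneg K_slope_nonneg by (intro mult_left_mono) auto
    finally show ?thesis .
  qed
  have T3: "\<bar>\<epsilon>\<^sup>2 * \<theta> r * (1 - \<theta> r) * b r\<bar> \<le> real m / r0 * X"
  proof -
    have "\<bar>\<epsilon>\<^sup>2 * \<theta> r * (1 - \<theta> r) * b r\<bar> = (\<epsilon>\<^sup>2 * \<theta> r) * ((1 - \<theta> r) * \<bar>b r\<bar>)"
      using \<theta> by (simp add: abs_mult)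
    also have "\<dots> \<le> 1 * (real m / r0 * X)"
    proof (rule mult_mono[OF _ \<theta>b])
      show "\<epsilon>\<^sup>2 * \<theta> r \<le> 1"
        using \<theta> \<epsilon>1 by (intro mult_le_one) auto
    qed (use \<theta> in auto)
    finally show ?thesis by simp
  qed
  have T4: "\<bar>(1 - \<theta> r) * (q (vE r0 + b r) - q (vE r0))\<bar> \<le> real m / r0 * X * L"
  proof -
    have "\<bar>q (vE r0 + b r) - q (vE r0)\<bar> \<le> L * \<bar>vE r0 + b r - vE r0\<bar>"
      by (rule q_lipschitz) (use near in auto)
    then have "(1 - \<theta> r) * \<bar>q (vE r0 + b r) - q (vE r0)\<bar> \<le> (1 - \<theta> r) * (L * \<bar>b r\<bar>)"
      using \<theta> by (intro mult_left_mono) auto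
    also have "\<dots> = (1 - \<theta> r) * \<bar>b r\<bar> * L"
      by simp
    also have "\<dots> \<le> real m / r0 * X * L"
      using \<theta>b L_M_nonneg by (intro mult_right_mono) auto
    finally show ?thesis
      using \<theta> by (simp add: abs_mult)
  qed
  have T5: "\<bar>N r - NE r\<bar> \<le> \<epsilon>\<^sup>2 * W / 2 + real m / r0 * X"
  proof -
    have "\<bar>N r - NE r\<bar> \<le> \<epsilon>\<^sup>2 * W / 2 * (\<theta> r)\<^sup>2 + real m / r0 * \<epsilon>\<^sup>2 * (\<eta> / 2) / l * exp (- l * (r - r0))"
    proof (rule nonlocal_term_abs_le[where z = "\<lambda>r. v r - vE r" and N = "\<lambda>r. N r - NE r"])
      fix s assume s: "s > r0"
      have "((\<lambda>r. N r - NE r) has_real_derivative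
          - (real m * \<epsilon>\<^sup>2 * (\<theta> s)\<^sup>2 * v s / s) - - (real m * \<epsilon>\<^sup>2 * (\<theta> s)\<^sup>2 * vE s / s)) (at s)"
        using flow eflow s by (intro DERIV_diff) (auto simp: flow_def)
      then show "((\<lambda>r. N r - NE r) has_real_derivative
          - (real m * \<epsilon>\<^sup>2 * (\<theta> s)\<^sup>2 * (v s - vE s) / s)) (at s)"
        by (rule DERIV_cong) (simp add: algebra_simps diff_divide_distrib)
      have "v s - vE s = w s + b s" by (simp add: w)
      then show "\<bar>v s - vE s\<bar> \<le> W + \<eta> / 2 * exp (- l * (s - r0))"
        using max[of s] b[of s] s unfolding W_def by linarith
    next
      show "((\<lambda>r. N r - NE r) \<longlongrightarrow> 0) at_top"
        using flow eflow tendsto_diff[of N 0 at_top NE 0] by (simp add: flow_def)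
    qed (use \<eta>_pos \<open>l > 0\<close> r in auto)
    also have "\<dots> \<le> \<epsilon>\<^sup>2 * W / 2 * 1 + real m / r0 * X * 1"
    proof (intro add_mono mult_mono)
      have "real m / r0 * \<epsilon>\<^sup>2 * (\<eta> / 2) / l = \<epsilon>\<^sup>2 * (real m / r0 * X)"
        by (simp add: l_def X_def)
      also have "\<dots> \<le> 1 * (real m / r0 * X)"
        using \<epsilon>1 mX by (intro mult_right_mono) auto
      finally show "real m / r0 * \<epsilon>\<^sup>2 * (\<eta> / 2) / l \<le> real m / r0 * X" by simp
    qed (use \<theta> mX r' \<open>l > 0\<close> in \<open>auto simp: W_def\<close>)
    finally show ?thesis by simp
  qed
  have T6: "\<bar>\<mu> * \<epsilon> * \<theta> r * vE' r\<bar> \<le> K_slope * \<epsilon> * \<mu>"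
  proof -
    have "\<bar>\<mu> * \<epsilon> * \<theta> r * vE' r\<bar> = \<mu> * \<epsilon> * (\<theta> r * \<bar>vE' r\<bar>)"
      using \<open>\<epsilon> > 0\<close> \<open>\<mu> > 0\<close> \<theta> by (simp add: abs_mult)
    also have "\<dots> \<le> \<mu> * \<epsilon> * (1 * (K_slope * 1))"
    proof (intro mult_left_mono mult_mono)
      have "K_slope * \<epsilon>\<^sup>2 \<le> K_slope * 1"
        using \<epsilon>1 K_slope_nonneg by (rule mult_left_mono)
      with inviscid_flow_deriv_bound[OF eflow \<epsilon> r(1)] show "\<bar>vE' r\<bar> \<le> K_slope * 1"
        by linarith
    qed (use \<theta> \<open>\<epsilon> > 0\<close> \<open>\<mu> > 0\<close> in auto)
    finally show ?thesis by (simp add: mult_ac)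
  qed
  \<comment> \<open>The terms proportional to \<open>W\<close> add up to 3/2 \<epsilon>^2 W \<le>
    3/32 c W, so more than half of c W survives on the left.\<close>
  have "c * W \<le> \<bar>q (v r) - q (vE r + b r)\<bar>"
    using q_diff_lower[OF near(2,1)] by (simp add: W_def w diff_diff_add)
  also have "\<dots> \<le> \<epsilon>\<^sup>2 * W + M * K_slope * X + real m / r0 * X + real m / r0 * X * L
      + (\<epsilon>\<^sup>2 * W / 2 + real m / r0 * X) + K_slope * \<epsilon> * \<mu>"
  proof -
    have "\<bar>- A - B + C - D + E + F\<bar> \<le> A' + B' + C' + D' + E' + F'"
      if "\<bar>A\<bar> \<le> A'" "\<bar>B\<bar> \<le> B'" "\<bar>C\<bar> \<le> C'" "\<bar>D\<bar> \<le> D'" "\<bar>E\<bar> \<le> E'" "\<bar>F\<bar> \<le> F'"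
      for A B C D E F A' B' C' D' E' F' :: real
      using that by linarith
    from this[OF T1 T2 T3 T4 T5 T6] show ?thesis unfolding key .
  qed
  also have "\<dots> = 3 / 2 * (\<epsilon>\<^sup>2 * W) + c / 2 * (K_error * \<epsilon> * \<mu>)"
    using c_pos r0_pos by (simp add: K_error_def X_def field_simps)
  also have "\<epsilon>\<^sup>2 * W \<le> c / 16 * W"
    using small_le(1)[OF \<epsilon>] by (intro mult_right_mono) (auto simp: W_def)
  finally have "c * W \<le> 3 / 2 * (c / 16 * W) + c / 2 * (K_error * \<epsilon> * \<mu>)" by simp
  moreover have "c * W \<ge> 0"
    using c_pos by (simp add: W_def)
  ultimately have "c / 2 * W \<le> c / 2 * (K_error * \<epsilon> * \<mu>)"
    by simp
  then have "W \<le> K_error * \<epsilon> * \<mu>"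
    using c_pos by simp
  with max[OF \<open>s \<ge> r0\<close>] show ?thesis
    by (simp add: W_def)
qed

end

subsection \<open>Reduction of the systems to scalar equations\<close>

lemma smooth_on_halfline_derivative:
  assumes "smooth_on {a..} f"
  obtains f' where "smooth_on {a..} f'" "\<And>x. x > a \<Longrightarrow> (f has_real_derivative f' x) (at x)"
proof -
  obtain f' where f': "smooth_on {a..} f'"
    "\<And>x. x \<in> {a..} \<Longrightarrow> (f has_real_derivative f' x) (at x within {a..})"
    using smooth_on_derivative[OF assms] by blast
  have "(f has_real_derivative f' x) (at x)" if "x > a" for x
    using f'(2)[of x] that at_within_interior[of x "{a..}"] by simp
  with f'(1) show ?thesis using that by blast
qed

lemma DERIV_eq_on_halfline:
  fixes f g :: "real \<Rightarrow> real"
  assumes "(f has_real_derivative d) (at x)" "\<And>s. s > a \<Longrightarrow> f s = g s" "x > a"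
  shows "(g has_real_derivative d) (at x)"
  by (rule has_field_derivative_transform_within_open[OF assms(1), of "{a<..}"]) (use assms in auto)

lemma constant_on_halfline:
  fixes f :: "real \<Rightarrow> real"
  assumes "continuous_on {a..} f" "\<And>x. x > a \<Longrightarrow> (f has_real_derivative 0) (at x)" "x \<ge> a"
  shows "f x = f a"
proof (rule antisym)
  show "f x \<le> f a"
    by (rule nonincreasing_halfline[of a f "\<lambda>_. 0"]) (use assms in auto)
  have "- f x \<le> - f a"
  proof (rule nonincreasing_halfline[of a "\<lambda>x. - f x" "\<lambda>_. 0"])
    fix x assume "x > a"
    from DERIV_minus[OF assms(2)[OF this]]
    show "((\<lambda>x. - f x) has_real_derivative 0) (at x)" by simp
  qed (use assms in \<open>auto intro: continuous_intros\<close>)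
  then show "f a \<le> f x" by simp
qed

lemma smooth_on_deriv_zero_constant:
  assumes F: "smooth_on {a..} F" and "\<And>x. x > a \<Longrightarrow> deriv F x = 0" and "x \<ge> a"
  shows "F x = F a"
proof (rule constant_on_halfline[OF smooth_on_continuous[OF F] _ \<open>x \<ge> a\<close>])
  obtain F' where "\<And>x. x > a \<Longrightarrow> (F has_real_derivative F' x) (at x)"
    using smooth_on_halfline_derivative[OF F] by metis
  then show "(F has_real_derivative 0) (at x)" if "a < x" for x
    using assms(2) that by (metis DERIV_imp_deriv)
qed

context gas_law
begin

lemma q_isCont: "x > 0 \<Longrightarrow> isCont q x"
  using q_deriv by (rule DERIV_isCont)

text \<open>
  The integrated momentum equation determines \<open>N\<close> up to a constant; if \<open>N\<close> did not vanish at
  infinity, \<open>v\<close> would grow or decrease at least linearly.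
\<close>
lemma nonlocal_term_vanishes:
  assumes "\<mu> \<ge> 0" "\<epsilon> > 0" and lim: "(v \<longlongrightarrow> a) at_top" and vpos: "\<And>r. r \<ge> r0 \<Longrightarrow> v r > 0"
    and v': "\<And>r. r > r0 \<Longrightarrow> (v has_real_derivative v' r) (at r)"
    and N': "\<And>r. r > r0 \<Longrightarrow> (N has_real_derivative - (real m * \<epsilon>\<^sup>2 * (\<theta> r)\<^sup>2 * v r / r)) (at r)"
    and eq: "\<And>r. r > r0 \<Longrightarrow> \<mu> * \<epsilon> * \<theta> r * v' r = q (v r) - q a + \<epsilon>\<^sup>2 * (\<theta> r)\<^sup>2 * v r - N r"
  shows "(N \<longlongrightarrow> 0) at_top"
proof -
  define g where "g r = q (v r) - q a + \<epsilon>\<^sup>2 * (\<theta> r)\<^sup>2 * v r" for r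
  have "((\<lambda>r. q (v r) - q a + \<epsilon>\<^sup>2 * (\<theta> r)\<^sup>2 * v r) \<longlongrightarrow> q a - q a + \<epsilon>\<^sup>2 * 0\<^sup>2 * a) at_top"
    by (intro tendsto_intros \<theta>_tendsto lim isCont_tendsto_compose[OF q_isCont[OF a_pos]])
  then have g: "(g \<longlongrightarrow> 0) at_top"
    by (simp add: g_def[abs_def])
  have eq': "\<mu> * \<epsilon> * \<theta> r * v' r = g r - N r" if "r > r0" for r
    using eq[OF that] by (simp add: g_def)
  show ?thesis
  proof (cases "\<mu> = 0")
    case True
    have "\<forall>\<^sub>F r in at_top. g r = N r"
      using eventually_gt_at_top[of r0] by eventually_elim (use eq' True in simp)
    with g show ?thesis
      by (rule Lim_transform_eventually)
  next
    case False
    then have \<mu>\<epsilon>: "\<mu> * \<epsilon> > 0" using assms by simp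
    have mono: "N t \<le> N s" if "r0 < s" "s \<le> t" for s t
    proof (rule DERIV_nonpos_imp_nonincreasing[OF that(2)])
      fix x assume "s \<le> x"
      then have x: "x > r0" using that by simp
      have "real m * \<epsilon>\<^sup>2 * (\<theta> x)\<^sup>2 * v x / x \<ge> 0"
        using x vpos[of x] r0_pos by simp
      then show "\<exists>y. (N has_real_derivative y) (at x) \<and> y \<le> 0"
        using N'[OF x] by (intro exI[of _ "- (real m * \<epsilon>\<^sup>2 * (\<theta> x)\<^sup>2 * v x / x)"]) simp
    qed
    have ev_g: "\<forall>\<^sub>F r in at_top. \<bar>g r\<bar> < e" if "e > 0" for e
      using tendstoD[OF g that] by (simp add: dist_real_def)
    \<comment> \<open>Although \<theta> tends to zero, it does so in the favourable direction: since
      \<theta> \<le> 1, a positive lower bound on \<mu> \<epsilon> \<theta> x gives one on x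
      independent of r.\<close>
    have unscale: "e / (\<mu> * \<epsilon>) \<le> x" if "e \<le> \<mu> * \<epsilon> * \<theta> r * x" "e > 0" "r > r0" for e x r
    proof -
      have \<theta>: "0 < \<theta> r" "\<theta> r \<le> 1"
        using \<theta>_pos[of r] \<theta>_le_1[of r] that(3) by auto
      have "\<mu> * \<epsilon> * \<theta> r * x > 0" using that by simp
      then have "x > 0"
        by (rule zero_less_mult_pos) (use \<mu>\<epsilon> \<theta> in simp)
      have "\<mu> * \<epsilon> * \<theta> r * x \<le> \<mu> * \<epsilon> * 1 * x"
        using \<mu>\<epsilon> \<theta> \<open>x > 0\<close> by (intro mult_right_mono mult_left_mono) auto
      with that(1) have "e \<le> x * (\<mu> * \<epsilon>)" by (simp add: mult_ac)
      then show ?thesis using \<mu>\<epsilon> by (simp add: pos_divide_le_eq)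
    qed
    have nonneg: "N s \<ge> 0" if s: "s > r0" for s
    proof (rule ccontr)
      assume "\<not> N s \<ge> 0"
      then have e: "- N s / 2 > 0" by simp
      have "\<forall>\<^sub>F r in at_top. (v has_real_derivative v' r) (at r) \<and> - N s / 2 / (\<mu> * \<epsilon>) \<le> v' r"
        using ev_g[OF e] eventually_ge_at_top[of s]
      proof eventually_elim
        case (elim r)
        then have "r > r0" using s by simp
        have "- N s / 2 \<le> \<mu> * \<epsilon> * \<theta> r * v' r"
          unfolding eq'[OF \<open>r > r0\<close>] using mono[OF s elim(2)] elim(1) by (simp add: abs_less_iff)
        with v'[OF \<open>r > r0\<close>] unscale[OF _ e \<open>r > r0\<close>] show ?case by blast
      qed
      then show False
        by (rule derivative_bounded_below_not_convergent[OF lim, rotated]) (use e \<mu>\<epsilon> in \<open>rule divide_pos_pos\<close>)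
    qed
    have small: "\<exists>s>r0. N s < e" if "e > 0" for e
    proof (rule ccontr)
      assume "\<not> (\<exists>s>r0. N s < e)"
      then have Ne: "N s \<ge> e" if "s > r0" for s
        using that by force
      have e: "e / 2 > 0" using that by simp
      have "\<forall>\<^sub>F r in at_top. ((\<lambda>r. - v r) has_real_derivative - v' r) (at r) \<and> e / 2 / (\<mu> * \<epsilon>) \<le> - v' r"
        using ev_g[OF e] eventually_gt_at_top[of r0]
      proof eventually_elim
        case (elim r)
        have "e / 2 \<le> \<mu> * \<epsilon> * \<theta> r * - v' r"
          using eq'[OF elim(2)] Ne[OF elim(2)] elim(1) by (simp add: abs_less_iff)
        with DERIV_minus[OF v'[OF elim(2)]] unscale[OF _ e elim(2)] show ?case by blast
      qed
      then show False
        by (rule derivative_bounded_below_not_convergent[OF tendsto_minus[OF lim], rotated])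
          (use e \<mu>\<epsilon> in \<open>rule divide_pos_pos\<close>)
    qed
    show ?thesis
    proof (rule tendstoI)
      fix e :: real assume "e > 0"
      then obtain s where s: "s > r0" "N s < e" using small by blast
      show "\<forall>\<^sub>F r in at_top. dist (N r) 0 < e"
        using eventually_ge_at_top[of s]
      proof eventually_elim
        case (elim r)
        with nonneg[of r] mono[of s r] s show ?case by (simp add: dist_real_def)
      qed
    qed
  qed
qed

text \<open>Mass conservation leaves v as the only unknown, and r^m u = r0^m \<epsilon> v gives (r^m
  u)_r / r^m = \<epsilon> \<theta> v_r. All of the momentum equation except m \<epsilon>^2
  \<theta>^2 v / r is then a derivative in r. Allowing \<mu> \<ge> 0 treats the Navier-Stokes and
  Euler problems together.\<close>

lemma radial_solution_flow:
  assumes q_p: "\<And>x. x > 0 \<Longrightarrow> q x = p (1 / x)"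
    and smooth: "smooth_on {r0..} \<rho>" "smooth_on {r0..} u"
    and pos: "\<And>r. r \<ge> r0 \<Longrightarrow> \<rho> r > 0"
    and mass: "\<And>r. r > r0 \<Longrightarrow> deriv (\<lambda>s. s ^ m * \<rho> s * u s) r = 0"
    and momentum: "\<And>r. r > r0 \<Longrightarrow> \<rho> r * u r * deriv u r + deriv (\<lambda>s. p (\<rho> s)) r
        = \<mu> * deriv (\<lambda>s. deriv (\<lambda>t. t ^ m * u t) s / s ^ m) r"
    and lim: "(\<rho> \<longlongrightarrow> 1 / a) at_top"
    and "\<mu> \<ge> 0" and \<epsilon>: "\<epsilon> = \<rho> r0 * u r0" "\<epsilon> > 0"
  obtains v' N where "flow \<mu> \<epsilon> (\<lambda>r. 1 / \<rho> r) v' N"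
    and "\<And>r. r \<ge> r0 \<Longrightarrow> u r = \<epsilon> * \<theta> r * (1 / \<rho> r)"
proof -
  define v where "v r = 1 / \<rho> r" for r
  have vpos: "v r > 0" if "r \<ge> r0" for r
    using pos[OF that] by (simp add: v_def)
  have \<theta>_scale: "\<theta> r = r0 ^ m / r ^ m" for r
    by (simp add: \<theta>_def power_divide)
  have rm: "r ^ m > 0" if "r \<ge> r0" for r
    using that r0_pos by simp
  have F: "r ^ m * \<rho> r * u r = r0 ^ m * \<epsilon>" if "r \<ge> r0" for r
  proof -
    have "smooth_on {r0..} (\<lambda>s. s ^ m * \<rho> s * u s)"
      by (intro smooth_on_mult smooth_on_power smooth_on_ident smooth)
    from smooth_on_deriv_zero_constant[OF this mass that] show ?thesis
      by (simp add: \<epsilon>(1))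
  qed
  have u: "u r = \<epsilon> * \<theta> r * v r" if "r \<ge> r0" for r
  proof -
    have "\<rho> r * r ^ m > 0"
      by (intro mult_pos_pos pos rm that)
    moreover have "u r * (\<rho> r * r ^ m) = \<epsilon> * r0 ^ m"
      using F[OF that] by (simp add: mult_ac)
    ultimately have "u r = \<epsilon> * r0 ^ m / (\<rho> r * r ^ m)"
      by (intro eq_divide_imp) (rule less_imp_neq[symmetric])
    then show ?thesis by (simp add: v_def \<theta>_scale)
  qed
  have "smooth_on {r0..} v"
    unfolding v_def[abs_def] using pos
    by (intro smooth_on_divide smooth_on_const smooth) (auto simp: less_imp_neq[symmetric])
  then obtain v1 where v1: "smooth_on {r0..} v1" "\<And>r. r > r0 \<Longrightarrow> (v has_real_derivative v1 r) (at r)"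
    using smooth_on_halfline_derivative by metis
  obtain v2 where v2: "\<And>r. r > r0 \<Longrightarrow> (v1 has_real_derivative v2 r) (at r)"
    using smooth_on_halfline_derivative[OF v1(1)] by metis
  define G where "G r = - (real m * \<theta> r / r) * v1 r + v2 r * \<theta> r" for r
  have \<theta>v1: "((\<lambda>r. \<theta> r * v1 r) has_real_derivative G r) (at r)" if "r > r0" for r
    unfolding G_def using that by (intro DERIV_mult \<theta>_deriv v2) auto
  have visc: "deriv (\<lambda>s. deriv (\<lambda>t. t ^ m * u t) s / s ^ m) r = \<epsilon> * G r" if "r > r0" for r
  proof (rule DERIV_imp_deriv, rule DERIV_eq_on_halfline[OF DERIV_cmult[OF \<theta>v1[OF that]] _ that])
    fix s assume s: "s > r0"
    have "((\<lambda>t. t ^ m * u t) has_real_derivative r0 ^ m * \<epsilon> * v1 s) (at s)"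
    proof (rule DERIV_eq_on_halfline[OF DERIV_cmult[OF v1(2)[OF s]] _ s])
      fix t assume "t > r0"
      then show "r0 ^ m * \<epsilon> * v t = t ^ m * u t"
        using u[of t] r0_pos by (simp add: \<theta>_scale)
    qed
    then have "deriv (\<lambda>t. t ^ m * u t) s = r0 ^ m * \<epsilon> * v1 s"
      by (rule DERIV_imp_deriv)
    then show "\<epsilon> * (\<theta> s * v1 s) = deriv (\<lambda>t. t ^ m * u t) s / s ^ m"
      by (simp add: \<theta>_scale)
  qed
  have du: "deriv u r = \<epsilon> * (- (real m * \<theta> r / r) * v r + v1 r * \<theta> r)" if "r > r0" for r
  proof (rule DERIV_imp_deriv, rule DERIV_eq_on_halfline[OF DERIV_cmult[OF DERIV_mult] _ that])
    show "(\<theta> has_real_derivative - (real m * \<theta> r / r)) (at r)"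
      using that by (intro \<theta>_deriv) simp
    show "\<epsilon> * (\<theta> s * v s) = u s" if "s > r0" for s
      using u[of s] that by simp
  qed (rule v1(2)[OF that])
  have qv: "((\<lambda>r. q (v r)) has_real_derivative q' (v r) * v1 r) (at r)" if "r > r0" for r
    using that vpos[of r] by (intro DERIV_chain2[OF q_deriv v1(2)]) auto
  have dp: "deriv (\<lambda>s. p (\<rho> s)) r = q' (v r) * v1 r" if "r > r0" for r
    by (rule DERIV_imp_deriv, rule DERIV_eq_on_halfline[OF qv[OF that] _ that])
      (use q_p vpos in \<open>simp add: v_def\<close>)
  have mom: "\<epsilon>\<^sup>2 * (\<theta> r)\<^sup>2 * v1 r + q' (v r) * v1 r - \<mu> * \<epsilon> * G r = real m * \<epsilon>\<^sup>2 * (\<theta> r)\<^sup>2 * v r / r"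
    if r: "r > r0" for r
  proof -
    have "\<rho> r * u r = \<epsilon> * \<theta> r"
      using u[of r] pos[of r] r by (simp add: v_def)
    then have "\<epsilon> * \<theta> r * (\<epsilon> * (- (real m * \<theta> r / r) * v r + v1 r * \<theta> r)) + q' (v r) * v1 r = \<mu> * (\<epsilon> * G r)"
      using momentum[OF r] by (simp only: du[OF r] dp[OF r] visc[OF r])
    then show ?thesis
      by (simp add: algebra_simps power2_eq_square)
  qed
  \<comment> \<open>\<open>N\<close> is taken to be whatever makes the integrated equation true; the
    momentum equation then turns into the required formula for its derivative.\<close>
  define N where "N r = q (v r) - q a + \<epsilon>\<^sup>2 * (\<theta> r)\<^sup>2 * v r - \<mu> * \<epsilon> * (\<theta> r * v1 r)" for r
  have N': "(N has_real_derivative - (real m * \<epsilon>\<^sup>2 * (\<theta> r)\<^sup>2 * v r / r)) (at r)" if r: "r > r0" for r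
  proof -
    have "(N has_real_derivative q' (v r) * v1 r - 0
        + (\<epsilon>\<^sup>2 * (- (2 * real m * (\<theta> r)\<^sup>2 / r)) * v r + v1 r * (\<epsilon>\<^sup>2 * (\<theta> r)\<^sup>2)) - \<mu> * \<epsilon> * G r) (at r)"
      unfolding N_def using r
      by (intro DERIV_diff DERIV_add DERIV_mult DERIV_cmult DERIV_const qv v1(2) \<theta>v1 \<theta>_sq_deriv) auto
    then show ?thesis
      by (rule DERIV_cong) (use mom[OF r] in \<open>simp add: algebra_simps\<close>)
  qed
  have limv: "(v \<longlongrightarrow> a) at_top"
    using tendsto_divide[OF tendsto_const[of 1] lim] a_pos by (simp add: v_def[abs_def])
  have eq: "\<mu> * \<epsilon> * \<theta> r * v1 r = q (v r) - q a + \<epsilon>\<^sup>2 * (\<theta> r)\<^sup>2 * v r - N r" for r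
    by (simp add: N_def)
  have "(N \<longlongrightarrow> 0) at_top"
    by (rule nonlocal_term_vanishes[OF \<open>\<mu> \<ge> 0\<close> \<open>\<epsilon> > 0\<close> limv vpos v1(2) N' eq])
  then have "flow \<mu> \<epsilon> v v1 N"
    unfolding flow_def
    using smooth_on_continuous[OF \<open>smooth_on {r0..} v\<close>] vpos limv v1(2) N' eq by blast
  then show ?thesis
    using that[of v1 N] u unfolding v_def[abs_def] by blast
qed

text \<open>Momentum minus viscous stress, \<open>J\<close>, is a first integral. It determines
  \<open>v1\<close> as a function of v, so \<open>v1\<close> has a limit; convergence of v forces
  that limit to be zero, and this evaluates the constant at the far-field state.\<close>

lemma bl_solution_layer:
  assumes q_p: "\<And>x. x > 0 \<Longrightarrow> q x = p (1 / x)"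
    and bl: "bl_solution p \<rho>i ui \<rho>m um \<rho>B uB" and "\<rho>i > 0" and \<epsilon>: "\<epsilon> = \<rho>m * um" "\<epsilon> > 0"
  obtains v' where "layer \<epsilon> (1 / \<rho>i) (\<lambda>y. 1 / \<rho>B y) v'"
    and "\<And>y. y \<ge> 0 \<Longrightarrow> uB y = \<epsilon> * (1 / \<rho>B y)"
proof -
  have smooth: "smooth_on {0..} \<rho>B" "smooth_on {0..} uB"
    and pos: "\<And>y. y \<ge> 0 \<Longrightarrow> \<rho>B y > 0"
    and mass: "\<And>y. y > 0 \<Longrightarrow> deriv (\<lambda>z. \<rho>B z * uB z) y = 0"
    and momentum: "\<And>y. y > 0 \<Longrightarrow> \<rho>B y * uB y * deriv uB y + deriv (\<lambda>z. p (\<rho>B z)) y = deriv (deriv uB) y"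
    and lim: "(\<rho>B \<longlongrightarrow> \<rho>i) at_top" and init: "\<rho>B 0 = \<rho>m" "uB 0 = um"
    using bl by (auto simp: bl_solution_def)
  define v where "v y = 1 / \<rho>B y" for y
  define vi where "vi = 1 / \<rho>i"
  have "vi > 0" using \<open>\<rho>i > 0\<close> by (simp add: vi_def)
  have vpos: "v y > 0" if "y \<ge> 0" for y
    using pos[OF that] by (simp add: v_def)
  have F: "\<rho>B y * uB y = \<epsilon>" if "y \<ge> 0" for y
    using smooth_on_deriv_zero_constant[OF smooth_on_mult[OF smooth] mass that]
    by (simp add: \<epsilon>(1) init)
  have u: "uB y = \<epsilon> * v y" if "y \<ge> 0" for y
    using F[OF that] pos[OF that] by (simp add: v_def field_simps)
  have "smooth_on {0..} v"
    unfolding v_def[abs_def] using pos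
    by (intro smooth_on_divide smooth_on_const smooth) (auto simp: less_imp_neq[symmetric])
  then obtain v1 where v1: "smooth_on {0..} v1" "\<And>y. y > 0 \<Longrightarrow> (v has_real_derivative v1 y) (at y)"
    using smooth_on_halfline_derivative by metis
  obtain v2 where v2: "\<And>y. y > 0 \<Longrightarrow> (v1 has_real_derivative v2 y) (at y)"
    using smooth_on_halfline_derivative[OF v1(1)] by metis
  have du: "deriv uB y = \<epsilon> * v1 y" if "y > 0" for y
    by (rule DERIV_imp_deriv, rule DERIV_eq_on_halfline[OF DERIV_cmult[OF v1(2)[OF that]] _ that])
      (use u in simp)
  have ddu: "deriv (deriv uB) y = \<epsilon> * v2 y" if "y > 0" for y
    by (rule DERIV_imp_deriv, rule DERIV_eq_on_halfline[OF DERIV_cmult[OF v2[OF that]] _ that])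
      (use du in simp)
  have qv: "((\<lambda>r. q (v r)) has_real_derivative q' (v y) * v1 y) (at y)" if "y > 0" for y
    using that vpos[of y] by (intro DERIV_chain2[OF q_deriv v1(2)]) auto
  have dp: "deriv (\<lambda>s. p (\<rho>B s)) y = q' (v y) * v1 y" if "y > 0" for y
    by (rule DERIV_imp_deriv, rule DERIV_eq_on_halfline[OF qv[OF that] _ that])
      (use q_p vpos in \<open>simp add: v_def\<close>)
  define J where "J y = \<epsilon>\<^sup>2 * v y + q (v y) - \<epsilon> * v1 y" for y
  have J': "(J has_real_derivative 0) (at y)" if y: "y > 0" for y
  proof -
    have "(J has_real_derivative \<epsilon>\<^sup>2 * v1 y + q' (v y) * v1 y - \<epsilon> * v2 y) (at y)"
      unfolding J_def using y by (intro DERIV_diff DERIV_add DERIV_cmult qv v1(2) v2)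
    moreover have "\<epsilon> * (\<epsilon> * v1 y) + q' (v y) * v1 y = \<epsilon> * v2 y"
      using momentum[OF y] F[of y] y by (simp add: du dp ddu)
    then have "\<epsilon>\<^sup>2 * v1 y + q' (v y) * v1 y - \<epsilon> * v2 y = 0"
      by (simp add: power2_eq_square mult.assoc)
    ultimately show ?thesis by simp
  qed
  \<comment> \<open>The equation is imposed on the open half-line, so the reference point is 1
    instead of the boundary.\<close>
  have J: "J y = J 1" if "y > 0" for y
  proof -
    have *: "J s = J t" if "0 < t" "t \<le> s" for s t
    proof (rule constant_on_halfline[of t J])
      show "continuous_on {t..} J"
        using \<open>0 < t\<close> by (intro continuous_at_imp_continuous_on ballI DERIV_isCont[OF J']) simp
      show "(J has_real_derivative 0) (at x)" if "t < x" for x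
        using that \<open>0 < t\<close> by (intro J') simp
      show "t \<le> s" by (rule \<open>t \<le> s\<close>)
    qed
    show ?thesis
    proof (cases "y \<le> 1")
      case True
      from *[OF that this] show ?thesis by (rule sym)
    next
      case False
      then show ?thesis by (intro *) auto
    qed
  qed
  have limv: "(v \<longlongrightarrow> vi) at_top"
    using tendsto_divide[OF tendsto_const[of 1] lim] \<open>\<rho>i > 0\<close> by (simp add: v_def[abs_def] vi_def)
  define k where "k = \<epsilon>\<^sup>2 * vi + q vi - J 1"
  have "((\<lambda>y. (\<epsilon>\<^sup>2 * v y + q (v y) - J 1) / \<epsilon>) \<longlongrightarrow> k / \<epsilon>) at_top"
    unfolding k_def using \<open>\<epsilon> > 0\<close>
    by (intro tendsto_intros limv isCont_tendsto_compose[OF q_isCont[OF \<open>vi > 0\<close>]]) auto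
  moreover have "\<forall>\<^sub>F y in at_top. (\<epsilon>\<^sup>2 * v y + q (v y) - J 1) / \<epsilon> = v1 y"
    using eventually_gt_at_top[of 0]
  proof eventually_elim
    case (elim y)
    then have "\<epsilon> * v1 y = \<epsilon>\<^sup>2 * v y + q (v y) - J 1"
      using J[of y] by (simp add: J_def)
    then show ?case using \<open>\<epsilon> > 0\<close> by (simp add: field_simps)
  qed
  ultimately have limv1: "(v1 \<longlongrightarrow> k / \<epsilon>) at_top"
    by (rule Lim_transform_eventually)
  define d where "d = k / \<epsilon>"
  have limv1: "(v1 \<longlongrightarrow> d) at_top"
    using limv1 by (simp add: d_def)
  have "d \<le> 0"
  proof (rule ccontr)
    assume "\<not> d \<le> 0"
    then have d: "d / 2 > 0" "d / 2 < d" by linarith+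
    have "\<forall>\<^sub>F y in at_top. (v has_real_derivative v1 y) (at y) \<and> d / 2 \<le> v1 y"
      using order_tendstoD(1)[OF limv1 d(2)] eventually_gt_at_top[of 0]
      by eventually_elim (use v1 in auto)
    then show False
      by (rule derivative_bounded_below_not_convergent[OF limv d(1)])
  qed
  moreover have "d \<ge> 0"
  proof (rule ccontr)
    assume "\<not> d \<ge> 0"
    then have d: "- (d / 2) > 0" "d < d / 2" by linarith+
    have "\<forall>\<^sub>F y in at_top. ((\<lambda>y. - v y) has_real_derivative - v1 y) (at y) \<and> - (d / 2) \<le> - v1 y"
      using order_tendstoD(2)[OF limv1 d(2)] eventually_gt_at_top[of 0]
      by eventually_elim (use v1 in \<open>auto intro!: DERIV_minus\<close>)
    then show False
      by (rule derivative_bounded_below_not_convergent[OF tendsto_minus[OF limv] d(1)])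
  qed
  ultimately have "k / \<epsilon> = 0" by (simp add: d_def)
  then have "J 1 = \<epsilon>\<^sup>2 * vi + q vi"
    using \<open>\<epsilon> > 0\<close> by (simp add: k_def)
  then have "\<epsilon> * v1 y = \<epsilon>\<^sup>2 * (v y - vi) + q (v y) - q vi" if "y > 0" for y
    using J[OF that] by (simp add: J_def algebra_simps)
  then have "layer \<epsilon> vi v v1"
    unfolding layer_def using smooth_on_continuous[OF \<open>smooth_on {0..} v\<close>] v1(2) by blast
  then show ?thesis
    using that[of v1] u unfolding v_def[abs_def] vi_def by blast
qed

end

subsection \<open>Existence and uniqueness\<close>

lemma smooth_on_has_deriv:
  assumes "smooth_on S f" "open S"
  obtains f' where "smooth_on S f'" "\<And>x. x \<in> S \<Longrightarrow> (f has_real_derivative f' x) (at x)"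
proof -
  obtain f' where f': "smooth_on S f'" "\<And>x. x \<in> S \<Longrightarrow> (f has_real_derivative f' x) (at x within S)"
    using smooth_on_derivative[OF assms(1)] by blast
  with at_within_open[OF _ assms(2)] that show ?thesis by metis
qed

lemma smooth_on_antiderivative:
  assumes "smooth_on S f" "\<And>x. x \<in> S \<Longrightarrow> (F has_real_derivative f x) (at x)"
  shows "smooth_on S F"
proof (rule smooth_on_closed_set[of "insert F {f. smooth_on S f}"])
  fix g assume g: "g \<in> insert F {f. smooth_on S f}"
  show "\<exists>h\<in>insert F {f. smooth_on S f}. \<forall>x\<in>S. (g has_real_derivative h x) (at x within S)"
  proof (cases "g = F")
    case True
    with assms show ?thesis
      by (intro bexI[of _ f]) (auto intro: has_field_derivative_at_within)
  next
    case False
    then show ?thesis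
      using g smooth_on_derivative[of S g] by (metis insert_iff mem_Collect_eq)
  qed
qed simp

lemma positive_deriv_imp_strict_mono:
  fixes f :: "real \<Rightarrow> real"
  assumes der: "\<And>x. l < x \<Longrightarrow> x < u \<Longrightarrow> (f has_real_derivative f' x) (at x)"
    and pos: "\<And>x. l < x \<Longrightarrow> x < u \<Longrightarrow> f' x > 0"
    and "l < x" "x < y" "y < u"
  shows "f x < f y"
  by (rule DERIV_pos_imp_increasing[OF \<open>x < y\<close>]) (use assms in \<open>meson less_le_trans le_less_trans\<close>)

text \<open>The inverse solves the autonomous equation g' = 1 / f'(g), so its smoothness is an
  instance of the bootstrapping for such equations.\<close>

lemma smooth_on_inverse_function:
  assumes smooth: "smooth_on {l<..<u} f"
    and der: "\<And>x. l < x \<Longrightarrow> x < u \<Longrightarrow> (f has_real_derivative f' x) (at x)"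
    and pos: "\<And>x. l < x \<Longrightarrow> x < u \<Longrightarrow> f' x > 0"
  obtains g where "smooth_on (f ` {l<..<u}) g" "\<And>x. l < x \<Longrightarrow> x < u \<Longrightarrow> g (f x) = x"
    "\<And>x. l < x \<Longrightarrow> x < u \<Longrightarrow> isCont g (f x)"
proof -
  let ?S = "{l<..<u}"
  obtain f1 where f1: "smooth_on ?S f1" "\<And>x. x \<in> ?S \<Longrightarrow> (f has_real_derivative f1 x) (at x)"
    using smooth_on_has_deriv[OF smooth] by auto
  have f1_eq: "f1 x = f' x" if "x \<in> ?S" for x
    using DERIV_unique[OF f1(2)[OF that] der] that by auto
  have smooth': "smooth_on ?S f'"
    by (rule smooth_on_cong[OF f1(1)]) (use f1_eq in auto)
  have "inj_on f ?S"
    by (rule linorder_inj_onI') (use positive_deriv_imp_strict_mono[OF der pos] in force)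
  define g where "g = the_inv_into ?S f"
  have g: "g (f x) = x" if "x \<in> ?S" for x
    unfolding g_def using \<open>inj_on f ?S\<close> that by (rule the_inv_into_f_f)
  have g': "(g has_real_derivative inverse (f' x)) (at (f x))" if "x \<in> ?S" for x
    by (rule inverse_has_derivative[of ?S]) (use that g der pos in \<open>auto simp: less_imp_neq[symmetric]\<close>)
  have "smooth_on (f ` ?S) g"
  proof (rule smooth_on_autonomous_ode[of ?S "\<lambda>x. inverse (f' x)"])
    show "smooth_on ?S (\<lambda>x. inverse (f' x))"
      using pos by (intro smooth_on_inverse smooth') (auto simp: less_imp_neq[symmetric])
    show "g ` f ` ?S \<subseteq> ?S"
      using g by auto
    fix s assume "s \<in> f ` ?S"
    then obtain x where "x \<in> ?S" "s = f x" by blast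
    then show "(g has_real_derivative inverse (f' (g s))) (at s within f ` ?S)"
      using g'[of x] g[of x] by (auto intro: has_field_derivative_at_within)
  qed
  then show ?thesis
    using that[of g] g DERIV_isCont[OF g'] by auto
qed

context gas_law
begin

section \<open>Bernoulli's law and the Euler problem\<close>

text \<open>The derivative is z (k + q' z), negative because k \<le> c / 16 is dominated by -q' z
  \<ge> c. In Bernoulli's law \<open>k\<close> is \<epsilon>^2 \<theta>^2 at a fixed radius, so the
  law has at most one root near \<open>a\<close>.\<close>

lemma bernoulli_decreasing:
  assumes Q': "\<And>x. x > 0 \<Longrightarrow> (Q has_real_derivative x * q' x) (at x)"
    and "k \<le> c / 16" and x: "\<bar>x - a\<bar> \<le> \<eta>" and y: "\<bar>y - a\<bar> \<le> \<eta>" and "x < y"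
  shows "k * y\<^sup>2 / 2 + Q y < k * x\<^sup>2 / 2 + Q x"
proof (rule DERIV_neg_imp_decreasing[OF \<open>x < y\<close>])
  fix z assume "x \<le> z" "z \<le> y"
  then have z: "\<bar>z - a\<bar> \<le> \<eta>" by (rule near_between[OF x y])
  have "z > 0" using near_pos(1)[OF z] .
  have "((\<lambda>z. k * z\<^sup>2 / 2 + Q z) has_real_derivative z * (k + q' z)) (at z)"
    using Q'[OF \<open>z > 0\<close>] by (auto intro!: derivative_eq_intros simp: algebra_simps)
  moreover have "z * (k + q' z) < 0"
    using \<open>z > 0\<close> q'_upper[OF z] \<open>k \<le> c / 16\<close> c_pos by (intro mult_pos_neg) auto
  ultimately show "\<exists>d. ((\<lambda>z. k * z\<^sup>2 / 2 + Q z) has_real_derivative d) (at z) \<and> d < 0"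
    by blast
qed

text \<open>The derivative is v times the residual of the inviscid momentum equation. This is read
  both ways: Euler flows conserve the Bernoulli quantity, and conservation yields the Euler equation
  after cancelling v.\<close>

lemma bernoulli_deriv:
  assumes Q': "\<And>x. x > 0 \<Longrightarrow> (Q has_real_derivative x * q' x) (at x)"
    and v': "(v has_real_derivative v') (at r)" and "v r > 0" "r > r0"
  shows "((\<lambda>r. \<epsilon>\<^sup>2 * (\<theta> r)\<^sup>2 * (v r)\<^sup>2 / 2 + Q (v r)) has_real_derivative
    v r * (v' * (q' (v r) + \<epsilon>\<^sup>2 * (\<theta> r)\<^sup>2) - real m * \<epsilon>\<^sup>2 * (\<theta> r)\<^sup>2 * v r / r)) (at r)"
proof -
  have "r \<noteq> 0" using \<open>r > r0\<close> r0_pos by simp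
  have "((\<lambda>r. Q (v r)) has_real_derivative v r * q' (v r) * v') (at r)"
    by (rule DERIV_chain2[OF Q'[OF \<open>v r > 0\<close>] v'])
  moreover have "((\<lambda>r. (v r)\<^sup>2) has_real_derivative 2 * v r * v') (at r)"
    using v' by (auto intro!: derivative_eq_intros)
  ultimately have "((\<lambda>r. \<epsilon>\<^sup>2 * (\<theta> r)\<^sup>2 * (v r)\<^sup>2 / 2 + Q (v r)) has_real_derivative
      (\<epsilon>\<^sup>2 * (- (2 * real m * (\<theta> r)\<^sup>2 / r)) * (v r)\<^sup>2 + 2 * v r * v' * (\<epsilon>\<^sup>2 * (\<theta> r)\<^sup>2)) / 2
      + v r * q' (v r) * v') (at r)"
    using \<open>r > r0\<close> by (intro DERIV_add DERIV_mult DERIV_cmult \<theta>_sq_deriv DERIV_cdivide) auto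
  then show ?thesis
    by (rule DERIV_cong) (use \<open>r \<noteq> 0\<close> in \<open>simp add: power2_eq_square field_simps\<close>)
qed

lemma inviscid_flow_bernoulli:
  assumes Q': "\<And>x. x > 0 \<Longrightarrow> (Q has_real_derivative x * q' x) (at x)"
    and flow: "flow 0 \<epsilon> v v' N" and r: "r > r0"
  shows "\<epsilon>\<^sup>2 * (\<theta> r)\<^sup>2 * (v r)\<^sup>2 / 2 + Q (v r) = Q a"
proof -
  have vpos: "\<And>r. r \<ge> r0 \<Longrightarrow> v r > 0" and lim: "(v \<longlongrightarrow> a) at_top"
    and v': "\<And>r. r > r0 \<Longrightarrow> (v has_real_derivative v' r) (at r)"
    using flow by (auto simp: flow_def)
  define E where "E r = \<epsilon>\<^sup>2 * (\<theta> r)\<^sup>2 * (v r)\<^sup>2 / 2 + Q (v r)" for r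
  have E': "(E has_real_derivative 0) (at r)" if r: "r > r0" for r
  proof -
    have "v r > 0" using vpos r by simp
    from bernoulli_deriv[OF Q' v'[OF r] this r, of \<epsilon>] show ?thesis
      unfolding E_def by (simp add: inviscid_flow_deriv_eq[OF flow r])
  qed
  have "((\<lambda>r. \<epsilon>\<^sup>2 * (\<theta> r)\<^sup>2 * (v r)\<^sup>2 / 2 + Q (v r)) \<longlongrightarrow> \<epsilon>\<^sup>2 * 0\<^sup>2 * a\<^sup>2 / 2 + Q a) at_top"
    using DERIV_isCont[OF Q'[OF a_pos]]
    by (intro tendsto_intros \<theta>_tendsto lim) (auto intro: isCont_tendsto_compose lim)
  then have "(E \<longlongrightarrow> Q a) at_top"
    by (simp add: E_def[abs_def])
  then have "E r \<le> Q a" "- E r \<le> - Q a"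
  proof -
    assume lim: "(E \<longlongrightarrow> Q a) at_top"
    show "E r \<le> Q a"
      by (rule nondecreasing_tendsto_upper_bound[OF lim E' _ r]) auto
    have "((\<lambda>r. - E r) has_real_derivative 0) (at x)" if "x > r0" for x
      using DERIV_minus[OF E'[OF that]] by simp
    then show "- E r \<le> - Q a"
      by (rule nondecreasing_tendsto_upper_bound[OF tendsto_minus[OF lim] _ _ r]) auto
  qed
  then show ?thesis by (simp add: E_def)
qed

text \<open>At each radius both values lie near \<open>a\<close> and solve the same strictly
  monotone scalar equation. The integrated form would not allow this pointwise comparison, since
  \<open>N\<close> depends on the whole tail of the flow.\<close>

lemma inviscid_flow_unique:
  assumes Q': "\<And>x. x > 0 \<Longrightarrow> (Q has_real_derivative x * q' x) (at x)"
    and flows: "flow 0 \<epsilon> v v' N" "flow 0 \<epsilon> w w' N'" and \<epsilon>: "small \<epsilon>" and "r \<ge> r0"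
  shows "v r = w r"
proof -
  have eq: "v r = w r" if r: "r > r0" for r
  proof -
    have "\<epsilon>\<^sup>2 * (\<theta> r)\<^sup>2 \<le> \<epsilon>\<^sup>2 * 1"
      using \<theta>_sq_le_1[of r] r by (intro mult_left_mono) auto
    then have k: "\<epsilon>\<^sup>2 * (\<theta> r)\<^sup>2 \<le> c / 16"
      using small_le(1)[OF \<epsilon>] by simp
    have near: "\<bar>v r - a\<bar> \<le> \<eta>" "\<bar>w r - a\<bar> \<le> \<eta>"
      using inviscid_flow_near[OF flows(1) \<epsilon> r] inviscid_flow_near[OF flows(2) \<epsilon> r] by auto
    show ?thesis
      using bernoulli_decreasing[OF Q' k near] bernoulli_decreasing[OF Q' k near(2,1)]
        inviscid_flow_bernoulli[OF Q' flows(1) r] inviscid_flow_bernoulli[OF Q' flows(2) r]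
      by (cases "v r" "w r" rule: linorder_cases) auto
  qed
  have "continuous_on {r0..} v" "continuous_on {r0..} w"
    using flows by (auto simp: flow_def)
  then show ?thesis
    using le_at_left_endpoint[of r0 v w r] le_at_left_endpoint[of r0 w v r] eq \<open>r \<ge> r0\<close>
    by (simp add: order_antisym)
qed

lemma smooth_on_\<theta>: "smooth_on {r0..} \<theta>"
  unfolding \<theta>_def[abs_def] using r0_pos
  by (intro smooth_on_power smooth_on_divide smooth_on_const smooth_on_ident) auto

text \<open>Bernoulli's law \<open>\<epsilon>\<^sup>2 \<theta>\<^sup>2 v\<^sup>2 / 2 + Q v = Q a\<close> is solved for \<open>v\<close> by inverting \<open>\<Phi>\<close> on a neighbourhood
  of \<open>a\<close>, where \<open>\<Phi> v = 2 (Q a - Q v) / v\<^sup>2\<close>.\<close>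
lemma bernoulli_solution:
  assumes smooth_q': "smooth_on {0<..} q'"
    and Q': "\<And>x. x > 0 \<Longrightarrow> (Q has_real_derivative x * q' x) (at x)"
  obtains e where "e > 0"
    "\<And>\<epsilon>. \<epsilon>\<^sup>2 \<le> e \<Longrightarrow> \<exists>v. smooth_on {r0..} v \<and> (\<forall>r\<ge>r0. v r > 0) \<and> (v \<longlongrightarrow> a) at_top \<and>
      (\<forall>r\<ge>r0. \<epsilon>\<^sup>2 * (\<theta> r)\<^sup>2 * (v r)\<^sup>2 / 2 + Q (v r) = Q a)"
proof -
  define \<Phi> where "\<Phi> x = 2 * (Q a - Q x) / x\<^sup>2" for x
  define \<Phi>' where "\<Phi>' x = (- 2 * q' x * x ^ 2 - 4 * (Q a - Q x)) / x ^ 3" for x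
  have \<Phi>_deriv: "(\<Phi> has_real_derivative \<Phi>' x) (at x)" if "x > 0" for x
    unfolding \<Phi>_def \<Phi>'_def using Q'[OF that] that
    by (auto intro!: derivative_eq_intros simp: field_simps power2_eq_square power3_eq_cube)
  have "isCont \<Phi>' a"
    unfolding \<Phi>'_def using a_pos DERIV_isCont[OF Q'[OF a_pos]] DERIV_isCont[OF q'_deriv[OF a_pos]]
    by (intro continuous_intros) auto
  moreover have "\<Phi>' a > 0"
  proof -
    have "\<Phi>' a = - q' a * 2 / a"
      using a_pos by (simp add: \<Phi>'_def power2_eq_square power3_eq_cube)
    moreover have "- q' a > 0"
      using q'_upper[of a] \<eta>_pos c_pos by simp
    ultimately show ?thesis
      using a_pos by (metis divide_pos_pos mult_pos_pos zero_less_numeral)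
  qed
  ultimately have "\<forall>\<^sub>F x in at a. \<Phi>' x > 0"
    unfolding isCont_def by (rule order_tendstoD)
  then obtain d where d: "d > 0" "\<And>x. \<bar>x - a\<bar> < d \<Longrightarrow> \<Phi>' x > 0"
    using \<open>\<Phi>' a > 0\<close> unfolding eventually_at dist_real_def by (metis UNIV_I)
  define l u where "l = max (a - d) (a / 2)" and "u = a + d"
  have lu: "0 < l" "l < a" "a < u"
    using d(1) a_pos by (auto simp: l_def u_def)
  have \<Phi>'_pos: "\<Phi>' x > 0" if "l < x" "x < u" for x
    using that by (intro d(2)) (auto simp: l_def u_def)
  have "smooth_on {l<..<u} Q"
  proof (rule smooth_on_antiderivative)
    show "smooth_on {l<..<u} (\<lambda>x. x * q' x)"
      using lu by (intro smooth_on_mult smooth_on_ident smooth_on_subset[OF smooth_q']) auto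
  qed (use Q' lu in auto)
  then have smooth_\<Phi>: "smooth_on {l<..<u} \<Phi>"
    unfolding \<Phi>_def[abs_def] using lu
    by (intro smooth_on_divide smooth_on_mult smooth_on_diff smooth_on_const smooth_on_power smooth_on_ident)
      auto
  obtain \<Psi> where \<Psi>: "smooth_on (\<Phi> ` {l<..<u}) \<Psi>" "\<And>x. l < x \<Longrightarrow> x < u \<Longrightarrow> \<Psi> (\<Phi> x) = x"
    "\<And>x. l < x \<Longrightarrow> x < u \<Longrightarrow> isCont \<Psi> (\<Phi> x)"
  proof (rule smooth_on_inverse_function[OF smooth_\<Phi>])
    fix x assume x: "l < x" "x < u"
    show "(\<Phi> has_real_derivative \<Phi>' x) (at x)"
      using x lu by (intro \<Phi>_deriv) simp
    show "\<Phi>' x > 0"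
      by (rule \<Phi>'_pos[OF x])
  qed (rule that)
  \<comment> \<open>A closed interval from \<open>a\<close> to \<open>x1\<close> inside the domain
    of inversion lets every level between 0 and \<open>\<Phi> x1\<close> be attained;
    \<open>\<Phi> x1\<close> is the resulting threshold for \<epsilon>^2.\<close>
  define x1 where "x1 = (a + u) / 2"
  have x1: "a < x1" "x1 < u" using lu by (auto simp: x1_def)
  have "\<Phi> a = 0" by (simp add: \<Phi>_def)
  have "\<Phi> a < \<Phi> x1"
    by (rule positive_deriv_imp_strict_mono[of l u \<Phi> \<Phi>']) (use \<Phi>_deriv \<Phi>'_pos lu x1 in auto)
  have range: "\<exists>x\<ge>a. x \<le> x1 \<and> \<Phi> x = k" if "0 \<le> k" "k \<le> \<Phi> x1" for k
  proof (rule IVT')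
    show "continuous_on {a..x1} \<Phi>"
      using a_pos by (intro continuous_at_imp_continuous_on ballI DERIV_isCont[OF \<Phi>_deriv]) auto
  qed (use that \<open>\<Phi> a = 0\<close> x1 in auto)
  show ?thesis
  proof (rule that)
    show "\<Phi> x1 > 0" using \<open>\<Phi> a = 0\<close> \<open>\<Phi> a < \<Phi> x1\<close> by simp
    fix \<epsilon> :: real assume \<epsilon>: "\<epsilon>\<^sup>2 \<le> \<Phi> x1"
    define k where "k r = \<epsilon>\<^sup>2 * (\<theta> r)\<^sup>2" for r
    have "\<exists>x. a \<le> x \<and> x \<le> x1 \<and> \<Phi> x = k r" if "r \<ge> r0" for r
    proof -
      have "k r \<le> \<epsilon>\<^sup>2 * 1"
        unfolding k_def using \<theta>_sq_le_1[OF that] by (intro mult_left_mono) auto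
      then show ?thesis
        using range[of "k r"] \<epsilon> by (auto simp: k_def)
    qed
    then obtain x where x: "\<And>r. r \<ge> r0 \<Longrightarrow> a \<le> x r \<and> x r \<le> x1 \<and> \<Phi> (x r) = k r"
      by metis
    have \<Psi>k: "\<Psi> (k r) = x r" if "r \<ge> r0" for r
      using \<Psi>(2)[of "x r"] x[OF that] lu x1 by simp
    have "smooth_on {r0..} (\<lambda>r. \<Psi> (k r))"
    proof (rule smooth_on_compose[OF \<Psi>(1)])
      show "smooth_on {r0..} k"
        unfolding k_def[abs_def] by (intro smooth_on_mult smooth_on_const smooth_on_power smooth_on_\<theta>)
      show "k ` {r0..} \<subseteq> \<Phi> ` {l<..<u}"
      proof
        fix s assume "s \<in> k ` {r0..}"
        then obtain r where "r \<ge> r0" "s = k r" by auto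
        then show "s \<in> \<Phi> ` {l<..<u}"
          using x[of r] lu x1 by (intro image_eqI[of _ _ "x r"]) auto
      qed
    qed
    moreover have "((\<lambda>r. \<Psi> (k r)) \<longlongrightarrow> a) at_top"
    proof -
      have "((\<lambda>r. \<epsilon>\<^sup>2 * (\<theta> r)\<^sup>2) \<longlongrightarrow> \<epsilon>\<^sup>2 * 0\<^sup>2) at_top"
        by (intro tendsto_intros \<theta>_tendsto)
      then have "(k \<longlongrightarrow> \<Phi> a) at_top"
        by (simp add: k_def[abs_def] \<open>\<Phi> a = 0\<close>)
      then show ?thesis
        using isCont_tendsto_compose[OF \<Psi>(3)[of a]] \<Psi>(2)[of a] lu by simp
    qed
    moreover have "\<Psi> (k r) > 0" if "r \<ge> r0" for r
      using \<Psi>k[OF that] x[OF that] a_pos by simp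
    moreover have "\<epsilon>\<^sup>2 * (\<theta> r)\<^sup>2 * (\<Psi> (k r))\<^sup>2 / 2 + Q (\<Psi> (k r)) = Q a" if "r \<ge> r0" for r
    proof -
      have "x r > 0" using x[OF that] a_pos by simp
      then have "k r * (x r)\<^sup>2 = 2 * (Q a - Q (x r))"
        using x[OF that] by (simp add: \<Phi>_def field_simps)
      then have "k r * (x r)\<^sup>2 / 2 + Q (x r) = Q a"
        by (simp add: diff_divide_distrib)
      then show ?thesis
        by (simp only: \<Psi>k[OF that] k_def[symmetric])
    qed
    ultimately show "\<exists>v. smooth_on {r0..} v \<and> (\<forall>r\<ge>r0. v r > 0) \<and> (v \<longlongrightarrow> a) at_top \<and>
        (\<forall>r\<ge>r0. \<epsilon>\<^sup>2 * (\<theta> r)\<^sup>2 * (v r)\<^sup>2 / 2 + Q (v r) = Q a)"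
      by blast
  qed
qed

lemma euler_solution_of_bernoulli:
  assumes q_p: "\<And>x. x > 0 \<Longrightarrow> q x = p (1 / x)"
    and Q': "\<And>x. x > 0 \<Longrightarrow> (Q has_real_derivative x * q' x) (at x)"
    and v: "smooth_on {r0..} v" "\<And>r. r \<ge> r0 \<Longrightarrow> v r > 0" "(v \<longlongrightarrow> a) at_top"
    and bern: "\<And>r. r \<ge> r0 \<Longrightarrow> \<epsilon>\<^sup>2 * (\<theta> r)\<^sup>2 * (v r)\<^sup>2 / 2 + Q (v r) = Q a"
    and n: "n - 1 = m"
  shows "euler_solution p n r0 (1 / a) (\<lambda>r. 1 / v r) (\<lambda>r. \<epsilon> * \<theta> r * v r)"
proof -
  obtain v1 where v1: "\<And>r. r > r0 \<Longrightarrow> (v has_real_derivative v1 r) (at r)"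
    using smooth_on_halfline_derivative[OF v(1)] by metis
  have \<theta>_scale: "\<theta> r = r0 ^ m / r ^ m" for r
    by (simp add: \<theta>_def power_divide)
  have mass: "deriv (\<lambda>s. s ^ m * (1 / v s) * (\<epsilon> * \<theta> s * v s)) r = 0" if "r > r0" for r
  proof (rule DERIV_imp_deriv, rule DERIV_eq_on_halfline[OF DERIV_const _ that])
    fix s assume "s > r0"
    then show "r0 ^ m * \<epsilon> = s ^ m * (1 / v s) * (\<epsilon> * \<theta> s * v s)"
      using v(2)[of s] r0_pos by (simp add: \<theta>_scale)
  qed
  have momentum: "1 / v r * (\<epsilon> * \<theta> r * v r) * deriv (\<lambda>r. \<epsilon> * \<theta> r * v r) r + deriv (\<lambda>s. p (1 / v s)) r = 0"
    if r: "r > r0" for r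
  proof -
    have vpos: "v r > 0" using v(2)[of r] r by simp
    have "((\<lambda>r. \<epsilon> * \<theta> r * v r) has_real_derivative
        \<epsilon> * (- (real m * \<theta> r / r)) * v r + v1 r * (\<epsilon> * \<theta> r)) (at r)"
      using r by (intro DERIV_mult DERIV_cmult \<theta>_deriv v1) auto
    then have du: "deriv (\<lambda>r. \<epsilon> * \<theta> r * v r) r = \<epsilon> * (- (real m * \<theta> r / r)) * v r + v1 r * (\<epsilon> * \<theta> r)"
      by (rule DERIV_imp_deriv)
    have "((\<lambda>s. q (v s)) has_real_derivative q' (v r) * v1 r) (at r)"
      by (rule DERIV_chain2[OF q_deriv[OF vpos] v1[OF r]])
    then have "((\<lambda>s. p (1 / v s)) has_real_derivative q' (v r) * v1 r) (at r)"
      by (rule DERIV_eq_on_halfline[OF _ _ r]) (use q_p v(2) in simp)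
    then have dp: "deriv (\<lambda>s. p (1 / v s)) r = q' (v r) * v1 r"
      by (rule DERIV_imp_deriv)
    define E where "E r = \<epsilon>\<^sup>2 * (\<theta> r)\<^sup>2 * (v r)\<^sup>2 / 2 + Q (v r)" for r
    have "(E has_real_derivative v r * (v1 r * (q' (v r) + \<epsilon>\<^sup>2 * (\<theta> r)\<^sup>2)
        - real m * \<epsilon>\<^sup>2 * (\<theta> r)\<^sup>2 * v r / r)) (at r)"
      unfolding E_def by (rule bernoulli_deriv[OF Q' v1[OF r] vpos r])
    moreover have "(E has_real_derivative 0) (at r)"
      by (rule DERIV_eq_on_halfline[OF DERIV_const[of "Q a"] _ r]) (use bern in \<open>simp add: E_def\<close>)
    ultimately have "v r * (v1 r * (q' (v r) + \<epsilon>\<^sup>2 * (\<theta> r)\<^sup>2) - real m * \<epsilon>\<^sup>2 * (\<theta> r)\<^sup>2 * v r / r) = 0"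
      by (rule DERIV_unique)
    then have "v1 r * (q' (v r) + \<epsilon>\<^sup>2 * (\<theta> r)\<^sup>2) - real m * \<epsilon>\<^sup>2 * (\<theta> r)\<^sup>2 * v r / r = 0"
      using vpos by simp
    then have "\<epsilon> * \<theta> r * (\<epsilon> * (- (real m * \<theta> r / r)) * v r + v1 r * (\<epsilon> * \<theta> r)) + q' (v r) * v1 r = 0"
      by (simp add: power2_eq_square algebra_simps)
    then show ?thesis
      unfolding du dp using vpos by simp
  qed
  have "smooth_on {r0..} (\<lambda>r. 1 / v r)"
    using v(2) by (intro smooth_on_divide smooth_on_const v(1)) (auto simp: less_imp_neq[symmetric])
  moreover have "smooth_on {r0..} (\<lambda>r. \<epsilon> * \<theta> r * v r)"
    by (intro smooth_on_mult smooth_on_const smooth_on_\<theta> v(1))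
  moreover have "((\<lambda>r. 1 / v r) \<longlongrightarrow> 1 / a) at_top"
    using a_pos by (intro tendsto_intros v(3)) auto
  moreover have "((\<lambda>r. \<epsilon> * \<theta> r * v r) \<longlongrightarrow> 0) at_top"
    using tendsto_mult[OF tendsto_mult[OF tendsto_const \<theta>_tendsto] v(3), of \<epsilon>] by simp
  ultimately show ?thesis
    unfolding euler_solution_def n using v(2) mass momentum by (intro conjI allI impI) simp_all
qed

text \<open>The right-hand side \<open>g\<close> is smooth, so the constructed solution of the
  autonomous equation is smooth up to the boundary. The second-order momentum equation is recovered
  by differentiating the first-order one.\<close>

lemma bl_solution_exists:
  assumes q_p: "\<And>x. x > 0 \<Longrightarrow> q x = p (1 / x)" and smooth_q: "smooth_on {0<..} q"
    and \<epsilon>: "small \<epsilon>" and vi: "\<bar>vi - a\<bar> \<le> \<eta> / 4" and v0: "\<bar>v0 - a\<bar> \<le> \<eta> / 4"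
  shows "\<exists>v. bl_solution p (1 / vi) (\<epsilon> * vi) (1 / v0) (\<epsilon> * v0) (\<lambda>y. 1 / v y) (\<lambda>y. \<epsilon> * v y)"
proof -
  have "\<epsilon> > 0" using small_le(2)[OF \<epsilon>] .
  have "vi > 0" using vi \<eta>_pos by (intro near_pos(1)) linarith
  define g where "g x = (\<epsilon>\<^sup>2 * (x - vi) + q x - q vi) / \<epsilon>" for x
  obtain v where v: "v 0 = v0" "\<And>y. y \<ge> 0 \<Longrightarrow> \<bar>v y - a\<bar> \<le> \<eta>"
    "\<And>y. y \<ge> 0 \<Longrightarrow> (v has_real_derivative g (v y)) (at y)"
    using layer_exists[OF \<epsilon> vi v0] unfolding g_def by blast
  have vpos: "v y > 0" if "y \<ge> 0" for y
    using near_pos(1)[OF v(2)[OF that]] .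
  have "smooth_on {0..} v"
  proof (rule smooth_on_autonomous_ode[of "{0<..}" g])
    show "smooth_on {0<..} g"
      unfolding g_def[abs_def] using \<open>\<epsilon> > 0\<close>
      by (intro smooth_on_divide smooth_on_diff smooth_on_add smooth_on_mult smooth_on_const smooth_on_ident smooth_q)
        auto
  qed (use vpos v(3) in \<open>auto intro: has_field_derivative_at_within\<close>)
  have layer: "layer \<epsilon> vi v (\<lambda>y. g (v y))"
    unfolding layer_def using smooth_on_continuous[OF \<open>smooth_on {0..} v\<close>] v(3) \<open>\<epsilon> > 0\<close>
    by (simp add: g_def)
  have lim: "(v \<longlongrightarrow> vi) at_top"
  proof -
    have "((\<lambda>y. v y - vi) \<longlongrightarrow> 0) at_top"
    proof (rule Lim_null_comparison[where g = "\<lambda>y. \<bar>v 0 - vi\<bar> * exp (- (c / 2 / \<epsilon>) * y)"])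
      show "\<forall>\<^sub>F y in at_top. norm (v y - vi) \<le> \<bar>v 0 - vi\<bar> * exp (- (c / 2 / \<epsilon>) * y)"
        using eventually_ge_at_top[of 0]
        by eventually_elim (use layer_decay(1)[OF layer \<epsilon> vi] v0 v(1) in simp)
      have "c / 2 / \<epsilon> > 0" using c_pos \<open>\<epsilon> > 0\<close> by simp
      from tendsto_mult[OF tendsto_const exp_decay_tendsto[OF this, of 0], of "\<bar>v 0 - vi\<bar>"]
      show "((\<lambda>y. \<bar>v 0 - vi\<bar> * exp (- (c / 2 / \<epsilon>) * y)) \<longlongrightarrow> 0) at_top" by simp
    qed
    then show ?thesis by (rule LIM_zero_cancel)
  qed
  have mass: "deriv (\<lambda>z. 1 / v z * (\<epsilon> * v z)) y = 0" if "y > 0" for y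
    by (rule DERIV_imp_deriv, rule DERIV_eq_on_halfline[OF DERIV_const[of \<epsilon>] _ that])
      (use vpos in \<open>simp add: less_imp_neq[symmetric]\<close>)
  have momentum: "1 / v y * (\<epsilon> * v y) * deriv (\<lambda>y. \<epsilon> * v y) y + deriv (\<lambda>z. p (1 / v z)) y
      = deriv (deriv (\<lambda>y. \<epsilon> * v y)) y" if y: "y > 0" for y
  proof -
    have du: "deriv (\<lambda>y. \<epsilon> * v y) y = \<epsilon> * g (v y)" if "y > 0" for y
      using DERIV_cmult[OF v(3)[of y], of \<epsilon>] that by (intro DERIV_imp_deriv) simp
    have qv: "((\<lambda>s. q (v s)) has_real_derivative q' (v y) * g (v y)) (at y)"
      using y vpos[of y] by (intro DERIV_chain2[OF q_deriv v(3)]) auto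
    then have "((\<lambda>z. p (1 / v z)) has_real_derivative q' (v y) * g (v y)) (at y)"
      by (rule DERIV_eq_on_halfline[OF _ _ y]) (use q_p vpos in simp)
    then have dp: "deriv (\<lambda>z. p (1 / v z)) y = q' (v y) * g (v y)"
      by (rule DERIV_imp_deriv)
    have "((\<lambda>y. \<epsilon>\<^sup>2 * (v y - vi) + q (v y) - q vi) has_real_derivative
        \<epsilon>\<^sup>2 * (g (v y) - 0) + q' (v y) * g (v y) - 0) (at y)"
      using y by (intro DERIV_diff DERIV_add DERIV_cmult DERIV_const qv v(3)) auto
    then have "(deriv (\<lambda>y. \<epsilon> * v y) has_real_derivative
        \<epsilon>\<^sup>2 * (g (v y) - 0) + q' (v y) * g (v y) - 0) (at y)"
      by (rule DERIV_eq_on_halfline[OF _ _ y]) (use du \<open>\<epsilon> > 0\<close> in \<open>simp add: g_def\<close>)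
    then have "deriv (deriv (\<lambda>y. \<epsilon> * v y)) y = \<epsilon>\<^sup>2 * (g (v y) - 0) + q' (v y) * g (v y) - 0"
      by (rule DERIV_imp_deriv)
    then show ?thesis
      using du[OF y] dp vpos[of y] y by (simp add: power2_eq_square)
  qed
  have "smooth_on {0..} (\<lambda>y. 1 / v y)"
    using vpos by (intro smooth_on_divide smooth_on_const \<open>smooth_on {0..} v\<close>) (auto simp: less_imp_neq[symmetric])
  moreover have "smooth_on {0..} (\<lambda>y. \<epsilon> * v y)"
    by (intro smooth_on_mult smooth_on_const \<open>smooth_on {0..} v\<close>)
  moreover have "((\<lambda>y. 1 / v y) \<longlongrightarrow> 1 / vi) at_top" "((\<lambda>y. \<epsilon> * v y) \<longlongrightarrow> \<epsilon> * vi) at_top"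
    using \<open>vi > 0\<close> by (auto intro!: tendsto_intros lim)
  ultimately have "bl_solution p (1 / vi) (\<epsilon> * vi) (1 / v0) (\<epsilon> * v0) (\<lambda>y. 1 / v y) (\<lambda>y. \<epsilon> * v y)"
    unfolding bl_solution_def using vpos mass momentum v(1) by simp
  then show ?thesis by blast
qed

section \<open>From specific volume back to density and velocity\<close>

text \<open>One constant for both unknowns: 4 / a^2 is a Lipschitz constant of 1 / x near
  \<open>a\<close> and 16 / a^3 bounds its second derivative there, both for the density; the
  summand 1 and the last term serve the velocity.\<close>

definition K_total :: real where
  "K_total = (4 / a\<^sup>2 + 1) * K_error + 16 / a ^ 3 * K_slope * (\<eta> / c) + real m / r0 * (\<eta> / c)"

lemma K_total_nonneg: "K_total \<ge> 0"
  unfolding K_total_def using K_error_nonneg K_slope_nonneg a_pos c_pos \<eta>_pos r0_pos by simp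

lemma near_ge_half: "\<bar>x - a\<bar> \<le> \<eta> \<Longrightarrow> a / 2 \<le> x"
  using \<eta>_le by linarith

lemma inverse_lipschitz:
  assumes "\<bar>x - a\<bar> \<le> \<eta>" "\<bar>y - a\<bar> \<le> \<eta>"
  shows "\<bar>1 / x - 1 / y\<bar> \<le> 4 / a\<^sup>2 * \<bar>x - y\<bar>"
proof -
  have pos: "x > 0" "y > 0"
    using near_pos(1) assms by auto
  have "a / 2 * (a / 2) \<le> x * y"
    using near_ge_half[OF assms(1)] near_ge_half[OF assms(2)] a_pos by (intro mult_mono) auto
  then have "\<bar>x - y\<bar> / (x * y) \<le> \<bar>x - y\<bar> / (a / 2 * (a / 2))"
    using a_pos pos by (intro divide_left_mono) auto
  moreover have "1 / x - 1 / y = (y - x) / (x * y)"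
    using pos by (simp add: field_simps)
  then have "\<bar>1 / x - 1 / y\<bar> = \<bar>x - y\<bar> / (x * y)"
    using pos by (simp add: abs_mult abs_minus_commute)
  ultimately show ?thesis
    by (simp add: power2_eq_square mult.commute)
qed

text \<open>The density is nonlinear in v, so after replacing v by vE + b a second difference of 1 /
  x remains, small for the same reason as that of \<open>q\<close>. The velocity error is linear and
  equals \<epsilon> (\<theta> w - (1 - \<theta>) b).\<close>

lemma superposition_error:
  assumes flow: "flow \<mu> \<epsilon> v v' N" and eflow: "flow 0 \<epsilon> vE vE' NE"
    and layer: "layer \<epsilon> (vE r0) vB vB'" and \<epsilon>: "small \<epsilon>" and "\<mu> > 0"
    and init: "\<bar>v r0 - a\<bar> \<le> \<eta> / 4" "vB 0 = v r0" and r: "r \<ge> r0"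
  defines "y \<equiv> (r - r0) / \<mu>"
  shows "\<bar>1 / v r - 1 / vE r - 1 / vB y + 1 / vE r0\<bar> \<le> K_total * \<mu>"
    and "\<bar>\<epsilon> * \<theta> r * v r - \<epsilon> * \<theta> r * vE r - \<epsilon> * vB y + \<epsilon> * vE r0\<bar> \<le> K_total * \<mu>"
proof -
  define b where "b = vB y - vE r0"
  define w where "w = v r - vE r - b"
  define X where "X = \<eta> * \<epsilon> * \<mu> / c"
  have "\<epsilon> > 0" "\<epsilon> \<le> 1" using \<epsilon> by (auto simp: small_def)
  have vE_quarter: "\<bar>vE r - a\<bar> \<le> \<eta> / 4" "\<bar>vE r0 - a\<bar> \<le> \<eta> / 4"
    using inviscid_flow_quarter[OF eflow \<epsilon>] r by auto
  have init': "\<bar>vB 0 - a\<bar> \<le> \<eta> / 4" using init by simp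
  have b: "\<bar>b\<bar> \<le> \<eta> / 2" "(r - r0) * \<bar>b\<bar> \<le> X"
    unfolding b_def y_def X_def
    using layer_profile(2,3)[OF layer \<epsilon> \<open>\<mu> > 0\<close> vE_quarter(2) init' r] by auto
  have "X = \<eta> / c * \<mu> * \<epsilon>" by (simp add: X_def)
  also have "\<dots> \<le> \<eta> / c * \<mu> * 1"
    using \<open>\<epsilon> \<le> 1\<close> \<eta>_pos c_pos \<open>\<mu> > 0\<close> by (intro mult_left_mono) auto
  finally have X: "X \<le> \<eta> / c * \<mu>" by simp
  have near: "\<bar>v r - a\<bar> \<le> \<eta>" "\<bar>vE r + b - a\<bar> \<le> \<eta>" "\<bar>vE r - a\<bar> \<le> \<eta>"
      "\<bar>vE r0 + b - a\<bar> \<le> \<eta>" "\<bar>vE r0 - a\<bar> \<le> \<eta>"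
    using flow_trapped[OF flow \<open>\<mu> > 0\<close> \<epsilon> _ r] init(1) vE_quarter b(1) \<eta>_pos
    by linarith+
  have "\<bar>w\<bar> \<le> K_error * \<epsilon> * \<mu>"
    unfolding w_def b_def y_def
    by (rule flow_approximation[OF flow eflow layer \<epsilon> \<open>\<mu> > 0\<close> init r])
  also have "\<dots> \<le> K_error * 1 * \<mu>"
    using \<open>\<epsilon> \<le> 1\<close> \<open>\<mu> > 0\<close> K_error_nonneg by (intro mult_right_mono mult_left_mono) auto
  finally have w: "\<bar>w\<bar> \<le> K_error * \<mu>" by simp
  have \<theta>: "0 < \<theta> r" "\<theta> r \<le> 1"
    using \<theta>_pos[OF r] \<theta>_le_1[OF r] by auto

  have "\<bar>1 / v r - 1 / (vE r + b)\<bar> \<le> 4 / a\<^sup>2 * (K_error * \<mu>)"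
  proof -
    have "\<bar>1 / v r - 1 / (vE r + b)\<bar> \<le> 4 / a\<^sup>2 * \<bar>v r - (vE r + b)\<bar>"
      by (rule inverse_lipschitz[OF near(1,2)])
    also have "v r - (vE r + b) = w" by (simp add: w_def)
    also have "4 / a\<^sup>2 * \<bar>w\<bar> \<le> 4 / a\<^sup>2 * (K_error * \<mu>)"
      using w by (intro mult_left_mono) auto
    finally show ?thesis .
  qed
  moreover have "\<bar>1 / (vE r + b) - 1 / vE r - 1 / (vE r0 + b) + 1 / vE r0\<bar> \<le> 16 / a ^ 3 * K_slope * (\<eta> / c) * \<mu>"
  proof -
    have "\<bar>1 / (vE r + b) - 1 / vE r - 1 / (vE r0 + b) + 1 / vE r0\<bar> \<le> 16 / a ^ 3 * \<bar>vE r - vE r0\<bar> * \<bar>b\<bar>"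
    proof (rule second_difference_bound[of "a - \<eta>" "a + \<eta>" "\<lambda>x. 1 / x" "\<lambda>x. - 1 / x\<^sup>2" "\<lambda>x. 2 / x ^ 3"])
      fix x assume "x \<in> {a - \<eta>..a + \<eta>}"
      then have x: "\<bar>x - a\<bar> \<le> \<eta>" by (auto simp: abs_le_iff)
      then have "x > 0" "a / 2 \<le> x"
        using near_pos(1) near_ge_half by auto
      then show "((\<lambda>x. 1 / x) has_real_derivative - 1 / x\<^sup>2) (at x)"
        "((\<lambda>x. - 1 / x\<^sup>2) has_real_derivative 2 / x ^ 3) (at x)"
        by (auto intro!: derivative_eq_intros simp: field_simps power2_eq_square power3_eq_cube)
      have "(a / 2) ^ 3 \<le> x ^ 3"
        using \<open>a / 2 \<le> x\<close> a_pos by (intro power_mono) auto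
      then have "2 / x ^ 3 \<le> 2 / (a / 2) ^ 3"
        using a_pos \<open>x > 0\<close> by (intro divide_left_mono) auto
      then show "\<bar>2 / x ^ 3\<bar> \<le> 16 / a ^ 3"
        using \<open>x > 0\<close> by (simp add: power3_eq_cube)
    qed (use near in \<open>auto simp: abs_le_iff\<close>)
    also have "\<bar>vE r - vE r0\<bar> \<le> K_slope * 1 * (r - r0)"
    proof -
      have "\<bar>vE r - vE r0\<bar> \<le> K_slope * \<epsilon>\<^sup>2 * (r - r0)"
        by (rule inviscid_flow_lipschitz[OF eflow \<epsilon> r])
      also have "\<dots> \<le> K_slope * 1 * (r - r0)"
        using small_le(3)[OF \<epsilon>] K_slope_nonneg r by (intro mult_right_mono mult_left_mono) auto
      finally show ?thesis .
    qed
    then have "16 / a ^ 3 * \<bar>vE r - vE r0\<bar> * \<bar>b\<bar> \<le> 16 / a ^ 3 * (K_slope * 1 * (r - r0)) * \<bar>b\<bar>"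
      using a_pos by (intro mult_right_mono mult_left_mono) auto
    also have "\<dots> = 16 / a ^ 3 * K_slope * ((r - r0) * \<bar>b\<bar>)" by simp
    also have "\<dots> \<le> 16 / a ^ 3 * K_slope * (\<eta> / c * \<mu>)"
      using b(2) X K_slope_nonneg a_pos by (intro mult_left_mono) auto
    finally show ?thesis by (simp add: mult.assoc)
  qed
  ultimately have "\<bar>1 / v r - 1 / vE r - 1 / (vE r0 + b) + 1 / vE r0\<bar>
      \<le> 4 / a\<^sup>2 * (K_error * \<mu>) + 16 / a ^ 3 * K_slope * (\<eta> / c) * \<mu>"
    by linarith
  moreover have "0 \<le> K_error * \<mu>" "0 \<le> real m / r0 * (\<eta> / c) * \<mu>"
    "0 \<le> 4 / a\<^sup>2 * (K_error * \<mu>)" "0 \<le> 16 / a ^ 3 * K_slope * (\<eta> / c) * \<mu>"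
    using K_error_nonneg K_slope_nonneg a_pos c_pos \<eta>_pos r0_pos \<open>\<mu> > 0\<close> by auto
  moreover have K: "K_total * \<mu> = 4 / a\<^sup>2 * (K_error * \<mu>) + K_error * \<mu>
      + 16 / a ^ 3 * K_slope * (\<eta> / c) * \<mu> + real m / r0 * (\<eta> / c) * \<mu>"
    by (simp add: K_total_def algebra_simps)
  ultimately show "\<bar>1 / v r - 1 / vE r - 1 / vB y + 1 / vE r0\<bar> \<le> K_total * \<mu>"
    by (simp add: b_def)

  have "(1 - \<theta> r) * \<bar>b\<bar> \<le> real m / r0 * (\<eta> / c) * \<mu>"
  proof -
    have "(1 - \<theta> r) * \<bar>b\<bar> \<le> real m / r0 * (r - r0) * \<bar>b\<bar>"
      using one_minus_\<theta>_le[OF r] by (intro mult_right_mono) auto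
    also have "\<dots> = real m / r0 * ((r - r0) * \<bar>b\<bar>)" by simp
    also have "\<dots> \<le> real m / r0 * (\<eta> / c * \<mu>)"
      using b(2) X r0_pos by (intro mult_left_mono) auto
    finally show ?thesis by simp
  qed
  moreover have "\<bar>\<theta> r * w\<bar> \<le> K_error * \<mu>"
  proof -
    have "\<bar>\<theta> r * w\<bar> \<le> 1 * \<bar>w\<bar>"
      using \<theta> unfolding abs_mult by (intro mult_right_mono) auto
    with w show ?thesis by simp
  qed
  moreover have "\<bar>(1 - \<theta> r) * b\<bar> = (1 - \<theta> r) * \<bar>b\<bar>"
    using \<theta> by (simp add: abs_mult)
  ultimately have "\<bar>\<theta> r * w - (1 - \<theta> r) * b\<bar> \<le> K_total * \<mu>"
    unfolding K using \<open>0 \<le> 4 / a\<^sup>2 * (K_error * \<mu>)\<close> \<open>0 \<le> 16 / a ^ 3 * K_slope * (\<eta> / c) * \<mu>\<close> by linarith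
  moreover have "\<epsilon> * \<theta> r * v r - \<epsilon> * \<theta> r * vE r - \<epsilon> * vB y + \<epsilon> * vE r0 = \<epsilon> * (\<theta> r * w - (1 - \<theta> r) * b)"
    by (simp add: w_def b_def algebra_simps)
  moreover have "\<epsilon> * \<bar>\<theta> r * w - (1 - \<theta> r) * b\<bar> \<le> 1 * \<bar>\<theta> r * w - (1 - \<theta> r) * b\<bar>"
    using \<open>\<epsilon> \<le> 1\<close> by (intro mult_right_mono) auto
  ultimately show "\<bar>\<epsilon> * \<theta> r * v r - \<epsilon> * \<theta> r * vE r - \<epsilon> * vB y + \<epsilon> * vE r0\<bar> \<le> K_total * \<mu>"
    using \<open>\<epsilon> > 0\<close> by (simp add: abs_mult)
qed

end

subsection \<open>Estimates for a barotropic pressure law\<close>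

text \<open>\<open>Q\<close> is the specific enthalpy, the integral of dp / \<rho>, as a function of
  the specific volume x = 1 / \<rho>, up to an additive constant.\<close>

locale barotropic_gas = gas_law "\<lambda>x. p (1 / x)" q' q'' a \<eta> c L M r0 m
  for p q' q'' a \<eta> c L M r0 m +
  fixes Q :: "real \<Rightarrow> real"
  assumes smooth_q: "smooth_on {0<..} (\<lambda>x. p (1 / x))"
    and smooth_q': "smooth_on {0<..} q'"
    and Q': "\<And>x. x > 0 \<Longrightarrow> (Q has_real_derivative x * q' x) (at x)"

lemma barotropic_gas_exists:
  assumes "r0 > 0" "m \<ge> 1" "a > 0" and p: "smooth_on {0<..} p" "\<forall>\<rho>>0. deriv p \<rho> > 0"
  shows "\<exists>q' q'' \<eta> c L M Q. barotropic_gas p q' q'' a \<eta> c L M r0 m Q"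
proof -
  let ?q = "\<lambda>x. p (1 / x)"
  have smooth_q: "smooth_on {0<..} ?q"
    by (rule smooth_on_compose[OF p(1) smooth_on_divide[OF smooth_on_const smooth_on_ident]]) auto
  then obtain q' where q': "smooth_on {0<..} q'" "\<And>x. x \<in> {0<..} \<Longrightarrow> (?q has_real_derivative q' x) (at x)"
    using smooth_on_has_deriv open_greaterThan by metis
  obtain q'' where q'': "smooth_on {0<..} q''" "\<And>x. x \<in> {0<..} \<Longrightarrow> (q' has_real_derivative q'' x) (at x)"
    using smooth_on_has_deriv[OF q'(1)] open_greaterThan by metis
  obtain p' where p': "\<And>x. x \<in> {0<..} \<Longrightarrow> (p has_real_derivative p' x) (at x)"
    using smooth_on_has_deriv[OF p(1)] open_greaterThan by metis
  have q'_neg: "q' x < 0" if "x > 0" for x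
  proof -
    have "p' (1 / x) > 0"
      using p(2) DERIV_imp_deriv[OF p'[of "1 / x"]] that by (metis divide_pos_pos greaterThan_iff zero_less_one)
    have "((\<lambda>x. 1 / x) has_real_derivative - 1 / x\<^sup>2) (at x)"
      using that by (auto intro!: derivative_eq_intros simp: power2_eq_square)
    from DERIV_chain2[OF p' this] have "(?q has_real_derivative p' (1 / x) * (- 1 / x\<^sup>2)) (at x)"
      using that by simp
    moreover have "(?q has_real_derivative q' x) (at x)"
      using q'(2) that by simp
    ultimately have "q' x = p' (1 / x) * (- 1 / x\<^sup>2)"
      by (rule DERIV_unique[rotated])
    with \<open>p' (1 / x) > 0\<close> that show ?thesis
      by simp
  qed
  \<comment> \<open>Half the slope at \<open>a\<close> leaves room for continuity to give q' < -c on
    a neighbourhood. A closed interval inside it and away from zero fixes \<open>\<eta>\<close>, and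
    compactness then supplies \<open>L\<close> and \<open>M\<close>.\<close>
  define c where "c = - q' a / 2"
  have "c > 0" "q' a < - c"
    using q'_neg[OF \<open>a > 0\<close>] by (auto simp: c_def)
  have "isCont q' a"
    using q''(2)[of a] \<open>a > 0\<close> by (auto intro: DERIV_isCont)
  then have "\<forall>\<^sub>F x in at a. q' x < - c"
    unfolding isCont_def using \<open>q' a < - c\<close> by (rule order_tendstoD)
  then obtain d where d: "d > 0" "\<And>x. \<bar>x - a\<bar> < d \<Longrightarrow> q' x < - c"
    using \<open>q' a < - c\<close> unfolding eventually_at dist_real_def by (metis UNIV_I)
  define \<eta> where "\<eta> = min (d / 2) (a / 2)"
  have \<eta>: "\<eta> > 0" "\<eta> \<le> a / 2" "\<eta> < d"
    using d(1) \<open>a > 0\<close> by (auto simp: \<eta>_def)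
  have bounded: "\<exists>B. \<forall>x. \<bar>x - a\<bar> \<le> \<eta> \<longrightarrow> \<bar>f x\<bar> \<le> B" if "smooth_on {0<..} f" for f
  proof -
    have "continuous_on {a - \<eta>..a + \<eta>} f"
      by (rule continuous_on_subset[OF smooth_on_continuous[OF that]]) (use \<eta> \<open>a > 0\<close> in auto)
    then have "bounded (f ` {a - \<eta>..a + \<eta>})"
      by (intro compact_imp_bounded compact_continuous_image) auto
    then obtain B where "\<forall>x\<in>{a - \<eta>..a + \<eta>}. \<bar>f x\<bar> \<le> B"
      unfolding bounded_iff by auto
    then show ?thesis
      by (intro exI[of _ B]) (auto simp: abs_le_iff)
  qed
  obtain L where L: "\<And>x. \<bar>x - a\<bar> \<le> \<eta> \<Longrightarrow> \<bar>q' x\<bar> \<le> L"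
    using bounded[OF q'(1)] by blast
  obtain M where M: "\<And>x. \<bar>x - a\<bar> \<le> \<eta> \<Longrightarrow> \<bar>q'' x\<bar> \<le> M"
    using bounded[OF q''(1)] by blast
  obtain Q where Q: "\<And>x. 0 < ereal x \<Longrightarrow> ereal x < \<infinity> \<Longrightarrow> (Q has_real_derivative x * q' x) (at x)"
  proof (rule continuous_has_antiderivative[of 0 \<infinity> "\<lambda>x. x * q' x"])
    fix x assume "0 < ereal x"
    then have "isCont q' x"
      using q''(2)[of x] by (auto intro: DERIV_isCont)
    then show "isCont (\<lambda>x. x * q' x) x"
      by (intro continuous_intros)
  qed auto
  have "barotropic_gas p q' q'' a \<eta> c L M r0 m Q"
  proof unfold_locales
    fix x assume x: "\<bar>x - a\<bar> \<le> \<eta>"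
    show "q' x \<le> - c"
      using d(2)[of x] x \<eta>(3) by simp
    show "- L \<le> q' x" "\<bar>q'' x\<bar> \<le> M"
      using L[OF x] M[OF x] by (auto simp: abs_le_iff)
  qed (use assms \<eta> \<open>c > 0\<close> q' q'' smooth_q Q in auto)
  then show ?thesis by blast
qed

context barotropic_gas
begin

lemma euler_flow:
  assumes E: "euler_solution p (Suc m) r0 (1 / a) \<rho>E uE" and \<epsilon>: "\<rho>E r0 * uE r0 = \<epsilon>" "\<epsilon> > 0"
  obtains v' N where "flow 0 \<epsilon> (\<lambda>r. 1 / \<rho>E r) v' N"
    and "\<And>r. r \<ge> r0 \<Longrightarrow> uE r = \<epsilon> * \<theta> r * (1 / \<rho>E r)"
  by (rule radial_solution_flow[of p \<rho>E uE 0 \<epsilon>])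
    (use E \<epsilon> that in \<open>auto simp: euler_solution_def\<close>)

lemma ns_flow:
  assumes S: "ns_solution p (Suc m) r0 \<mu> (1 / a) \<rho>m um \<rho> u" and "\<mu> > 0" and \<epsilon>: "\<epsilon> = \<rho>m * um" "\<epsilon> > 0"
  obtains v' N where "flow \<mu> \<epsilon> (\<lambda>r. 1 / \<rho> r) v' N"
    and "\<And>r. r \<ge> r0 \<Longrightarrow> u r = \<epsilon> * \<theta> r * (1 / \<rho> r)"
  by (rule radial_solution_flow[of p \<rho> u \<mu> \<epsilon>])
    (use S \<epsilon> \<open>\<mu> > 0\<close> that in \<open>auto simp: ns_solution_def\<close>)

lemma euler_exists:
  "\<exists>e>0. \<forall>\<epsilon>. \<epsilon>\<^sup>2 \<le> e \<longrightarrow>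
    (\<exists>\<rho>E uE. euler_solution p (Suc m) r0 (1 / a) \<rho>E uE \<and> \<rho>E r0 * uE r0 = \<epsilon>)"
proof -
  obtain e where e: "e > 0"
    "\<And>\<epsilon>. \<epsilon>\<^sup>2 \<le> e \<Longrightarrow> \<exists>v. smooth_on {r0..} v \<and> (\<forall>r\<ge>r0. v r > 0) \<and> (v \<longlongrightarrow> a) at_top \<and>
      (\<forall>r\<ge>r0. \<epsilon>\<^sup>2 * (\<theta> r)\<^sup>2 * (v r)\<^sup>2 / 2 + Q (v r) = Q a)"
    using bernoulli_solution[OF smooth_q' Q'] by blast
  have "\<exists>\<rho>E uE. euler_solution p (Suc m) r0 (1 / a) \<rho>E uE \<and> \<rho>E r0 * uE r0 = \<epsilon>" if \<epsilon>: "\<epsilon>\<^sup>2 \<le> e" for \<epsilon>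
  proof -
    obtain v where v: "smooth_on {r0..} v" "\<And>r. r \<ge> r0 \<Longrightarrow> v r > 0" "(v \<longlongrightarrow> a) at_top"
      "\<And>r. r \<ge> r0 \<Longrightarrow> \<epsilon>\<^sup>2 * (\<theta> r)\<^sup>2 * (v r)\<^sup>2 / 2 + Q (v r) = Q a"
      using e(2)[OF \<epsilon>] by blast
    have "euler_solution p (Suc m) r0 (1 / a) (\<lambda>r. 1 / v r) (\<lambda>r. \<epsilon> * \<theta> r * v r)"
      by (rule euler_solution_of_bernoulli[OF refl Q' v]) simp_all
    moreover have "1 / v r0 * (\<epsilon> * \<theta> r0 * v r0) = \<epsilon>"
      using v(2)[of r0] by (simp add: \<theta>_r0)
    ultimately show ?thesis
      by (intro exI[of _ "\<lambda>r. 1 / v r"] exI[of _ "\<lambda>r. \<epsilon> * \<theta> r * v r"] conjI)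
  qed
  with e(1) show ?thesis by blast
qed

lemma euler_unique:
  assumes E: "euler_solution p (Suc m) r0 (1 / a) \<rho>E uE" "\<rho>E r0 * uE r0 = \<epsilon>"
    and E': "euler_solution p (Suc m) r0 (1 / a) \<rho>E' uE'" "\<rho>E' r0 * uE' r0 = \<epsilon>"
    and \<epsilon>: "small \<epsilon>" and "r \<ge> r0"
  shows "\<rho>E' r = \<rho>E r \<and> uE' r = uE r"
proof -
  obtain v' N where flow: "flow 0 \<epsilon> (\<lambda>r. 1 / \<rho>E r) v' N"
    and u: "\<And>r. r \<ge> r0 \<Longrightarrow> uE r = \<epsilon> * \<theta> r * (1 / \<rho>E r)"
    using euler_flow[OF E small_le(2)[OF \<epsilon>]] by blast
  obtain w' N' where flow': "flow 0 \<epsilon> (\<lambda>r. 1 / \<rho>E' r) w' N'"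
    and u': "\<And>r. r \<ge> r0 \<Longrightarrow> uE' r = \<epsilon> * \<theta> r * (1 / \<rho>E' r)"
    using euler_flow[OF E' small_le(2)[OF \<epsilon>]] by blast
  have "1 / \<rho>E r = 1 / \<rho>E' r"
    by (rule inviscid_flow_unique[OF Q' flow flow' \<epsilon> \<open>r \<ge> r0\<close>])
  with u[OF \<open>r \<ge> r0\<close>] u'[OF \<open>r \<ge> r0\<close>] show ?thesis by simp
qed

lemma euler_estimates:
  assumes E: "euler_solution p (Suc m) r0 (1 / a) \<rho>E uE" "\<rho>E r0 * uE r0 = \<epsilon>"
    and \<epsilon>: "small \<epsilon>" and r: "r \<ge> r0"
  shows "\<bar>\<rho>E r - 1 / a\<bar> \<le> 8 / (a * c) * \<epsilon>\<^sup>2 * (\<theta> r)\<^sup>2"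
    and "\<epsilon> * \<theta> r * (a / 2) \<le> uE r" and "uE r \<le> \<epsilon> * \<theta> r * (2 * a)"
proof -
  obtain v' N where flow: "flow 0 \<epsilon> (\<lambda>r. 1 / \<rho>E r) v' N"
    and u: "\<And>r. r \<ge> r0 \<Longrightarrow> uE r = \<epsilon> * \<theta> r * (1 / \<rho>E r)"
    using euler_flow[OF E small_le(2)[OF \<epsilon>]] by blast
  have near: "\<bar>1 / \<rho>E r - a\<bar> \<le> \<eta>" "\<bar>a - a\<bar> \<le> \<eta>"
    using inviscid_flow_quarter[OF flow \<epsilon> r] \<eta>_pos by auto
  have "\<bar>1 / (1 / \<rho>E r) - 1 / a\<bar> \<le> 4 / a\<^sup>2 * \<bar>1 / \<rho>E r - a\<bar>"
    by (rule inverse_lipschitz[OF near])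
  also have "\<dots> \<le> 4 / a\<^sup>2 * (2 * a / c * \<epsilon>\<^sup>2 * (\<theta> r)\<^sup>2)"
    using inviscid_flow_close[OF flow \<epsilon> r] by (intro mult_left_mono) auto
  also have "\<dots> = 8 / (a * c) * \<epsilon>\<^sup>2 * (\<theta> r)\<^sup>2"
    using a_pos by (simp add: power2_eq_square)
  finally show "\<bar>\<rho>E r - 1 / a\<bar> \<le> 8 / (a * c) * \<epsilon>\<^sup>2 * (\<theta> r)\<^sup>2" by simp
  have "\<epsilon> * \<theta> r \<ge> 0"
    using small_le(2)[OF \<epsilon>] \<theta>_pos[OF r] by simp
  then show "\<epsilon> * \<theta> r * (a / 2) \<le> uE r" "uE r \<le> \<epsilon> * \<theta> r * (2 * a)"
    unfolding u[OF r] using near_ge_half[OF near(1)] near_pos(2)[OF near(1)]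
    by (intro mult_left_mono; simp)+
qed

text \<open>Decay of the specific volume passes to the density through the Lipschitz constant 4 /
  a^2 of 1 / x. Since \<theta> = 1 at \<open>r0\<close>, layer and Euler velocity are both
  \<epsilon> times the specific volume there, and \<epsilon> \<le> 1.\<close>

lemma bl_estimates:
  assumes E: "euler_solution p (Suc m) r0 (1 / a) \<rho>E uE" "\<rho>E r0 * uE r0 = \<epsilon>"
    and \<epsilon>: "small \<epsilon>" "\<epsilon> = \<rho>m * um" and \<rho>m: "\<bar>1 / \<rho>m - a\<bar> \<le> \<eta> / 4"
    and B: "bl_solution p (\<rho>E r0) (uE r0) \<rho>m um \<rho>B uB" and "y \<ge> 0"
  defines "\<delta> \<equiv> \<bar>1 / \<rho>m - 1 / \<rho>E r0\<bar>"
  shows "\<bar>\<rho>B y - \<rho>E r0\<bar> \<le> 4 / a\<^sup>2 * (\<delta> * exp (- (c / 2 / \<epsilon>) * y))"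
    and "\<bar>uB y - uE r0\<bar> \<le> \<delta> * exp (- (c / 2 / \<epsilon>) * y)"
proof -
  have "\<epsilon> > 0" "\<epsilon> \<le> 1" using \<epsilon>(1) by (auto simp: small_def)
  obtain v' N where flow: "flow 0 \<epsilon> (\<lambda>r. 1 / \<rho>E r) v' N"
    and u: "\<And>r. r \<ge> r0 \<Longrightarrow> uE r = \<epsilon> * \<theta> r * (1 / \<rho>E r)"
    using euler_flow[OF E \<open>\<epsilon> > 0\<close>] by blast
  have \<rho>E: "\<bar>1 / \<rho>E r0 - a\<bar> \<le> \<eta> / 4" "\<rho>E r0 > 0"
    using inviscid_flow_quarter[OF flow \<epsilon>(1), of r0] E(1) by (auto simp: euler_solution_def)
  obtain w' where layer: "layer \<epsilon> (1 / \<rho>E r0) (\<lambda>y. 1 / \<rho>B y) w'"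
    and uB: "\<And>y. y \<ge> 0 \<Longrightarrow> uB y = \<epsilon> * (1 / \<rho>B y)"
    using bl_solution_layer[OF refl B \<rho>E(2) \<epsilon>(2) \<open>\<epsilon> > 0\<close>] by blast
  have init: "\<rho>B 0 = \<rho>m" using B by (simp add: bl_solution_def)
  have decay: "\<bar>1 / \<rho>B y - 1 / \<rho>E r0\<bar> \<le> \<delta> * exp (- (c / 2 / \<epsilon>) * y)" and near: "\<bar>1 / \<rho>B y - a\<bar> \<le> \<eta>"
    using layer_decay[OF layer \<epsilon>(1) \<rho>E(1) _ \<open>y \<ge> 0\<close>] \<rho>m unfolding init \<delta>_def by auto
  have "\<bar>1 / (1 / \<rho>B y) - 1 / (1 / \<rho>E r0)\<bar> \<le> 4 / a\<^sup>2 * \<bar>1 / \<rho>B y - 1 / \<rho>E r0\<bar>"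
    using near \<rho>E(1) \<eta>_pos by (intro inverse_lipschitz) auto
  also have "\<dots> \<le> 4 / a\<^sup>2 * (\<delta> * exp (- (c / 2 / \<epsilon>) * y))"
    by (rule mult_left_mono[OF decay]) simp
  finally show "\<bar>\<rho>B y - \<rho>E r0\<bar> \<le> 4 / a\<^sup>2 * (\<delta> * exp (- (c / 2 / \<epsilon>) * y))" by simp
  have "uB y - uE r0 = \<epsilon> * (1 / \<rho>B y - 1 / \<rho>E r0)"
    using u[of r0] uB[OF \<open>y \<ge> 0\<close>] by (simp add: \<theta>_r0 algebra_simps)
  then have "\<bar>uB y - uE r0\<bar> = \<epsilon> * \<bar>1 / \<rho>B y - 1 / \<rho>E r0\<bar>"
    using \<open>\<epsilon> > 0\<close> by (simp add: abs_mult)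
  also have "\<dots> \<le> 1 * \<bar>1 / \<rho>B y - 1 / \<rho>E r0\<bar>"
    using \<open>\<epsilon> \<le> 1\<close> by (intro mult_right_mono) auto
  finally show "\<bar>uB y - uE r0\<bar> \<le> \<delta> * exp (- (c / 2 / \<epsilon>) * y)"
    using decay by simp
qed

lemma bl_unique:
  assumes E: "euler_solution p (Suc m) r0 (1 / a) \<rho>E uE" "\<rho>E r0 * uE r0 = \<epsilon>"
    and \<epsilon>: "small \<epsilon>" "\<epsilon> = \<rho>m * um" and \<rho>m: "\<bar>1 / \<rho>m - a\<bar> \<le> \<eta> / 4"
    and B: "bl_solution p (\<rho>E r0) (uE r0) \<rho>m um \<rho>B uB"
    and B': "bl_solution p (\<rho>E r0) (uE r0) \<rho>m um \<rho>B' uB'" and "y \<ge> 0"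
  shows "\<rho>B' y = \<rho>B y \<and> uB' y = uB y"
proof -
  have "\<epsilon> > 0" using small_le(2)[OF \<epsilon>(1)] .
  obtain v' N where flow: "flow 0 \<epsilon> (\<lambda>r. 1 / \<rho>E r) v' N"
    using euler_flow[OF E \<open>\<epsilon> > 0\<close>] by blast
  have \<rho>E: "\<bar>1 / \<rho>E r0 - a\<bar> \<le> \<eta> / 4" "\<rho>E r0 > 0"
    using inviscid_flow_quarter[OF flow \<epsilon>(1), of r0] E(1) by (auto simp: euler_solution_def)
  obtain w where layer: "layer \<epsilon> (1 / \<rho>E r0) (\<lambda>y. 1 / \<rho>B y) w"
    and uB: "\<And>y. y \<ge> 0 \<Longrightarrow> uB y = \<epsilon> * (1 / \<rho>B y)"
    using bl_solution_layer[OF refl B \<rho>E(2) \<epsilon>(2) \<open>\<epsilon> > 0\<close>] by blast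
  obtain w' where layer': "layer \<epsilon> (1 / \<rho>E r0) (\<lambda>y. 1 / \<rho>B' y) w'"
    and uB': "\<And>y. y \<ge> 0 \<Longrightarrow> uB' y = \<epsilon> * (1 / \<rho>B' y)"
    using bl_solution_layer[OF refl B' \<rho>E(2) \<epsilon>(2) \<open>\<epsilon> > 0\<close>] by blast
  have "\<rho>B 0 = \<rho>m" "\<rho>B' 0 = \<rho>m" using B B' by (auto simp: bl_solution_def)
  then have init: "\<bar>1 / \<rho>B 0 - a\<bar> \<le> \<eta> / 4" "1 / \<rho>B' 0 = 1 / \<rho>B 0"
    using \<rho>m by auto
  have "1 / \<rho>B' y = 1 / \<rho>B y"
    by (rule layer_unique[OF layer layer' \<epsilon>(1) \<rho>E(1) init \<open>y \<ge> 0\<close>])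
  with uB[OF \<open>y \<ge> 0\<close>] uB'[OF \<open>y \<ge> 0\<close>] show ?thesis by simp
qed

lemma bl_exists:
  assumes E: "euler_solution p (Suc m) r0 (1 / a) \<rho>E uE" "\<rho>E r0 * uE r0 = \<epsilon>"
    and \<epsilon>: "small \<epsilon>" "\<epsilon> = \<rho>m * um" and \<rho>m: "\<bar>1 / \<rho>m - a\<bar> \<le> \<eta> / 4" "\<rho>m > 0"
  shows "\<exists>\<rho>B uB. bl_solution p (\<rho>E r0) (uE r0) \<rho>m um \<rho>B uB"
proof -
  have "\<epsilon> > 0" using small_le(2)[OF \<epsilon>(1)] .
  obtain v' N where flow: "flow 0 \<epsilon> (\<lambda>r. 1 / \<rho>E r) v' N"
    and u: "\<And>r. r \<ge> r0 \<Longrightarrow> uE r = \<epsilon> * \<theta> r * (1 / \<rho>E r)"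
    using euler_flow[OF E \<open>\<epsilon> > 0\<close>] by blast
  have \<rho>E: "\<bar>1 / \<rho>E r0 - a\<bar> \<le> \<eta> / 4"
    using inviscid_flow_quarter[OF flow \<epsilon>(1), of r0] by auto
  have "uE r0 = \<epsilon> * (1 / \<rho>E r0)" "um = \<epsilon> * (1 / \<rho>m)"
    using u[of r0] \<epsilon>(2) \<rho>m(2) by (auto simp: \<theta>_r0)
  with bl_solution_exists[OF refl smooth_q \<epsilon>(1) \<rho>E \<rho>m(1)] show ?thesis
    by auto
qed

lemma ns_approximation:
  assumes E: "euler_solution p (Suc m) r0 (1 / a) \<rho>E uE" "\<rho>E r0 * uE r0 = \<epsilon>"
    and \<epsilon>: "small \<epsilon>" "\<epsilon> = \<rho>m * um" and \<rho>m: "\<bar>1 / \<rho>m - a\<bar> \<le> \<eta> / 4"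
    and B: "bl_solution p (\<rho>E r0) (uE r0) \<rho>m um \<rho>B uB"
    and S: "ns_solution p (Suc m) r0 \<mu> (1 / a) \<rho>m um \<rho> u" and "\<mu> > 0" and r: "r \<ge> r0"
  shows "\<bar>\<rho> r - \<rho>E r - \<rho>B ((r - r0) / \<mu>) + \<rho>E r0\<bar> \<le> K_total * \<mu>"
    and "\<bar>u r - uE r - uB ((r - r0) / \<mu>) + uE r0\<bar> \<le> K_total * \<mu>"
proof -
  have "\<epsilon> > 0" using small_le(2)[OF \<epsilon>(1)] .
  obtain v' N where eflow: "flow 0 \<epsilon> (\<lambda>r. 1 / \<rho>E r) v' N"
    and uE: "\<And>r. r \<ge> r0 \<Longrightarrow> uE r = \<epsilon> * \<theta> r * (1 / \<rho>E r)"
    using euler_flow[OF E \<open>\<epsilon> > 0\<close>] by blast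
  obtain w' N' where flow: "flow \<mu> \<epsilon> (\<lambda>r. 1 / \<rho> r) w' N'"
    and u: "\<And>r. r \<ge> r0 \<Longrightarrow> u r = \<epsilon> * \<theta> r * (1 / \<rho> r)"
    using ns_flow[OF S \<open>\<mu> > 0\<close> \<epsilon>(2) \<open>\<epsilon> > 0\<close>] by blast
  have "\<rho>E r0 > 0" using E by (simp add: euler_solution_def)
  then obtain z' where layer: "layer \<epsilon> (1 / \<rho>E r0) (\<lambda>y. 1 / \<rho>B y) z'"
    and uB: "\<And>y. y \<ge> 0 \<Longrightarrow> uB y = \<epsilon> * (1 / \<rho>B y)"
    using bl_solution_layer[OF refl B _ \<epsilon>(2) \<open>\<epsilon> > 0\<close>] by blast
  have init: "\<bar>1 / \<rho> r0 - a\<bar> \<le> \<eta> / 4" "1 / \<rho>B 0 = 1 / \<rho> r0"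
    using \<rho>m B S by (auto simp: bl_solution_def ns_solution_def)
  have y: "(r - r0) / \<mu> \<ge> 0"
    using r \<open>\<mu> > 0\<close> by simp
  note error = superposition_error[OF flow eflow layer \<epsilon>(1) \<open>\<mu> > 0\<close> init r]
  from error(1) show "\<bar>\<rho> r - \<rho>E r - \<rho>B ((r - r0) / \<mu>) + \<rho>E r0\<bar> \<le> K_total * \<mu>"
    by simp
  from error(2) show "\<bar>u r - uE r - uB ((r - r0) / \<mu>) + uE r0\<bar> \<le> K_total * \<mu>"
    unfolding u[OF r] uE[OF r] uB[OF y] using uE[of r0] by (simp add: \<theta>_r0)
qed

section \<open>Smallness of the data and choice of constants\<close>

text \<open>The three thresholds keep the boundary density between 1 / (2 a) and 2 / a, make the
  flux at most \<open>s\<close>, and place the boundary specific volume within \<eta> / 4 of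
  \<open>a\<close>.\<close>

lemma boundary_data_small:
  assumes "s > 0" and \<epsilon>_small: "\<And>\<epsilon>. 0 < \<epsilon> \<Longrightarrow> \<epsilon> \<le> s \<Longrightarrow> P \<epsilon>"
  defines "\<epsilon>0 \<equiv> min (1 / (2 * a)) (min (s * a / 2) (\<eta> / (8 * a\<^sup>2)))"
  shows "\<epsilon>0 > 0"
    and "\<And>\<rho>m um. um > 0 \<Longrightarrow> \<rho>m > 0 \<Longrightarrow> um + \<bar>\<rho>m - 1 / a\<bar> \<le> \<epsilon>0 \<Longrightarrow>
      P (\<rho>m * um) \<and> um / (2 * a) \<le> \<rho>m * um \<and> \<rho>m * um \<le> 2 / a * um \<and>
      \<bar>1 / \<rho>m - a\<bar> \<le> \<eta> / 4 \<and> \<bar>1 / \<rho>m - a\<bar> \<le> 2 * a\<^sup>2 * \<bar>\<rho>m - 1 / a\<bar>"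
proof -
  show "\<epsilon>0 > 0"
    unfolding \<epsilon>0_def using a_pos \<eta>_pos \<open>s > 0\<close> by simp
  fix \<rho>m um :: real assume um: "um > 0" "\<rho>m > 0" and small: "um + \<bar>\<rho>m - 1 / a\<bar> \<le> \<epsilon>0"
  then have bounds: "um \<le> s * a / 2" "\<bar>\<rho>m - 1 / a\<bar> \<le> 1 / (2 * a)" "\<bar>\<rho>m - 1 / a\<bar> \<le> \<eta> / (8 * a\<^sup>2)"
    unfolding \<epsilon>0_def min.bounded_iff by linarith+
  have half: "1 / a = 2 * (1 / (2 * a))" "2 / a = 4 * (1 / (2 * a))" "1 / (2 * a) > 0"
    using a_pos by auto
  have lower: "1 / (2 * a) \<le> \<rho>m" and upper: "\<rho>m \<le> 2 / a"
    using bounds(2) half by linarith+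
  have "1 / (2 * a) * um \<le> \<rho>m * um" "\<rho>m * um \<le> 2 / a * um"
    using mult_right_mono[OF lower, of um] mult_right_mono[OF upper, of um] um by auto
  moreover have "2 / a * um \<le> 2 / a * (s * a / 2)"
    using bounds(1) a_pos by (intro mult_left_mono) auto
  then have "2 / a * um \<le> s" using a_pos by simp
  moreover have "0 < \<rho>m * um" using um by simp
  moreover have dist: "\<bar>1 / \<rho>m - a\<bar> \<le> 2 * a\<^sup>2 * \<bar>\<rho>m - 1 / a\<bar>"
  proof -
    have "1 / \<rho>m - a = - (a / \<rho>m) * (\<rho>m - 1 / a)"
      using a_pos um by (simp add: field_simps)
    then have "\<bar>1 / \<rho>m - a\<bar> = a / \<rho>m * \<bar>\<rho>m - 1 / a\<bar>"
      using a_pos um by (simp add: abs_mult)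
    also have "a / \<rho>m \<le> a / (1 / (2 * a))"
      using a_pos um lower by (intro divide_left_mono) auto
    then have "a / \<rho>m * \<bar>\<rho>m - 1 / a\<bar> \<le> a / (1 / (2 * a)) * \<bar>\<rho>m - 1 / a\<bar>"
      by (intro mult_right_mono) auto
    finally show ?thesis by (simp add: power2_eq_square mult_ac)
  qed
  moreover have "2 * a\<^sup>2 * \<bar>\<rho>m - 1 / a\<bar> \<le> 2 * a\<^sup>2 * (\<eta> / (8 * a\<^sup>2))"
    using bounds(3) by (intro mult_left_mono) auto
  then have "2 * a\<^sup>2 * \<bar>\<rho>m - 1 / a\<bar> \<le> \<eta> / 4"
    using a_pos by simp
  ultimately show "P (\<rho>m * um) \<and> um / (2 * a) \<le> \<rho>m * um \<and> \<rho>m * um \<le> 2 / a * um \<and>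
      \<bar>1 / \<rho>m - a\<bar> \<le> \<eta> / 4 \<and> \<bar>1 / \<rho>m - a\<bar> \<le> 2 * a\<^sup>2 * \<bar>\<rho>m - 1 / a\<bar>"
    using \<epsilon>_small[of "\<rho>m * um"] by (simp add: order_trans)
qed

lemma small_power2_le:
  assumes "e > 0"
  obtains s where "s > 0" "\<And>\<epsilon>. 0 < \<epsilon> \<Longrightarrow> \<epsilon> \<le> s \<Longrightarrow> small \<epsilon> \<and> \<epsilon>\<^sup>2 \<le> e"
proof (rule that)
  show "min 1 (min (c * \<eta> / (8 * a)) e) > 0"
    using assms c_pos \<eta>_pos a_pos by simp
  fix \<epsilon> :: real assume \<epsilon>: "0 < \<epsilon>" "\<epsilon> \<le> min 1 (min (c * \<eta> / (8 * a)) e)"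
  then have "\<epsilon> * \<epsilon> \<le> 1 * \<epsilon>"
    by (intro mult_right_mono) auto
  then have sq: "\<epsilon>\<^sup>2 \<le> \<epsilon>" by (simp add: power2_eq_square)
  then have "\<epsilon>\<^sup>2 \<le> c * \<eta> / (8 * a)" using \<epsilon> by simp
  then have "8 * a * \<epsilon>\<^sup>2 \<le> c * \<eta>"
    using a_pos by (simp add: field_simps)
  with \<epsilon> sq show "small \<epsilon> \<and> \<epsilon>\<^sup>2 \<le> e"
    by (simp add: small_def)
qed

end

theorem theorem1p3:
  fixes p :: "real \<Rightarrow> real" and n :: nat and r0 \<rho>_plus :: real
  assumes "r0 > 0" and "n \<ge> 2"
    and "smooth_on {0<..} p" and "\<forall>\<rho>>0. deriv p \<rho> > 0"
    and "\<rho>_plus > 0"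
  shows "\<exists>\<epsilon>0>0. \<exists>\<nu>0>0. \<exists>C>0.
    \<comment> \<open>(I)\<close>
    (\<forall>u_minus>0. \<forall>\<rho>_minus>0. \<bar>u_minus\<bar> + \<bar>\<rho>_minus - \<rho>_plus\<bar> \<le> \<epsilon>0 \<longrightarrow>
      (\<exists>\<rho>E uE.
        euler_solution p n r0 \<rho>_plus \<rho>E uE \<and> \<rho>E r0 * uE r0 = \<rho>_minus * u_minus \<and>
        (\<forall>\<rho>E' uE'.
          euler_solution p n r0 \<rho>_plus \<rho>E' uE' \<and> \<rho>E' r0 * uE' r0 = \<rho>_minus * u_minus \<longrightarrow>
          (\<forall>r\<ge>r0. \<rho>E' r = \<rho>E r \<and> uE' r = uE r)) \<and>
        (\<forall>r\<ge>r0.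
          \<bar>\<rho>E r - \<rho>_plus\<bar> \<le> C * \<bar>u_minus\<bar>\<^sup>2 / r ^ (2 * (n - 1)) \<and>
          \<bar>u_minus\<bar> / (C * r ^ (n - 1)) \<le> \<bar>uE r\<bar> \<and>
          \<bar>uE r\<bar> \<le> C * \<bar>u_minus\<bar> / r ^ (n - 1)))) \<and>
    \<comment> \<open>(II)\<close>
    (\<forall>u_minus>0. \<forall>\<rho>_minus>0. \<bar>\<rho>_minus - \<rho>_plus\<bar> + \<bar>u_minus\<bar> \<le> \<epsilon>0 \<longrightarrow>
      (\<forall>\<rho>E uE.
        euler_solution p n r0 \<rho>_plus \<rho>E uE \<and> \<rho>E r0 * uE r0 = \<rho>_minus * u_minus \<longrightarrow>
        (\<exists>\<rho>B uB.
          bl_solution p (\<rho>E r0) (uE r0) \<rho>_minus u_minus \<rho>B uB \<and>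
          (\<forall>\<rho>B' uB'.
            bl_solution p (\<rho>E r0) (uE r0) \<rho>_minus u_minus \<rho>B' uB' \<longrightarrow>
            (\<forall>y\<ge>0. \<rho>B' y = \<rho>B y \<and> uB' y = uB y)) \<and>
          (\<forall>y\<ge>0.
            \<bar>\<rho>B y - \<rho>E r0\<bar>
              \<le> C * exp (- (\<nu>0 / (\<rho>_minus * u_minus)) * y) * (\<bar>u_minus\<bar>\<^sup>2 + \<bar>\<rho>_minus - \<rho>_plus\<bar>) \<and>
            \<bar>uB y - uE r0\<bar>
              \<le> C * exp (- (\<nu>0 / (\<rho>_minus * u_minus)) * y) * (\<bar>u_minus\<bar>\<^sup>2 + \<bar>\<rho>_minus - \<rho>_plus\<bar>))))) \<and>
    \<comment> \<open>(III), uniform convergence\<close>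
    (\<forall>u_minus>0. \<forall>\<rho>_minus>0. \<bar>\<rho>_minus - \<rho>_plus\<bar> + \<bar>u_minus\<bar> \<le> \<epsilon>0 \<longrightarrow>
      (\<forall>\<rho>E uE \<rho>B uB. \<forall>\<rho> u :: real \<Rightarrow> real \<Rightarrow> real.
        euler_solution p n r0 \<rho>_plus \<rho>E uE \<and> \<rho>E r0 * uE r0 = \<rho>_minus * u_minus \<and>
        bl_solution p (\<rho>E r0) (uE r0) \<rho>_minus u_minus \<rho>B uB \<and>
        (\<forall>\<mu>\<in>{0<..1}. ns_solution p n r0 \<mu> \<rho>_plus \<rho>_minus u_minus (\<rho> \<mu>) (u \<mu>)) \<longrightarrow>
        uniform_limit {r0..}
          (\<lambda>\<mu> r. \<rho> \<mu> r - \<rho>E r - \<rho>B ((r - r0) / \<mu>) + \<rho>E r0) (\<lambda>r. 0) (at_right 0) \<and>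
        uniform_limit {r0..}
          (\<lambda>\<mu> r. u \<mu> r - uE r - uB ((r - r0) / \<mu>) + uE r0) (\<lambda>r. 0) (at_right 0))) \<and>
    \<comment> \<open>(III), rate of convergence\<close>
    (\<forall>\<alpha>\<in>{0<..<1}. \<exists>C\<alpha>>0.
      \<forall>u_minus>0. \<forall>\<rho>_minus>0. \<bar>\<rho>_minus - \<rho>_plus\<bar> + \<bar>u_minus\<bar> \<le> \<epsilon>0 \<longrightarrow>
      (\<forall>\<rho>E uE \<rho>B uB. \<forall>\<mu>\<in>{0<..1}. \<forall>\<rho> u.
        euler_solution p n r0 \<rho>_plus \<rho>E uE \<and> \<rho>E r0 * uE r0 = \<rho>_minus * u_minus \<and>
        bl_solution p (\<rho>E r0) (uE r0) \<rho>_minus u_minus \<rho>B uB \<and>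
        ns_solution p n r0 \<mu> \<rho>_plus \<rho>_minus u_minus \<rho> u \<longrightarrow>
        (\<forall>r\<ge>r0.
          \<bar>\<rho> r - \<rho>E r - \<rho>B ((r - r0) / \<mu>) + \<rho>E r0\<bar> \<le> C\<alpha> * \<mu> powr \<alpha> \<and>
          \<bar>u r - uE r - uB ((r - r0) / \<mu>) + uE r0\<bar> \<le> C\<alpha> * \<mu> powr \<alpha>)))"
proof -
  define m where "m = n - 1"
  define a where "a = 1 / \<rho>_plus"
  have "m \<ge> 1" and n: "n = Suc m"
    using \<open>n \<ge> 2\<close> by (auto simp: m_def)
  have "a > 0" and \<rho>_plus: "\<rho>_plus = 1 / a"
    using \<open>\<rho>_plus > 0\<close> by (auto simp: a_def)
  obtain q' q'' \<eta> c L M Q where "barotropic_gas p q' q'' a \<eta> c L M r0 m Q"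
    using barotropic_gas_exists[OF \<open>r0 > 0\<close> \<open>m \<ge> 1\<close> \<open>a > 0\<close>] assms(3,4) by blast
  then interpret barotropic_gas p q' q'' a \<eta> c L M r0 m Q .
  obtain e where e: "e > 0" "\<And>\<epsilon>. \<epsilon>\<^sup>2 \<le> e \<Longrightarrow>
      \<exists>\<rho>E uE. euler_solution p (Suc m) r0 (1 / a) \<rho>E uE \<and> \<rho>E r0 * uE r0 = \<epsilon>"
    using euler_exists by blast
  obtain s where s: "s > 0" "\<And>\<epsilon>. 0 < \<epsilon> \<Longrightarrow> \<epsilon> \<le> s \<Longrightarrow> small \<epsilon> \<and> \<epsilon>\<^sup>2 \<le> e"
    using small_power2_le[OF e(1)] by blast
  define \<epsilon>0 where "\<epsilon>0 = min (1 / (2 * a)) (min (s * a / 2) (\<eta> / (8 * a\<^sup>2)))"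
  have "\<epsilon>0 > 0"
    unfolding \<epsilon>0_def by (rule boundary_data_small(1)[where P = "\<lambda>\<epsilon>. small \<epsilon> \<and> \<epsilon>\<^sup>2 \<le> e", OF s])
  have data: "small (\<rho>m * um)" "(\<rho>m * um)\<^sup>2 \<le> e" "um / (2 * a) \<le> \<rho>m * um" "\<rho>m * um \<le> 2 / a * um"
      "\<bar>1 / \<rho>m - a\<bar> \<le> \<eta> / 4" "\<bar>1 / \<rho>m - a\<bar> \<le> 2 * a\<^sup>2 * \<bar>\<rho>m - \<rho>_plus\<bar>"
    if "um > 0" "\<rho>m > 0" "\<bar>\<rho>m - \<rho>_plus\<bar> + \<bar>um\<bar> \<le> \<epsilon>0" for \<rho>m um
  proof -
    have "um + \<bar>\<rho>m - 1 / a\<bar> \<le> \<epsilon>0"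
      using that unfolding \<rho>_plus by simp
    from boundary_data_small(2)[where P = "\<lambda>\<epsilon>. small \<epsilon> \<and> \<epsilon>\<^sup>2 \<le> e", OF s that(1,2) this[unfolded \<epsilon>0_def]]
    show "small (\<rho>m * um)" "(\<rho>m * um)\<^sup>2 \<le> e" "um / (2 * a) \<le> \<rho>m * um" "\<rho>m * um \<le> 2 / a * um"
      "\<bar>1 / \<rho>m - a\<bar> \<le> \<eta> / 4" "\<bar>1 / \<rho>m - a\<bar> \<le> 2 * a\<^sup>2 * \<bar>\<rho>m - \<rho>_plus\<bar>"
      unfolding \<rho>_plus by blast+
  qed
  \<comment> \<open>\<open>C1\<close> is the Euler density constant 8 / (a c) times 4 / a^2, from
    \<epsilon> \<le> (2 / a) um, times r0^(2 m), from \<theta>^2. \<open>C2\<close> bounds the layer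
    strength by adding the distances of the boundary state and of the Euler state from
    \<open>a\<close>. \<open>C\<close> sums everything, so it also dominates the two velocity
    constants 4 / r0^m and 4 r0^m.\<close>
  define C1 where "C1 = 32 / (a ^ 3 * c) * r0 ^ (2 * m)"
  define C2 where "C2 = 2 * a\<^sup>2 + 8 / (a * c)"
  define C where "C = C1 + 4 / r0 ^ m + 4 * r0 ^ m + (4 / a\<^sup>2 + 1) * C2"
  have pos: "C1 > 0" "C2 > 0" "4 / r0 ^ m > 0" "4 * r0 ^ m > 0" "(4 / a\<^sup>2 + 1) * C2 > 0"
    using \<open>a > 0\<close> \<open>r0 > 0\<close> c_pos by (auto simp: C1_def C2_def intro!: add_pos_pos mult_pos_pos)
  then have C: "C > 0" "C1 \<le> C" "4 / r0 ^ m \<le> C" "4 * r0 ^ m \<le> C" "(4 / a\<^sup>2 + 1) * C2 \<le> C"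
    unfolding C_def by linarith+
  have square_le: "(\<rho>m * um)\<^sup>2 \<le> 4 / a\<^sup>2 * um\<^sup>2" if "\<rho>m * um \<le> 2 / a * um" "0 < \<rho>m" "0 < um" for \<rho>m um
  proof -
    have "(\<rho>m * um)\<^sup>2 \<le> (2 / a * um)\<^sup>2"
      using that by (intro power_mono) auto
    then show ?thesis by (simp add: power_mult_distrib power_divide)
  qed
  have \<theta>_eq: "\<theta> r = r0 ^ m / r ^ m" for r
    by (simp add: \<theta>_def power_divide)

  have I: "\<exists>\<rho>E uE.
      euler_solution p n r0 \<rho>_plus \<rho>E uE \<and> \<rho>E r0 * uE r0 = \<rho>m * um \<and>
      (\<forall>\<rho>E' uE'.
        euler_solution p n r0 \<rho>_plus \<rho>E' uE' \<and> \<rho>E' r0 * uE' r0 = \<rho>m * um \<longrightarrow>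
        (\<forall>r\<ge>r0. \<rho>E' r = \<rho>E r \<and> uE' r = uE r)) \<and>
      (\<forall>r\<ge>r0.
        \<bar>\<rho>E r - \<rho>_plus\<bar> \<le> C * \<bar>um\<bar>\<^sup>2 / r ^ (2 * (n - 1)) \<and>
        \<bar>um\<bar> / (C * r ^ (n - 1)) \<le> \<bar>uE r\<bar> \<and>
        \<bar>uE r\<bar> \<le> C * \<bar>um\<bar> / r ^ (n - 1))"
    if um: "um > 0" and \<rho>m: "\<rho>m > 0" and bound: "\<bar>um\<bar> + \<bar>\<rho>m - \<rho>_plus\<bar> \<le> \<epsilon>0" for um \<rho>m
  proof -
    note data = data[OF um \<rho>m bound[unfolded add.commute[of "\<bar>um\<bar>"]]]
    obtain \<rho>E uE where E: "euler_solution p (Suc m) r0 (1 / a) \<rho>E uE" "\<rho>E r0 * uE r0 = \<rho>m * um"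
      using e(2)[OF data(2)] by blast
    have est: "\<bar>\<rho>E r - \<rho>_plus\<bar> \<le> C * \<bar>um\<bar>\<^sup>2 / r ^ (2 * (n - 1)) \<and>
        \<bar>um\<bar> / (C * r ^ (n - 1)) \<le> \<bar>uE r\<bar> \<and> \<bar>uE r\<bar> \<le> C * \<bar>um\<bar> / r ^ (n - 1)" if r: "r \<ge> r0" for r
    proof (intro conjI)
      have "r > 0" using r \<open>r0 > 0\<close> by simp
      have \<theta>: "\<theta> r > 0" using \<theta>_pos[OF r] .
      have "\<bar>\<rho>E r - 1 / a\<bar> \<le> 8 / (a * c) * (\<rho>m * um)\<^sup>2 * (\<theta> r)\<^sup>2"
        by (rule euler_estimates(1)[OF E data(1) r])
      also have "\<dots> \<le> 8 / (a * c) * (4 / a\<^sup>2 * um\<^sup>2) * (\<theta> r)\<^sup>2"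
        using square_le[OF data(4) \<rho>m um] \<open>a > 0\<close> c_pos
        by (intro mult_right_mono mult_left_mono) auto
      also have "\<dots> = C1 * (um\<^sup>2 / r ^ (2 * m))"
        by (simp add: C1_def \<theta>_eq power_divide power2_eq_square power3_eq_cube mult_2 mult_2_right power_add mult_ac)
      also have "\<dots> \<le> C * (um\<^sup>2 / r ^ (2 * m))"
        using C(2) \<open>r > 0\<close> by (intro mult_right_mono) auto
      finally show "\<bar>\<rho>E r - \<rho>_plus\<bar> \<le> C * \<bar>um\<bar>\<^sup>2 / r ^ (2 * (n - 1))"
        unfolding \<rho>_plus n by simp
      have lower: "\<rho>m * um * \<theta> r * (a / 2) \<le> uE r" and upper: "uE r \<le> \<rho>m * um * \<theta> r * (2 * a)"
        using euler_estimates(2,3)[OF E data(1) r] .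
      have "uE r > 0"
        by (rule less_le_trans[OF _ lower]) (use um \<rho>m \<theta> \<open>a > 0\<close> in simp)
      have "uE r \<le> \<rho>m * um * (\<theta> r * (2 * a))"
        using upper by (simp only: mult.assoc)
      also have "\<dots> \<le> 2 / a * um * (\<theta> r * (2 * a))"
        by (rule mult_right_mono[OF data(4)]) (use \<theta> \<open>a > 0\<close> in simp)
      also have "\<dots> = 4 * r0 ^ m * (um / r ^ m)"
        using \<open>a > 0\<close> by (simp add: \<theta>_eq)
      also have "\<dots> \<le> C * (um / r ^ m)"
        using C(4) \<open>r > 0\<close> um by (intro mult_right_mono) auto
      finally show "\<bar>uE r\<bar> \<le> C * \<bar>um\<bar> / r ^ (n - 1)"
        using \<open>uE r > 0\<close> um by (simp add: n)
      have "um / (C * r ^ m) \<le> um / (4 / r0 ^ m * r ^ m)"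
      proof (rule divide_left_mono)
        have "0 < r ^ m" using \<open>r > 0\<close> by simp
        then show "4 / r0 ^ m * r ^ m \<le> C * r ^ m" "0 < C * r ^ m * (4 / r0 ^ m * r ^ m)"
          by (intro mult_right_mono mult_pos_pos C(1,3) pos(3); simp)+
      qed (use um in simp)
      also have "\<dots> = um / (2 * a) * (\<theta> r * (a / 2))"
        using \<open>a > 0\<close> \<open>r0 > 0\<close> by (simp add: \<theta>_eq)
      also have "\<dots> \<le> \<rho>m * um * (\<theta> r * (a / 2))"
        using data(3) \<theta> \<open>a > 0\<close> by (intro mult_right_mono) auto
      also have "\<dots> \<le> uE r"
        using lower by simp
      finally show "\<bar>um\<bar> / (C * r ^ (n - 1)) \<le> \<bar>uE r\<bar>"
        using \<open>uE r > 0\<close> um by (simp add: n)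
    qed
    show ?thesis
    proof (intro exI conjI allI impI)
      show "euler_solution p n r0 \<rho>_plus \<rho>E uE" "\<rho>E r0 * uE r0 = \<rho>m * um"
        using E unfolding n \<rho>_plus by auto
    next
      fix \<rho>E' uE' r
      assume E': "euler_solution p n r0 \<rho>_plus \<rho>E' uE' \<and> \<rho>E' r0 * uE' r0 = \<rho>m * um" and r: "r0 \<le> r"
      have "euler_solution p (Suc m) r0 (1 / a) \<rho>E' uE'" "\<rho>E' r0 * uE' r0 = \<rho>m * um"
        using E' unfolding n \<rho>_plus by auto
      from euler_unique[OF E this data(1) r] show "\<rho>E' r = \<rho>E r" "uE' r = uE r" by auto
    qed (use est in blast)+
  qed

  have II: "\<exists>\<rho>B uB.
      bl_solution p (\<rho>E r0) (uE r0) \<rho>m um \<rho>B uB \<and>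
      (\<forall>\<rho>B' uB'. bl_solution p (\<rho>E r0) (uE r0) \<rho>m um \<rho>B' uB' \<longrightarrow>
        (\<forall>y\<ge>0. \<rho>B' y = \<rho>B y \<and> uB' y = uB y)) \<and>
      (\<forall>y\<ge>0.
        \<bar>\<rho>B y - \<rho>E r0\<bar> \<le> C * exp (- (c / 2 / (\<rho>m * um)) * y) * (\<bar>um\<bar>\<^sup>2 + \<bar>\<rho>m - \<rho>_plus\<bar>) \<and>
        \<bar>uB y - uE r0\<bar> \<le> C * exp (- (c / 2 / (\<rho>m * um)) * y) * (\<bar>um\<bar>\<^sup>2 + \<bar>\<rho>m - \<rho>_plus\<bar>))"
    if um: "um > 0" and \<rho>m: "\<rho>m > 0" and bound: "\<bar>\<rho>m - \<rho>_plus\<bar> + \<bar>um\<bar> \<le> \<epsilon>0"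
      and EE: "euler_solution p n r0 \<rho>_plus \<rho>E uE \<and> \<rho>E r0 * uE r0 = \<rho>m * um" for um \<rho>m \<rho>E uE
  proof -
    note data = data[OF um \<rho>m bound]
    have E: "euler_solution p (Suc m) r0 (1 / a) \<rho>E uE" "\<rho>E r0 * uE r0 = \<rho>m * um"
      using EE unfolding n \<rho>_plus by auto
    obtain \<rho>B uB where B: "bl_solution p (\<rho>E r0) (uE r0) \<rho>m um \<rho>B uB"
      using bl_exists[OF E data(1) refl data(5) \<rho>m] by blast
    define S where "S = \<bar>um\<bar>\<^sup>2 + \<bar>\<rho>m - \<rho>_plus\<bar>"
    have "S \<ge> 0" by (simp add: S_def)
    have \<delta>: "\<bar>1 / \<rho>m - 1 / \<rho>E r0\<bar> \<le> C2 * S"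
    proof -
      obtain v' N where flow: "flow 0 (\<rho>m * um) (\<lambda>r. 1 / \<rho>E r) v' N"
        using euler_flow[OF E small_le(2)[OF data(1)]] by blast
      have "\<bar>1 / \<rho>E r0 - a\<bar> \<le> 2 * a / c * (\<rho>m * um)\<^sup>2 * (\<theta> r0)\<^sup>2"
        by (rule inviscid_flow_close[OF flow data(1) order_refl])
      also have "\<dots> \<le> 2 * a / c * (4 / a\<^sup>2 * um\<^sup>2)"
        using square_le[OF data(4) \<rho>m um] \<open>a > 0\<close> c_pos by (simp only: \<theta>_r0 power_one mult_1_right) (intro mult_left_mono, auto)
      also have "\<dots> = 8 / (a * c) * um\<^sup>2"
        using \<open>a > 0\<close> by (simp add: power2_eq_square)
      finally have "\<bar>1 / \<rho>m - 1 / \<rho>E r0\<bar> \<le> 2 * a\<^sup>2 * \<bar>\<rho>m - \<rho>_plus\<bar> + 8 / (a * c) * um\<^sup>2"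
        using data(6) by linarith
      also have "\<dots> \<le> C2 * \<bar>\<rho>m - \<rho>_plus\<bar> + C2 * um\<^sup>2"
        using \<open>a > 0\<close> c_pos by (intro add_mono mult_right_mono) (auto simp: C2_def)
      finally show ?thesis by (simp add: S_def algebra_simps)
    qed
    have est: "\<bar>\<rho>B y - \<rho>E r0\<bar> \<le> C * exp (- (c / 2 / (\<rho>m * um)) * y) * S \<and>
        \<bar>uB y - uE r0\<bar> \<le> C * exp (- (c / 2 / (\<rho>m * um)) * y) * S" if "y \<ge> 0" for y
    proof -
      define x where "x = exp (- (c / 2 / (\<rho>m * um)) * y)"
      have "x > 0" by (simp add: x_def)
      have d: "\<bar>1 / \<rho>m - 1 / \<rho>E r0\<bar> * x \<le> C2 * S * x"
        using \<delta> \<open>x > 0\<close> by (intro mult_right_mono) auto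
      have "0 \<le> S * x" using \<open>S \<ge> 0\<close> \<open>x > 0\<close> by simp
      have "4 / a\<^sup>2 * (C2 * S * x) + C2 * S * x = (4 / a\<^sup>2 + 1) * C2 * (S * x)"
        by (simp add: algebra_simps)
      also have "\<dots> \<le> C * (S * x)"
        by (rule mult_right_mono[OF C(5) \<open>0 \<le> S * x\<close>])
      finally have sum: "4 / a\<^sup>2 * (C2 * S * x) + C2 * S * x \<le> C * x * S"
        by (simp add: mult_ac)
      have nonneg: "0 \<le> C2 * S * x" "0 \<le> 4 / a\<^sup>2 * (C2 * S * x)"
        using pos(2) \<open>0 \<le> S * x\<close> by (simp_all add: mult.assoc)
      have "\<bar>\<rho>B y - \<rho>E r0\<bar> \<le> 4 / a\<^sup>2 * (\<bar>1 / \<rho>m - 1 / \<rho>E r0\<bar> * x)"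
        "\<bar>uB y - uE r0\<bar> \<le> \<bar>1 / \<rho>m - 1 / \<rho>E r0\<bar> * x"
        using bl_estimates[OF E data(1) refl data(5) B that] by (auto simp: x_def)
      moreover have "4 / a\<^sup>2 * (\<bar>1 / \<rho>m - 1 / \<rho>E r0\<bar> * x) \<le> 4 / a\<^sup>2 * (C2 * S * x)"
        by (rule mult_left_mono[OF d]) simp
      ultimately show ?thesis
        unfolding x_def[symmetric] using d sum nonneg by linarith
    qed
    show ?thesis
    proof (intro exI conjI allI impI)
      show "bl_solution p (\<rho>E r0) (uE r0) \<rho>m um \<rho>B uB" by (rule B)
    next
      fix \<rho>B' uB' and y :: real
      assume "bl_solution p (\<rho>E r0) (uE r0) \<rho>m um \<rho>B' uB'" "0 \<le> y"
      from bl_unique[OF E data(1) refl data(5) B this]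
      show "\<rho>B' y = \<rho>B y" "uB' y = uB y" by auto
    qed (use est in \<open>auto simp: S_def\<close>)
  qed

  have linear_rate: "\<bar>\<rho> r - \<rho>E r - \<rho>B ((r - r0) / \<mu>) + \<rho>E r0\<bar> \<le> K_total * \<mu> \<and>
      \<bar>u r - uE r - uB ((r - r0) / \<mu>) + uE r0\<bar> \<le> K_total * \<mu>"
    if um: "um > 0" and \<rho>m: "\<rho>m > 0" and bound: "\<bar>\<rho>m - \<rho>_plus\<bar> + \<bar>um\<bar> \<le> \<epsilon>0"
      and E: "euler_solution p n r0 \<rho>_plus \<rho>E uE" "\<rho>E r0 * uE r0 = \<rho>m * um"
      and B: "bl_solution p (\<rho>E r0) (uE r0) \<rho>m um \<rho>B uB"
      and S: "ns_solution p n r0 \<mu> \<rho>_plus \<rho>m um \<rho> u" and "\<mu> > 0" "r \<ge> r0"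
    for um \<rho>m \<rho>E uE \<rho>B uB \<mu> \<rho> u r
    using ns_approximation[OF E(1)[unfolded n \<rho>_plus] E(2) _ refl _ B S[unfolded n \<rho>_plus] \<open>\<mu> > 0\<close> \<open>r \<ge> r0\<close>]
      data[OF um \<rho>m bound] by blast
  have uniform: "uniform_limit {r0..} f (\<lambda>r. 0) (at_right 0)"
    if f: "\<And>\<mu> r. \<mu> \<in> {0<..1} \<Longrightarrow> r \<ge> r0 \<Longrightarrow> \<bar>f \<mu> r\<bar> \<le> K_total * \<mu>" for f :: "real \<Rightarrow> real \<Rightarrow> real"
  proof (rule uniform_limitI)
    fix e :: real assume "e > 0"
    \<comment> \<open>Adding 1 to \<open>K_total\<close> keeps the denominator positive and gives
      the strict inequality needed for the uniform limit.\<close>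
    define d where "d = min 1 (e / (K_total + 1))"
    have "d > 0"
      using \<open>e > 0\<close> K_total_nonneg by (simp add: d_def)
    have "\<forall>r\<in>{r0..}. dist (f \<mu> r) 0 < e" if "0 < \<mu>" "\<mu> < d" for \<mu>
    proof
      fix r assume "r \<in> {r0..}"
      then have "\<bar>f \<mu> r\<bar> \<le> K_total * \<mu>"
        using that by (intro f) (auto simp: d_def)
      also have "\<dots> < (K_total + 1) * \<mu>"
        using that by (simp add: algebra_simps)
      also have "\<dots> < e"
        using that K_total_nonneg by (simp add: d_def field_simps)
      finally show "dist (f \<mu> r) 0 < e" by simp
    qed
    then show "\<forall>\<^sub>F \<mu> in at_right 0. \<forall>r\<in>{r0..}. dist (f \<mu> r) 0 < e"
      using \<open>d > 0\<close> unfolding eventually_at_right_field by blast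
  qed

  show ?thesis
  \<comment> \<open>The decay rate in specific volume, c / 2, is the witness for the layer
    exponent.\<close>
  proof (rule exI[of _ \<epsilon>0], rule conjI[OF \<open>\<epsilon>0 > 0\<close>], rule exI[of _ "c / 2"], rule conjI,
      use c_pos in simp, rule exI[of _ C], rule conjI[OF C(1)], intro conjI, goal_cases)
    case 1
    show ?case
      by (intro allI impI) (rule I)
  next
    case 2
    show ?case
      by (intro allI impI) (rule II)
  next
    case 3
    show ?case
    proof (intro allI impI, elim conjE)
      fix um \<rho>m \<rho>E uE \<rho>B uB and \<rho> u :: "real \<Rightarrow> real \<Rightarrow> real"
      assume um: "um > 0" and \<rho>m: "\<rho>m > 0" and bound: "\<bar>\<rho>m - \<rho>_plus\<bar> + \<bar>um\<bar> \<le> \<epsilon>0"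
        and E: "euler_solution p n r0 \<rho>_plus \<rho>E uE" "\<rho>E r0 * uE r0 = \<rho>m * um"
        and B: "bl_solution p (\<rho>E r0) (uE r0) \<rho>m um \<rho>B uB"
        and S: "\<forall>\<mu>\<in>{0<..1}. ns_solution p n r0 \<mu> \<rho>_plus \<rho>m um (\<rho> \<mu>) (u \<mu>)"
      have "\<bar>\<rho> \<mu> r - \<rho>E r - \<rho>B ((r - r0) / \<mu>) + \<rho>E r0\<bar> \<le> K_total * \<mu>"
        "\<bar>u \<mu> r - uE r - uB ((r - r0) / \<mu>) + uE r0\<bar> \<le> K_total * \<mu>"
        if "\<mu> \<in> {0<..1}" "r \<ge> r0" for \<mu> r
        using linear_rate[OF um \<rho>m bound E B S[rule_format, OF that(1)] _ that(2)] that(1) by auto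
      then show "uniform_limit {r0..} (\<lambda>\<mu> r. \<rho> \<mu> r - \<rho>E r - \<rho>B ((r - r0) / \<mu>) + \<rho>E r0) (\<lambda>r. 0) (at_right 0) \<and>
          uniform_limit {r0..} (\<lambda>\<mu> r. u \<mu> r - uE r - uB ((r - r0) / \<mu>) + uE r0) (\<lambda>r. 0) (at_right 0)"
        by (intro conjI uniform)
    qed
  next
    case 4
    show ?case (is "\<forall>\<alpha>\<in>_. ?rate \<alpha>")
    proof
      fix \<alpha> :: real assume \<alpha>: "\<alpha> \<in> {0<..<1}"
      have rate: "\<bar>\<rho> r - \<rho>E r - \<rho>B ((r - r0) / \<mu>) + \<rho>E r0\<bar> \<le> (K_total + 1) * \<mu> powr \<alpha> \<and>
          \<bar>u r - uE r - uB ((r - r0) / \<mu>) + uE r0\<bar> \<le> (K_total + 1) * \<mu> powr \<alpha>"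
        if *: "um > 0" "\<rho>m > 0" "\<bar>\<rho>m - \<rho>_plus\<bar> + \<bar>um\<bar> \<le> \<epsilon>0" and \<mu>: "\<mu> \<in> {0<..1}"
          and sol: "euler_solution p n r0 \<rho>_plus \<rho>E uE \<and> \<rho>E r0 * uE r0 = \<rho>m * um \<and>
            bl_solution p (\<rho>E r0) (uE r0) \<rho>m um \<rho>B uB \<and> ns_solution p n r0 \<mu> \<rho>_plus \<rho>m um \<rho> u"
          and r: "r0 \<le> r" for um \<rho>m \<rho>E uE \<rho>B uB \<mu> \<rho> u r
      proof -
        \<comment> \<open>For \<mu> in (0, 1] the linear rate implies every rate with exponent
          \<alpha> < 1, with a constant that does not depend on \<alpha>.\<close>
        have "\<mu> powr 1 \<le> \<mu> powr \<alpha>"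
          using \<mu> \<alpha> by (intro powr_mono') auto
        then have "\<mu> \<le> \<mu> powr \<alpha>"
          using \<mu> by simp
        then have "K_total * \<mu> \<le> (K_total + 1) * \<mu> powr \<alpha>"
          using K_total_nonneg \<mu> by (intro mult_mono) auto
        moreover have "\<mu> > 0" using \<mu> by simp
        ultimately show ?thesis
          using linear_rate[OF * _ _ _ _ _ r, of \<rho>E uE \<rho>B uB \<mu> \<rho> u] sol by fastforce
      qed
      show "?rate \<alpha>"
      proof (rule exI[of _ "K_total + 1"], rule conjI)
        show "K_total + 1 > 0" using K_total_nonneg by simp
      qed (intro allI impI ballI, rule rate)
    qed
  qed
qed

end
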